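(* A pair $(\Gamma,G)\in\mathcal{OG}(4)$ is basic of independent-cycle type if and only if, up to isomorphism of graph-group pairs, it is one of the following, where $p$ and $q$ denote arbitrary odd primes (possibly equal): 1. $(\Gamma(r,s),\,G(r,s))$ with $(r,s)$ of the form $(4,p)$, $(p,4)$ or $(p,q)$; 2. $(\Gamma^{+}(r,s),\,G^{+}(r,s))$ with $(r,s)$ of the form $(4,4)$, $(4,2p)$ or $(2p,4)$; 3. $(\Gamma(r,s),\,H(r,s))$ with $(r,s)$ of the form $(p,4)$ or $(p,2q)$; 4. $(\Gamma^{+}(r,s),\,H^{+}(r,s))$ with $(r,s)$ of the form $(4,4)$, $(4,2p)$, $(2p,4)$ or $(2p,2q)$; 5. $(\Gamma_{2}(r,s),\,G_{2}(r,s))$ with $(r,s)$ of the form $(p,q)$.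
   Context: All graphs are finite and simple. An arc of a graph is an ordered pair of adjacent vertices. $\mathcal{OG}(4)$ is the family of pairs $(\Gamma,G)$ where $\Gamma$ is a finite connected 4-valent graph and $G\le \mathrm{Aut}(\Gamma)$ is transitive on vertices and on edges of $\Gamma$, but not transitive on arcs. Two graph-group pairs $(\Gamma,G)$, $(\Gamma',G')$ are isomorphic if there is a graph isomorphism $f:\Gamma\to\Gamma'$ with $fGf^{-1}=G'$. Normal quotients. For $N$ normal in $G$, $\Gamma_N$ is the simple graph whose vertices are the $N$-orbits on $V\Gamma$, two distinct orbits being adjacent iff there is at least one edge of $\Gamma$ between them. $\widetilde N$ denotes the kernel of the action of $G$ on the set of $N$-orbits. $\mathbf{C}_r$ ($r\ge3$) is the cycle graph on $r$ vertices. The pair $(\Gamma,G)\in\mathcal{OG}(4)$ is basic if for every nontrivial normal subgroup $N$ of $G$, $\Gamma_N$ is isomorphic to $K_1$, $K_2$ or $\mathbf{C}_r$ for some $r\ge 3$. A cyclic normal quotient is a normal quotient $\Gamma_N$ (with $N\neq1$) isomorphic to some $\mathbf{C}_r$, $r\ge3$. Two cyclic normal quotients $\Gamma_M,\Gamma_N$ are independent if, with $K=\widetilde M\cap\widetilde N$, the quotient $\Gamma_K$ is not a cycle (if $K=1$ then $\Gamma_K=\Gamma$). A pair $(\Gamma,G)\in\mathcal{OG}(4)$ is basic of independent-cycle type if it is basic and has two independent cyclic normal quotients. Graphs and groups. Let $r,s\ge3$ be integers. $\Gamma(r,s)$ has vertex set $X=\mathbb{Z}_r\times\mathbb{Z}_s$,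 with $(i,j)$ adjacent to the four vertices $(i\pm1,j\pm1)$ (signs independent). Define permutations of $X$: $\mu:(i,j)\mapsto(i+1,j)$, $\nu:(i,j)\mapsto(i,j+1)$, $\sigma:(i,j)\mapsto(-i,j)$, $\tau:(i,j)\mapsto(-i,-j)$. Put $G(r,s)=\langle\mu,\nu,\sigma\rangle$, and for $s$ even $H(r,s)=\langle\mu,\sigma\nu,\tau\rangle$. If $r,s$ are both even, let $X^+=\{(i,j)\in X: i,j \text{ of the same parity}\}$, let $\Gamma^+(r,s)$ be the subgraph of $\Gamma(r,s)$ induced on $X^+$, and let $G^+(r,s)=\langle\mu^2,\mu\nu,\sigma\rangle$ and $H^+(r,s)=\langle\mu^2,\sigma\mu\nu,\tau\rangle$, acting on $X^+$ by restriction. $\Gamma_2(r,s)$ is the standard double cover of $\Gamma(r,s)$: its vertex set is $X_2=\{x_\delta: x\in X,\delta\in\mathbb{Z}_2\}$, with $(i,j)_\delta$ adjacent to the four vertices $(i\pm1,j\pm1)_{\delta+1}$. On $X_2$ define $\mu:(i,j)_\delta\mapsto(i+1,j)_\delta$, $\nu:(i,j)_\delta\mapsto(i,j+1)_\delta$, $\sigma:(i,j)_\delta\mapsto(i,-j)_{\delta+1}$, $\tau:(i,j)_\delta\mapsto(-i,-j)_\delta$, and let $G_2(r,s)=\langle\mu,\nu,\sigma,\tau\rangle$ (these four permutations of $X_2$). *)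

theory Defs
  imports
    "Graph_Theory.Graph_Theory"
    "HOL-Algebra.Group_Action"
    "HOL-Algebra.Generated_Groups"
    "HOL-Computational_Algebra.Primes"
begin

text \<open>
  Finite simple graphs are symmetric loop-free pair digraphs (locale \<^locale>\<open>pair_graph\<close>), so that
  the set \<^term>\<open>parcs \<Gamma>\<close> consists exactly of the ordered pairs of adjacent vertices.
  Permutations of a set \<open>V\<close> are the extensional bijections that form \<^term>\<open>BijGroup V\<close>; its
  multiplication is composition, the right factor being applied first.
\<close>

section \<open>Graphs, automorphisms and isomorphisms\<close>

definition graph_iso :: "('a \<Rightarrow> 'b) \<Rightarrow> 'a pair_pre_digraph \<Rightarrow> 'b pair_pre_digraph \<Rightarrow> bool" where
  "graph_iso f \<Gamma> \<Delta> \<longleftrightarrow>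
     bij_betw f (pverts \<Gamma>) (pverts \<Delta>) \<and>
     (\<forall>u\<in>pverts \<Gamma>. \<forall>v\<in>pverts \<Gamma>. (u, v) \<in> parcs \<Gamma> \<longleftrightarrow> (f u, f v) \<in> parcs \<Delta>)"

definition perm_group :: "'a set \<Rightarrow> ('a \<Rightarrow> 'a) set \<Rightarrow> ('a \<Rightarrow> 'a) monoid" where
  "perm_group V G = (BijGroup V)\<lparr>carrier := G\<rparr>"

definition graph_Aut :: "'a pair_pre_digraph \<Rightarrow> ('a \<Rightarrow> 'a) set" where
  "graph_Aut \<Gamma> = {f \<in> extensional (pverts \<Gamma>). graph_iso f \<Gamma> \<Gamma>}"

definition graph_group_pair :: "'a pair_pre_digraph \<Rightarrow> ('a \<Rightarrow> 'a) set \<Rightarrow> bool" where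
  "graph_group_pair \<Gamma> G \<longleftrightarrow>
     pair_graph \<Gamma> \<and> subgroup G (perm_group (pverts \<Gamma>) (graph_Aut \<Gamma>))"

text \<open>The image on the left of the last equation is \<open>f G f\<^sup>-\<^sup>1\<close>, a set of permutations of the vertices of \<open>\<Delta>\<close>.\<close>

definition pair_iso ::
  "'a pair_pre_digraph \<Rightarrow> ('a \<Rightarrow> 'a) set \<Rightarrow> 'b pair_pre_digraph \<Rightarrow> ('b \<Rightarrow> 'b) set \<Rightarrow> bool" where
  "pair_iso \<Gamma> G \<Delta> H \<longleftrightarrow>
     (\<exists>f. graph_iso f \<Gamma> \<Delta> \<and>
          (\<lambda>g. \<lambda>y\<in>pverts \<Delta>. f (g (inv_into (pverts \<Gamma>) f y))) ` G = H)"

definition graph_edges :: "'a pair_pre_digraph \<Rightarrow> 'a set set" where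
  "graph_edges \<Gamma> = {{u, v} | u v. (u, v) \<in> parcs \<Gamma>}"

definition transitive_on :: "'g set \<Rightarrow> ('g \<Rightarrow> 'x \<Rightarrow> 'x) \<Rightarrow> 'x set \<Rightarrow> bool" where
  "transitive_on G \<phi> X \<longleftrightarrow> (\<forall>x\<in>X. \<forall>y\<in>X. \<exists>g\<in>G. \<phi> g x = y)"

definition OG4 :: "'a pair_pre_digraph \<Rightarrow> ('a \<Rightarrow> 'a) set \<Rightarrow> bool" where
  "OG4 \<Gamma> G \<longleftrightarrow>
     graph_group_pair \<Gamma> G \<and>
     Digraph_Component.connected (with_proj \<Gamma>) \<and>
     (\<forall>v\<in>pverts \<Gamma>. out_degree (with_proj \<Gamma>) v = 4) \<and>
     transitive_on G (\<lambda>g. g) (pverts \<Gamma>) \<and>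
     transitive_on G (\<lambda>g e. g ` e) (graph_edges \<Gamma>) \<and>
     \<not> transitive_on G (\<lambda>g. map_prod g g) (parcs \<Gamma>)"


section \<open>Normal quotients\<close>

definition perm_orbits :: "'a set \<Rightarrow> ('a \<Rightarrow> 'a) set \<Rightarrow> 'a set set" where
  "perm_orbits V N = orbits (perm_group V N) V (\<lambda>g. g)"

definition quotient_graph :: "'a pair_pre_digraph \<Rightarrow> ('a \<Rightarrow> 'a) set \<Rightarrow> 'a set pair_pre_digraph" where
  "quotient_graph \<Gamma> N =
     \<lparr>pverts = perm_orbits (pverts \<Gamma>) N,
      parcs = {(A, B). A \<in> perm_orbits (pverts \<Gamma>) N \<and> B \<in> perm_orbits (pverts \<Gamma>) N \<and>
                       A \<noteq> B \<and> (\<exists>u\<in>A. \<exists>v\<in>B. (u, v) \<in> parcs \<Gamma>)}\<rparr>"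

definition orbit_kernel :: "'a set \<Rightarrow> ('a \<Rightarrow> 'a) set \<Rightarrow> ('a \<Rightarrow> 'a) set \<Rightarrow> ('a \<Rightarrow> 'a) set" where
  "orbit_kernel V G N = {g \<in> G. \<forall>B\<in>perm_orbits V N. g ` B = B}"

definition cycle_graph :: "nat \<Rightarrow> int pair_pre_digraph" where
  "cycle_graph r =
     \<lparr>pverts = {0..<int r},
      parcs = {(i, j). i \<in> {0..<int r} \<and> (j = (i + 1) mod int r \<or> j = (i - 1) mod int r)}\<rparr>"

definition is_cycle_graph :: "'a pair_pre_digraph \<Rightarrow> bool" where
  "is_cycle_graph \<Gamma> \<longleftrightarrow> (\<exists>r\<ge>3. \<exists>f. graph_iso f \<Gamma> (cycle_graph r))"

definition nontrivial_normal :: "'a set \<Rightarrow> ('a \<Rightarrow> 'a) set \<Rightarrow> ('a \<Rightarrow> 'a) set \<Rightarrow> bool" where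
  "nontrivial_normal V G N \<longleftrightarrow>
     N \<lhd> perm_group V G \<and> N \<noteq> {\<one>\<^bsub>perm_group V G\<^esub>}"

definition OG4_basic :: "'a pair_pre_digraph \<Rightarrow> ('a \<Rightarrow> 'a) set \<Rightarrow> bool" where
  "OG4_basic \<Gamma> G \<longleftrightarrow>
     OG4 \<Gamma> G \<and>
     (\<forall>N. nontrivial_normal (pverts \<Gamma>) G N \<longrightarrow>
        K\<^bsub>1\<^esub> (with_proj (quotient_graph \<Gamma> N)) \<or>
        K\<^bsub>2\<^esub> (with_proj (quotient_graph \<Gamma> N)) \<or>
        is_cycle_graph (quotient_graph \<Gamma> N))"

definition cyclic_normal_quotient ::
  "'a pair_pre_digraph \<Rightarrow> ('a \<Rightarrow> 'a) set \<Rightarrow> ('a \<Rightarrow> 'a) set \<Rightarrow> bool" where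
  "cyclic_normal_quotient \<Gamma> G N \<longleftrightarrow>
     nontrivial_normal (pverts \<Gamma>) G N \<and> is_cycle_graph (quotient_graph \<Gamma> N)"

text \<open>
  For \<open>K = 1\<close> the vertices of \<^term>\<open>quotient_graph \<Gamma> K\<close> are the singletons of vertices of \<open>\<Gamma>\<close>, so this
  quotient is \<open>\<Gamma>\<close> up to isomorphism.
\<close>

definition independent_quotients ::
  "'a pair_pre_digraph \<Rightarrow> ('a \<Rightarrow> 'a) set \<Rightarrow> ('a \<Rightarrow> 'a) set \<Rightarrow> ('a \<Rightarrow> 'a) set \<Rightarrow> bool" where
  "independent_quotients \<Gamma> G M N \<longleftrightarrow>
     \<not> is_cycle_graph
         (quotient_graph \<Gamma> (orbit_kernel (pverts \<Gamma>) G M \<inter> orbit_kernel (pverts \<Gamma>) G N))"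

definition basic_independent_cycle_type :: "'a pair_pre_digraph \<Rightarrow> ('a \<Rightarrow> 'a) set \<Rightarrow> bool" where
  "basic_independent_cycle_type \<Gamma> G \<longleftrightarrow>
     OG4_basic \<Gamma> G \<and>
     (\<exists>M N. cyclic_normal_quotient \<Gamma> G M \<and> cyclic_normal_quotient \<Gamma> G N \<and>
            independent_quotients \<Gamma> G M N)"


section \<open>The graphs and groups\<close>

text \<open>The integers modulo \<open>n\<close> are represented by the residues \<^term>\<open>{0..<int n}\<close>.\<close>

definition X_set :: "nat \<Rightarrow> nat \<Rightarrow> (int \<times> int) set" where
  "X_set r s = {0..<int r} \<times> {0..<int s}"

definition Gam :: "nat \<Rightarrow> nat \<Rightarrow> (int \<times> int) pair_pre_digraph" where
  "Gam r s =
     \<lparr>pverts = X_set r s,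
      parcs = {((i, j), ((i + a) mod int r, (j + b) mod int s)) | i j a b.
                 (i, j) \<in> X_set r s \<and> a \<in> {1, -1} \<and> b \<in> {1, -1}}\<rparr>"

definition mu :: "nat \<Rightarrow> nat \<Rightarrow> int \<times> int \<Rightarrow> int \<times> int" where
  "mu r s = (\<lambda>(i, j)\<in>X_set r s. ((i + 1) mod int r, j))"

definition nu :: "nat \<Rightarrow> nat \<Rightarrow> int \<times> int \<Rightarrow> int \<times> int" where
  "nu r s = (\<lambda>(i, j)\<in>X_set r s. (i, (j + 1) mod int s))"

definition sigma :: "nat \<Rightarrow> nat \<Rightarrow> int \<times> int \<Rightarrow> int \<times> int" where
  "sigma r s = (\<lambda>(i, j)\<in>X_set r s. ((- i) mod int r, j))"

definition tau :: "nat \<Rightarrow> nat \<Rightarrow> int \<times> int \<Rightarrow> int \<times> int" where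
  "tau r s = (\<lambda>(i, j)\<in>X_set r s. ((- i) mod int r, (- j) mod int s))"

definition G_grp :: "nat \<Rightarrow> nat \<Rightarrow> (int \<times> int \<Rightarrow> int \<times> int) set" where
  "G_grp r s = generate (BijGroup (X_set r s)) {mu r s, nu r s, sigma r s}"

definition H_grp :: "nat \<Rightarrow> nat \<Rightarrow> (int \<times> int \<Rightarrow> int \<times> int) set" where
  "H_grp r s =
     generate (BijGroup (X_set r s))
       {mu r s, sigma r s \<otimes>\<^bsub>BijGroup (X_set r s)\<^esub> nu r s, tau r s}"

text \<open>
  The following four definitions are meant for even \<open>r\<close> and \<open>s\<close>, when the parity of a residue is that
  of its representative.
\<close>

definition X_plus :: "nat \<Rightarrow> nat \<Rightarrow> (int \<times> int) set" where
  "X_plus r s = {(i, j) \<in> X_set r s. even i \<longleftrightarrow> even j}"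

definition Gam_plus :: "nat \<Rightarrow> nat \<Rightarrow> (int \<times> int) pair_pre_digraph" where
  "Gam_plus r s =
     \<lparr>pverts = X_plus r s, parcs = parcs (Gam r s) \<inter> X_plus r s \<times> X_plus r s\<rparr>"

definition G_plus_grp :: "nat \<Rightarrow> nat \<Rightarrow> (int \<times> int \<Rightarrow> int \<times> int) set" where
  "G_plus_grp r s =
     (\<lambda>g. restrict g (X_plus r s)) `
       generate (BijGroup (X_set r s))
         {mu r s [^]\<^bsub>BijGroup (X_set r s)\<^esub> (2::nat),
          mu r s \<otimes>\<^bsub>BijGroup (X_set r s)\<^esub> nu r s,
          sigma r s}"

text \<open>
  Since \<open>\<mu>\<^sup>2\<close> is one of the generators, reading the product \<open>\<sigma>\<mu>\<nu>\<close> in the opposite order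
  gives the same group \<open>H\<^sup>+(r,s)\<close>.
\<close>

definition H_plus_grp :: "nat \<Rightarrow> nat \<Rightarrow> (int \<times> int \<Rightarrow> int \<times> int) set" where
  "H_plus_grp r s =
     (\<lambda>g. restrict g (X_plus r s)) `
       generate (BijGroup (X_set r s))
         {mu r s [^]\<^bsub>BijGroup (X_set r s)\<^esub> (2::nat),
          sigma r s \<otimes>\<^bsub>BijGroup (X_set r s)\<^esub> mu r s \<otimes>\<^bsub>BijGroup (X_set r s)\<^esub> nu r s,
          tau r s}"

definition double_cover :: "'a pair_pre_digraph \<Rightarrow> ('a \<times> int) pair_pre_digraph" where
  "double_cover \<Gamma> =
     \<lparr>pverts = pverts \<Gamma> \<times> {0..<2},
      parcs = {((x, d), (y, (d + 1) mod 2)) | x y d. (x, y) \<in> parcs \<Gamma> \<and> d \<in> {0..<2}}\<rparr>"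

definition X2_set :: "nat \<Rightarrow> nat \<Rightarrow> ((int \<times> int) \<times> int) set" where
  "X2_set r s = X_set r s \<times> {0..<2}"

definition Gam2 :: "nat \<Rightarrow> nat \<Rightarrow> ((int \<times> int) \<times> int) pair_pre_digraph" where
  "Gam2 r s = double_cover (Gam r s)"

definition mu2 :: "nat \<Rightarrow> nat \<Rightarrow> (int \<times> int) \<times> int \<Rightarrow> (int \<times> int) \<times> int" where
  "mu2 r s = (\<lambda>((i, j), d)\<in>X2_set r s. (((i + 1) mod int r, j), d))"

definition nu2 :: "nat \<Rightarrow> nat \<Rightarrow> (int \<times> int) \<times> int \<Rightarrow> (int \<times> int) \<times> int" where
  "nu2 r s = (\<lambda>((i, j), d)\<in>X2_set r s. ((i, (j + 1) mod int s), d))"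

text \<open>Unlike \<open>\<sigma>\<close> on \<open>X\<close>, which negates the first coordinate, \<open>\<sigma>\<close> on \<open>X\<^sub>2\<close> negates the second.\<close>

definition sigma2 :: "nat \<Rightarrow> nat \<Rightarrow> (int \<times> int) \<times> int \<Rightarrow> (int \<times> int) \<times> int" where
  "sigma2 r s = (\<lambda>((i, j), d)\<in>X2_set r s. ((i, (- j) mod int s), (d + 1) mod 2))"

definition tau2 :: "nat \<Rightarrow> nat \<Rightarrow> (int \<times> int) \<times> int \<Rightarrow> (int \<times> int) \<times> int" where
  "tau2 r s = (\<lambda>((i, j), d)\<in>X2_set r s. (((- i) mod int r, (- j) mod int s), d))"

definition G2_grp :: "nat \<Rightarrow> nat \<Rightarrow> ((int \<times> int) \<times> int \<Rightarrow> (int \<times> int) \<times> int) set" where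
  "G2_grp r s = generate (BijGroup (X2_set r s)) {mu2 r s, nu2 r s, sigma2 r s, tau2 r s}"

end

(*
  Lift everything to the lattice L = {(x, y). x + y even} with (x, y) adjacent to (x +- 1, y +- 1).
  Two independent cyclic normal quotients give G-equivariant coordinates alpha, beta modulo r and s
  which separate the elements of G, because a nontrivial common kernel K would make Gamma_K a cycle.
  A vertex stabilizer therefore embeds in {1, -1}^2; it acts freely on the out-neighbours and on the
  in-neighbours, and as there are four neighbours it has order 2.  Up to exchanging the coordinates
  its generator is (x, y) -> (-x, y) or (x, y) -> (-x, -y).  Adding an element that moves a vertex to
  an out-neighbour, one obtains all maps (x, y) -> (+-x + a, y + b) with (a, b) in L in the first
  case, and all maps (x, y) -> (e1 x + a, e2 y + b) with (a, b) in L and e1 e2 = (-1)^a in the second.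
  So (Gamma, G) is the quotient of L and of this group by those of its translations (a, b) with r | a
  and s | b, and each pair of the theorem is such a quotient.  Doubling an odd parameter often does
  not change the translations: cases 3 and 5 are instances of case 4, and the parameters (4, p) and
  (p, 4) of case 1 are instances of case 2.  Being basic means that no larger lattice of translations
  has a quotient of valency 4, which restricts r and s; conversely, a commutator computation shows
  that every nontrivial normal subgroup contains one of the translations (2, 0), (0, 2), or both
  (2, 2) and (4, 0), and then its quotient has valency at most 2.
*)

theory Submission
  imports Defs
begin

section \<open>Permutation groups\<close>

text \<open>The obstacle in the classification is that a basic pair carries no lattice: the
  labelling \<open>\<pi>\<close> has to be produced by the group. It is read off a base vertex x0,
  as \<open>\<pi> x y\<close> = g x0 for any g whose coordinate action has translation part (x, y);
  two such elements are equal or differ by the stabilizer generator g0, which fixes x0. That this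
  covers all of G depends on the signs of an element h moving x0 to an out-neighbour. Composing h
  with g0 leaves two sign patterns, and the wrong one has to be excluded. With a reflection g0, an h
  reversing \<beta> would confine \<beta> to two values although s is at least 3. With the rotation
  g0, an h keeping both signs satisfies h g0 h = g0, so h g0 exchanges the ends of an arc and G
  would be arc-transitive. Once \<open>\<pi>\<close> exists, a pair is determined up to isomorphism
  by the flag \<open>B\<close> and the translations in the kernel, and the rest is arithmetic of
  these translations. Both moduli odd without \<open>B\<close> stays a separate case: the kernel
  then contains a translation with odd entries, and neither modulus can be doubled.\<close>

locale perm_grp =
  fixes V :: "'a set" and G :: "('a \<Rightarrow> 'a) set"
  assumes subset_Bij: "G \<subseteq> Bij V"
    and ex_id: "\<exists>e\<in>G. \<forall>x\<in>V. e x = x"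
    and ex_comp: "\<lbrakk>g \<in> G; h \<in> G\<rbrakk> \<Longrightarrow> \<exists>k\<in>G. \<forall>x\<in>V. k x = g (h x)"
    and ex_inverse: "g \<in> G \<Longrightarrow> \<exists>h\<in>G. \<forall>x\<in>V. h (g x) = x"
begin

lemma bij: "g \<in> G \<Longrightarrow> bij_betw g V V"
  using subset_Bij by (auto simp: Bij_def)

lemma closed [simp]: "\<lbrakk>g \<in> G; x \<in> V\<rbrakk> \<Longrightarrow> g x \<in> V"
  using subset_Bij Bij_imp_funcset by blast

lemma surj: "\<lbrakk>g \<in> G; y \<in> V\<rbrakk> \<Longrightarrow> \<exists>x\<in>V. g x = y"
  using bij by (metis bij_betw_imp_surj_on imageE)

lemma ext: "\<lbrakk>g \<in> G; h \<in> G; \<And>x. x \<in> V \<Longrightarrow> g x = h x\<rbrakk> \<Longrightarrow> g = h"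
  using subset_Bij by (metis (no_types, lifting) Bij_imp_extensional extensionalityI subsetD)

lemma ex_inv:
  assumes "g \<in> G"
  shows "\<exists>h\<in>G. (\<forall>x\<in>V. h (g x) = x) \<and> (\<forall>x\<in>V. g (h x) = x)"
proof -
  obtain h where h: "h \<in> G" "\<forall>x\<in>V. h (g x) = x"
    using ex_inverse[OF assms] by blast
  have "g (h x) = x" if x: "x \<in> V" for x
    using surj[OF assms x] h by auto
  with h show ?thesis by blast
qed

lemma id_mem: "(\<lambda>x\<in>V. x) \<in> G"
proof -
  obtain e where "e \<in> G" "\<forall>x\<in>V. e x = x" using ex_id by blast
  then have "e = (\<lambda>x\<in>V. x)"
    using subset_Bij by (intro extensionalityI[of _ V]) (auto simp: Bij_def)
  with \<open>e \<in> G\<close> show ?thesis by simp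
qed

lemma trivial_iff: "G = {\<lambda>x\<in>V. x} \<longleftrightarrow> (\<forall>g\<in>G. \<forall>x\<in>V. g x = x)"
proof
  assume *: "\<forall>g\<in>G. \<forall>x\<in>V. g x = x"
  have "g = (\<lambda>x\<in>V. x)" if "g \<in> G" for g
    by (rule ext[OF that id_mem]) (use * that in simp)
  with id_mem show "G = {\<lambda>x\<in>V. x}" by blast
qed auto

definition orb :: "'a \<Rightarrow> 'a set" where
  "orb x = {g x | g. g \<in> G}"

lemma orb_self: "x \<in> V \<Longrightarrow> x \<in> orb x"
  using ex_id unfolding orb_def by (metis (mono_tags, lifting) mem_Collect_eq)

lemma orb_subset: "x \<in> V \<Longrightarrow> orb x \<subseteq> V"
  by (auto simp: orb_def)

lemma orb_eq_iff:
  assumes "x \<in> V" "y \<in> V"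
  shows "orb x = orb y \<longleftrightarrow> (\<exists>g\<in>G. g x = y)"
proof
  assume "orb x = orb y"
  with orb_self[OF assms(2)] have "y \<in> orb x" by simp
  then show "\<exists>g\<in>G. g x = y" by (auto simp: orb_def)
next
  have sub: "orb (g z) \<subseteq> orb z" if "g \<in> G" "z \<in> V" for g z
  proof
    fix w assume "w \<in> orb (g z)"
    then obtain h where "h \<in> G" "w = h (g z)" by (auto simp: orb_def)
    moreover obtain k where "k \<in> G" "\<forall>x\<in>V. k x = h (g x)"
      using ex_comp[of h g] \<open>h \<in> G\<close> \<open>g \<in> G\<close> by blast
    ultimately have "k \<in> G" "w = k z" using that by auto
    then show "w \<in> orb z" by (auto simp: orb_def)
  qed
  assume "\<exists>g\<in>G. g x = y"
  then obtain g where g: "g \<in> G" "g x = y" by blast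
  obtain h where h: "h \<in> G" "\<forall>x\<in>V. h (g x) = x" using ex_inv[OF g(1)] by blast
  show "orb x = orb y"
    using sub[of g x] sub[of h y] g h assms by auto
qed

lemma mem_orb_iff:
  assumes "x \<in> V"
  shows "y \<in> orb x \<longleftrightarrow> y \<in> V \<and> orb y = orb x"
proof -
  have "y \<in> orb x \<longleftrightarrow> (\<exists>g\<in>G. g x = y)" by (auto simp: orb_def)
  then show ?thesis using orb_eq_iff[OF assms, of y] orb_subset[OF assms] by blast
qed

lemma perm_orbits_eq: "perm_orbits V G = orb ` V"
  by (auto simp: perm_orbits_def orbits_def orbit_def orb_def perm_group_def)

end

text \<open>Bridge to the library's subgroups. The pointwise laws of \<open>perm_grp\<close> allow
  elements to be evaluated at vertices without expanding products and inverses of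
  \<open>BijGroup V\<close>.\<close>

lemma subgroup_Bij_iff_perm_grp: "subgroup G (BijGroup V) \<longleftrightarrow> perm_grp V G"
proof
  interpret B: group "BijGroup V" by (rule group_BijGroup)
  assume S: "subgroup G (BijGroup V)"
  then have sub: "G \<subseteq> Bij V" by (simp add: subgroup_def BijGroup_def)
  show "perm_grp V G"
  proof
    show "G \<subseteq> Bij V" by fact
    show "\<exists>e\<in>G. \<forall>x\<in>V. e x = x"
      using subgroup.one_closed[OF S] by (auto simp: BijGroup_def intro!: bexI[of _ "\<lambda>x\<in>V. x"])
    show "\<exists>k\<in>G. \<forall>x\<in>V. k x = g (h x)" if "g \<in> G" "h \<in> G" for g h
    proof (rule bexI[of _ "compose V g h"])
      have "g \<in> Bij V" "h \<in> Bij V" using that sub by auto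
      then show "compose V g h \<in> G"
        using subgroup.m_closed[OF S that] by (simp add: BijGroup_def)
    qed (simp add: compose_def)
    show "\<exists>h\<in>G. \<forall>x\<in>V. h (g x) = x" if "g \<in> G" for g
    proof (rule bexI[of _ "restrict (inv_into V g) V"])
      have g: "g \<in> Bij V" using that sub by auto
      then show "restrict (inv_into V g) V \<in> G"
        using subgroup.m_inv_closed[OF S that] by (simp add: inv_BijGroup)
      show "\<forall>x\<in>V. restrict (inv_into V g) V (g x) = x"
        using g by (auto simp: Bij_def bij_betw_def)
    qed
  qed
next
  interpret B: group "BijGroup V" by (rule group_BijGroup)
  assume "perm_grp V G"
  then interpret perm_grp V G .
  show "subgroup G (BijGroup V)"
  proof (rule B.subgroupI)
    show "G \<subseteq> carrier (BijGroup V)" using subset_Bij by (simp add: BijGroup_def)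
    show "G \<noteq> {}" using ex_id by blast
  next
    fix g assume g: "g \<in> G"
    obtain h where h: "h \<in> G" "\<forall>x\<in>V. h (g x) = x" using ex_inv[OF g] by blast
    have "compose V h g = (\<lambda>x\<in>V. x)" using h by (auto simp: compose_def)
    then have "inv\<^bsub>BijGroup V\<^esub> g = h"
      using g h subset_Bij by (intro B.inv_equality) (auto simp: BijGroup_def)
    with h show "inv\<^bsub>BijGroup V\<^esub> g \<in> G" by simp
  next
    fix g h assume gh: "g \<in> G" "h \<in> G"
    obtain k where k: "k \<in> G" "\<forall>x\<in>V. k x = g (h x)" using ex_comp[OF gh] by blast
    have "k = compose V g h"
      using k subset_Bij by (intro extensionalityI[of _ V]) (auto simp: compose_def Bij_def)
    with k gh subset_Bij show "g \<otimes>\<^bsub>BijGroup V\<^esub> h \<in> G" by (auto simp: BijGroup_def)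
  qed
qed

section \<open>Automorphism groups and normality in pointwise form\<close>

lemma graph_Aut_subset_Bij: "graph_Aut \<Gamma> \<subseteq> Bij (pverts \<Gamma>)"
  by (auto simp: graph_Aut_def Bij_def graph_iso_def)

lemma perm_grp_graph_Aut: "perm_grp (pverts \<Gamma>) (graph_Aut \<Gamma>)"
proof
  let ?V = "pverts \<Gamma>"
  show "graph_Aut \<Gamma> \<subseteq> Bij ?V" by (rule graph_Aut_subset_Bij)
  show "\<exists>e\<in>graph_Aut \<Gamma>. \<forall>x\<in>?V. e x = x"
    by (rule bexI[of _ "\<lambda>x\<in>?V. x"]) (auto simp: graph_Aut_def graph_iso_def bij_betw_def inj_on_def)
  show "\<exists>k\<in>graph_Aut \<Gamma>. \<forall>x\<in>?V. k x = g (h x)" if "g \<in> graph_Aut \<Gamma>" "h \<in> graph_Aut \<Gamma>" for g h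
  proof (rule bexI[of _ "compose ?V g h"])
    have "bij_betw (compose ?V g h) ?V ?V"
      using that by (auto simp: graph_Aut_def graph_iso_def intro: bij_betw_compose)
    moreover have "h x \<in> ?V" if "x \<in> ?V" for x
      using that \<open>h \<in> graph_Aut \<Gamma>\<close> by (auto simp: graph_Aut_def graph_iso_def bij_betw_def)
    ultimately show "compose ?V g h \<in> graph_Aut \<Gamma>"
      using that by (auto simp: graph_Aut_def graph_iso_def compose_def)
  qed (auto simp: compose_def)
  show "\<exists>h\<in>graph_Aut \<Gamma>. \<forall>x\<in>?V. h (g x) = x" if g: "g \<in> graph_Aut \<Gamma>" for g
  proof (rule bexI[of _ "restrict (inv_into ?V g) ?V"])
    let ?h = "inv_into ?V g"
    have b: "bij_betw g ?V ?V" using g by (auto simp: graph_Aut_def graph_iso_def)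
    then show "\<forall>x\<in>?V. restrict ?h ?V (g x) = x"
      by (auto simp: bij_betw_def)
    have gh: "g (?h x) = x" "?h x \<in> ?V" if "x \<in> ?V" for x
      using b that by (auto simp: bij_betw_def f_inv_into_f inv_into_into)
    have "bij_betw (restrict ?h ?V) ?V ?V"
      using b by (simp add: bij_betw_inv_into)
    moreover have "(?h u, ?h v) \<in> parcs \<Gamma> \<longleftrightarrow> (u, v) \<in> parcs \<Gamma>" if "u \<in> ?V" "v \<in> ?V" for u v
      using g gh that by (auto simp: graph_Aut_def graph_iso_def)
    ultimately show "restrict ?h ?V \<in> graph_Aut \<Gamma>"
      by (auto simp: graph_Aut_def graph_iso_def)
  qed
qed

lemma graph_group_pair_iff:
  "graph_group_pair \<Gamma> G \<longleftrightarrow> pair_graph \<Gamma> \<and> perm_grp (pverts \<Gamma>) G \<and>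
     (\<forall>g\<in>G. \<forall>u\<in>pverts \<Gamma>. \<forall>v\<in>pverts \<Gamma>. (u, v) \<in> parcs \<Gamma> \<longleftrightarrow> (g u, g v) \<in> parcs \<Gamma>)"
proof -
  interpret B: group "BijGroup (pverts \<Gamma>)" by (rule group_BijGroup)
  have A: "subgroup (graph_Aut \<Gamma>) (BijGroup (pverts \<Gamma>))"
    using perm_grp_graph_Aut subgroup_Bij_iff_perm_grp by blast
  have 1: "subgroup G (perm_group (pverts \<Gamma>) (graph_Aut \<Gamma>)) \<longleftrightarrow>
        subgroup G (BijGroup (pverts \<Gamma>)) \<and> G \<subseteq> graph_Aut \<Gamma>"
    unfolding perm_group_def
    using B.incl_subgroup[OF A] B.subgroup_incl[OF _ A] subgroup.subset by fastforce
  have 2: "G \<subseteq> graph_Aut \<Gamma> \<longleftrightarrow>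
      (\<forall>g\<in>G. \<forall>u\<in>pverts \<Gamma>. \<forall>v\<in>pverts \<Gamma>. (u, v) \<in> parcs \<Gamma> \<longleftrightarrow> (g u, g v) \<in> parcs \<Gamma>)"
    if "perm_grp (pverts \<Gamma>) G"
    using perm_grp.subset_Bij[OF that] by (auto simp: graph_Aut_def graph_iso_def Bij_def)
  show ?thesis
    unfolding graph_group_pair_def 1 subgroup_Bij_iff_perm_grp using 2 by blast
qed

text \<open>The equation n' (g x) = g (n x) says that n' is the conjugate of n by g; in this form no
  inverse has to be evaluated.\<close>

lemma (in perm_grp) nontrivial_normal_iff:
  "nontrivial_normal V G N \<longleftrightarrow> perm_grp V N \<and> N \<subseteq> G \<and>
     (\<forall>g\<in>G. \<forall>n\<in>N. \<exists>n'\<in>N. \<forall>x\<in>V. n' (g x) = g (n x)) \<and> (\<exists>n\<in>N. \<exists>x\<in>V. n x \<noteq> x)"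
proof -
  interpret B: group "BijGroup V" by (rule group_BijGroup)
  have A: "subgroup G (BijGroup V)"
    using subgroup_Bij_iff_perm_grp perm_grp_axioms by blast
  let ?P = "perm_group V G"
  interpret P: group ?P unfolding perm_group_def by (rule B.subgroup_imp_group[OF A])
  have id: "\<one>\<^bsub>?P\<^esub> = (\<lambda>x\<in>V. x)" by (simp add: perm_group_def BijGroup_def)
  have sub: "subgroup N ?P \<longleftrightarrow> perm_grp V N \<and> N \<subseteq> G"
    unfolding perm_group_def subgroup_Bij_iff_perm_grp[symmetric]
    using B.incl_subgroup[OF A] B.subgroup_incl[OF _ A] subgroup.subset by fastforce
  have conj: "g \<otimes>\<^bsub>?P\<^esub> n \<otimes>\<^bsub>?P\<^esub> inv\<^bsub>?P\<^esub> g \<in> N \<longleftrightarrow> (\<exists>n'\<in>N. \<forall>x\<in>V. n' (g x) = g (n x))"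
    if g: "g \<in> G" and n: "n \<in> N" and N: "perm_grp V N" "N \<subseteq> G" for g n
  proof
    have car: "carrier ?P = G" by (simp add: perm_group_def)
    have mult: "x \<otimes>\<^bsub>?P\<^esub> y = compose V x y" if "x \<in> G" "y \<in> G" for x y
      using that subset_Bij by (auto simp: perm_group_def BijGroup_def)
    let ?c = "g \<otimes>\<^bsub>?P\<^esub> n \<otimes>\<^bsub>?P\<^esub> inv\<^bsub>?P\<^esub> g"
    have nG: "n \<in> G" using n N by blast
    have gn: "g \<otimes>\<^bsub>?P\<^esub> n \<in> G" using P.m_closed g nG car by simp
    have ig: "inv\<^bsub>?P\<^esub> g \<in> G" using P.inv_closed g car by simp
    have cG: "?c \<in> G" using P.m_closed gn ig car by simp
    have eq: "?c \<otimes>\<^bsub>?P\<^esub> g = g \<otimes>\<^bsub>?P\<^esub> n"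
    proof -
      have "?c \<otimes>\<^bsub>?P\<^esub> g = (g \<otimes>\<^bsub>?P\<^esub> n) \<otimes>\<^bsub>?P\<^esub> (inv\<^bsub>?P\<^esub> g \<otimes>\<^bsub>?P\<^esub> g)"
        by (rule P.m_assoc) (use gn ig g car in simp_all)
      then show ?thesis using P.l_inv[of g] P.r_one[of "g \<otimes>\<^bsub>?P\<^esub> n"] g gn car by simp
    qed
    have pt: "?c (g x) = g (n x)" if "x \<in> V" for x
    proof -
      have "compose V ?c g x = compose V g n x" using eq mult[OF cG g] mult[OF g nG] by simp
      then show ?thesis using that by (simp add: compose_def)
    qed
    then show "\<exists>n'\<in>N. \<forall>x\<in>V. n' (g x) = g (n x)" if "?c \<in> N" using that by blast
    assume "\<exists>n'\<in>N. \<forall>x\<in>V. n' (g x) = g (n x)"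
    then obtain n' where n': "n' \<in> N" "\<forall>x\<in>V. n' (g x) = g (n x)" by blast
    have "n' y = ?c y" if "y \<in> V" for y
      using surj[OF g that] n' pt by auto
    then have "n' = ?c" using ext n' N cG by blast
    then show "?c \<in> N" using n' by simp
  qed
  have nt: "N \<noteq> {\<one>\<^bsub>?P\<^esub>} \<longleftrightarrow> (\<exists>n\<in>N. \<exists>x\<in>V. n x \<noteq> x)" if "perm_grp V N"
    unfolding id using perm_grp.trivial_iff[OF that] by blast
  have car: "carrier ?P = G" by (simp add: perm_group_def)
  show ?thesis
  proof (cases "perm_grp V N \<and> N \<subseteq> G")
    case True
    then have "(\<forall>g\<in>G. \<forall>n\<in>N. g \<otimes>\<^bsub>?P\<^esub> n \<otimes>\<^bsub>?P\<^esub> inv\<^bsub>?P\<^esub> g \<in> N) \<longleftrightarrow>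
        (\<forall>g\<in>G. \<forall>n\<in>N. \<exists>n'\<in>N. \<forall>x\<in>V. n' (g x) = g (n x))"
      by (intro ball_cong refl conj) auto
    with True nt show ?thesis
      unfolding nontrivial_normal_def P.normal_inv_iff sub car by simp
  next
    case False
    then show ?thesis
      unfolding nontrivial_normal_def P.normal_inv_iff sub by blast
  qed
qed

section \<open>Quotients of the infinite square lattice\<close>

text \<open>For \<open>B\<close> the last clause says e1 e2 = (-1)^a. Both sides are multiplicative
  under composition, because signs are odd, so these maps form a group. The parity of a + b keeps
  the set of points with even coordinate sum invariant.\<close>

definition admissible :: "bool \<Rightarrow> int \<Rightarrow> int \<Rightarrow> int \<Rightarrow> int \<Rightarrow> bool" where
  "admissible B e1 e2 a b \<longleftrightarrow>
     \<bar>e1\<bar> = 1 \<and> \<bar>e2\<bar> = 1 \<and> even (a + b) \<and> (if B then e1 = e2 \<longleftrightarrow> even a else e2 = 1)"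

lemma abs_eq_one_odd: "\<bar>a\<bar> = 1 \<Longrightarrow> odd a" for a :: int
  by (cases "a \<ge> 0") auto

lemma admissible_parity:
  assumes "admissible B e1 e2 a b" "even (x + y)"
  shows "even ((e1 * x + a) + (e2 * y + b))"
proof -
  have "odd e1" "odd e2" "even (a + b)"
    using assms(1) abs_eq_one_odd by (auto simp: admissible_def)
  with assms(2) show ?thesis by (auto simp: even_add even_mult_iff)
qed

definition lattice_arcs :: "(int \<Rightarrow> int \<Rightarrow> 'a) \<Rightarrow> 'a rel" where
  "lattice_arcs \<pi> = {(\<pi> x y, \<pi> (x + a) (y + b)) | x y a b. even (x + y) \<and> \<bar>a\<bar> = 1 \<and> \<bar>b\<bar> = 1}"

text \<open>A relation rather than a function of g: adding a kernel translation to (a, b) describes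
  the same permutation.\<close>

definition acts :: "(int \<Rightarrow> int \<Rightarrow> 'a) \<Rightarrow> ('a \<Rightarrow> 'a) \<Rightarrow> int \<Rightarrow> int \<Rightarrow> int \<Rightarrow> int \<Rightarrow> bool" where
  "acts \<pi> g e1 e2 a b \<longleftrightarrow> (\<forall>x y. even (x + y) \<longrightarrow> g (\<pi> x y) = \<pi> (e1 * x + a) (e2 * y + b))"

text \<open>
  Only the values \<open>\<pi> x y\<close> with \<open>x + y\<close> even are meaningful. The flag \<open>B\<close> selects one of the two groups
  of affine maps: \<open>B\<close> holds for \<open>H\<close>, \<open>H\<^sup>+\<close> and \<open>G\<^sub>2\<close>, whose linear parts are tied to the parity of the
  translation part, so that a pure translation has even entries; hence the condition on \<open>x - x'\<close>.
\<close>

locale lattice_cover =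
  fixes B :: bool and r s :: nat
    and \<Gamma> :: "'a pair_pre_digraph" and G :: "('a \<Rightarrow> 'a) set"
    and \<pi> :: "int \<Rightarrow> int \<Rightarrow> 'a"
  assumes verts: "pverts \<Gamma> = {\<pi> x y | x y. even (x + y)}"
    and eq_iff: "\<lbrakk>even (x + y); even (x' + y')\<rbrakk> \<Longrightarrow>
      \<pi> x y = \<pi> x' y' \<longleftrightarrow> int r dvd x - x' \<and> int s dvd y - y' \<and> (B \<longrightarrow> even (x - x'))"
    and arcs: "parcs \<Gamma> = lattice_arcs \<pi>"
    and ex_acts: "admissible B e1 e2 a b \<Longrightarrow>
      \<exists>g\<in>G. acts \<pi> g e1 e2 a b"
    and acts_ex: "g \<in> G \<Longrightarrow>
      \<exists>e1 e2 a b. admissible B e1 e2 a b \<and>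
        acts \<pi> g e1 e2 a b"
    and extensional: "G \<subseteq> extensional (pverts \<Gamma>)"
begin

lemma mem_verts [intro]: "even (x + y) \<Longrightarrow> \<pi> x y \<in> pverts \<Gamma>"
  using verts by blast

lemma vertsE:
  assumes "v \<in> pverts \<Gamma>"
  obtains x y where "even (x + y)" "v = \<pi> x y"
  using assms verts by blast

text \<open>An arc comes with some representative of its tail; since equality of labels is invariant
  under adding the same step, the step can be taken at the given representative instead.\<close>

lemma arc_iff:
  assumes "even (x + y)" "even (x' + y')"
  shows "(\<pi> x y, \<pi> x' y') \<in> parcs \<Gamma> \<longleftrightarrow>
    (\<exists>a b. \<bar>a\<bar> = 1 \<and> \<bar>b\<bar> = 1 \<and> \<pi> x' y' = \<pi> (x + a) (y + b))" (is "?L \<longleftrightarrow> ?R")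
proof
  assume ?L
  then obtain u v a b where *: "\<pi> x y = \<pi> u v" "\<pi> x' y' = \<pi> (u + a) (v + b)" "even (u + v)"
    "\<bar>a\<bar> = 1" "\<bar>b\<bar> = 1"
    unfolding arcs lattice_arcs_def by blast
  then have "\<pi> (u + a) (v + b) = \<pi> (x + a) (y + b)"
    using eq_iff[of x y u v] eq_iff[of "u + a" "v + b" "x + a" "y + b"] assms
    by (simp add: abs_eq_one_odd dvd_diff_commute)
  with * show ?R by auto
next
  assume ?R
  then show ?L using assms(1) unfolding arcs lattice_arcs_def by blast
qed

lemma arcE:
  assumes "(\<pi> x y, v) \<in> parcs \<Gamma>" "even (x + y)"
  obtains a b where "\<bar>a\<bar> = 1" "\<bar>b\<bar> = 1" "v = \<pi> (x + a) (y + b)"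
proof -
  obtain x' y' where "even (x' + y')" "v = \<pi> x' y'"
  proof -
    obtain u w a b where "v = \<pi> (u + a) (w + b)" "even (u + w)" "\<bar>a\<bar> = 1" "\<bar>b\<bar> = 1"
      using assms(1) unfolding arcs lattice_arcs_def by blast
    moreover from this have "even ((u + a) + (w + b))" by (simp add: abs_eq_one_odd)
    ultimately show thesis using that by blast
  qed
  with arc_iff[of x y x' y'] assms that show thesis by blast
qed

lemma arcI: "\<lbrakk>even (x + y); \<bar>a\<bar> = 1; \<bar>b\<bar> = 1\<rbrakk> \<Longrightarrow> (\<pi> x y, \<pi> (x + a) (y + b)) \<in> parcs \<Gamma>"
  unfolding arcs lattice_arcs_def by blast

end

text \<open>Only the set of kernel translations matters, not the moduli that cut it out. This is
  what identifies an odd modulus with its double.\<close>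

lemma lattice_cover_change:
  assumes "lattice_cover B r s \<Gamma> G \<pi>"
    and "\<And>x y. even (x + y) \<Longrightarrow>
      (int r dvd x \<and> int s dvd y \<and> (B \<longrightarrow> even x)) \<longleftrightarrow> (int r' dvd x \<and> int s' dvd y \<and> (B \<longrightarrow> even x))"
  shows "lattice_cover B r' s' \<Gamma> G \<pi>"
proof -
  interpret lattice_cover B r s \<Gamma> G \<pi> by fact
  show ?thesis
  proof
    fix x y x' y' :: int
    assume e: "even (x + y)" "even (x' + y')"
    then have "even ((x - x') + (y - y'))" by presburger
    from assms(2)[OF this] eq_iff[OF e]
    show "\<pi> x y = \<pi> x' y' \<longleftrightarrow> int r' dvd x - x' \<and> int s' dvd y - y' \<and> (B \<longrightarrow> even (x - x'))" by blast
  qed (fact verts arcs extensional | (rule ex_acts acts_ex, assumption))+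
qed

text \<open>Which labels name the same vertex depends on \<open>B\<close>, r and s only, so sending
  \<open>\<pi> x y\<close> to \<open>\<rho> x y\<close> is a bijection; arcs and group elements are
  described in terms of labels and follow along.\<close>

lemma lattice_cover_unique:
  assumes "lattice_cover B r s \<Gamma> G \<pi>" and "lattice_cover B r s \<Delta> H \<rho>"
  shows "pair_iso \<Gamma> G \<Delta> H"
proof -
  interpret \<Gamma>: lattice_cover B r s \<Gamma> G \<pi> by fact
  interpret \<Delta>: lattice_cover B r s \<Delta> H \<rho> by fact
  have eq: "\<pi> x y = \<pi> x' y' \<longleftrightarrow> \<rho> x y = \<rho> x' y'" if "even (x + y)" "even (x' + y')" for x y x' y'
    unfolding \<Gamma>.eq_iff[OF that] \<Delta>.eq_iff[OF that] ..
  \<comment> \<open>A vertex has many labels, but all of them have the same value under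
    \<open>\<rho>\<close>; outside the range of \<open>\<pi>\<close> any w will do.\<close>
  have "\<exists>w. \<forall>x y. even (x + y) \<longrightarrow> v = \<pi> x y \<longrightarrow> w = \<rho> x y" for v
    using eq by (cases "\<exists>x y. even (x + y) \<and> v = \<pi> x y") blast+
  then obtain f where "\<forall>v. \<forall>x y. even (x + y) \<longrightarrow> v = \<pi> x y \<longrightarrow> f v = \<rho> x y"
    by metis
  then have f: "f (\<pi> x y) = \<rho> x y" if "even (x + y)" for x y using that by blast
  have inj: "inj_on f (pverts \<Gamma>)"
    by (rule inj_onI) (metis \<Gamma>.vertsE eq f)
  have img: "f ` pverts \<Gamma> = pverts \<Delta>"
    unfolding \<Gamma>.verts \<Delta>.verts using f by (auto simp: image_iff) metis+
  have iso: "graph_iso f \<Gamma> \<Delta>"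
    unfolding graph_iso_def
  proof (intro conjI ballI)
    show "bij_betw f (pverts \<Gamma>) (pverts \<Delta>)" using inj img by (simp add: bij_betw_def)
    fix u v assume "u \<in> pverts \<Gamma>" "v \<in> pverts \<Gamma>"
    then obtain x y x' y' where uv: "even (x + y)" "u = \<pi> x y" "even (x' + y')" "v = \<pi> x' y'"
      by (metis \<Gamma>.vertsE)
    have "\<pi> x' y' = \<pi> (x + a) (y + b) \<longleftrightarrow> \<rho> x' y' = \<rho> (x + a) (y + b)"
      if "\<bar>a\<bar> = 1" "\<bar>b\<bar> = 1" for a b
      by (rule eq) (use uv that in \<open>simp_all add: abs_eq_one_odd\<close>)
    then have ex: "(\<exists>a b. \<bar>a\<bar> = 1 \<and> \<bar>b\<bar> = 1 \<and> \<pi> x' y' = \<pi> (x + a) (y + b)) \<longleftrightarrow>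
        (\<exists>a b. \<bar>a\<bar> = 1 \<and> \<bar>b\<bar> = 1 \<and> \<rho> x' y' = \<rho> (x + a) (y + b))"
      by blast
    have fu: "f u = \<rho> x y" and fv: "f v = \<rho> x' y'" using f uv by auto
    show "(u, v) \<in> parcs \<Gamma> \<longleftrightarrow> (f u, f v) \<in> parcs \<Delta>"
      unfolding fu fv unfolding uv(2,4) \<Gamma>.arc_iff[OF uv(1,3)] \<Delta>.arc_iff[OF uv(1,3)] by (fact ex)
  qed
  let ?c = "\<lambda>g. \<lambda>y\<in>pverts \<Delta>. f (g (inv_into (pverts \<Gamma>) f y))"
  have inv: "inv_into (pverts \<Gamma>) f (\<rho> x y) = \<pi> x y" if "even (x + y)" for x y
    using inv_into_f_f[OF inj \<Gamma>.mem_verts[OF that]] f[OF that] by simp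
  have c: "?c g = h"
    if "admissible B e1 e2 a b" "h \<in> H"
      "acts \<pi> g e1 e2 a b"
      "acts \<rho> h e1 e2 a b" for g h e1 e2 a b
  proof (rule extensionalityI[of _ "pverts \<Delta>"])
    show "h \<in> extensional (pverts \<Delta>)" using \<Delta>.extensional that(2) by blast
    fix v assume v: "v \<in> pverts \<Delta>"
    then obtain x y where xy: "even (x + y)" "v = \<rho> x y" by (metis \<Delta>.vertsE)
    moreover note admissible_parity[OF that(1) xy(1)]
    ultimately show "?c g v = h v"
      using v inv f that(3,4) by (simp add: acts_def)
  qed simp
  have "?c ` G = H"
  proof (intro equalityI subsetI)
    fix k assume "k \<in> ?c ` G"
    then obtain g where g: "g \<in> G" "k = ?c g" by blast
    obtain e1 e2 a b where ok: "admissible B e1 e2 a b"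
      and ga: "acts \<pi> g e1 e2 a b"
      using \<Gamma>.acts_ex[OF g(1)] by blast
    obtain h where "h \<in> H" "acts \<rho> h e1 e2 a b"
      using \<Delta>.ex_acts[OF ok] by blast
    with c[OF ok _ ga] g show "k \<in> H" by simp
  next
    fix h assume h: "h \<in> H"
    obtain e1 e2 a b where ok: "admissible B e1 e2 a b"
      and ha: "acts \<rho> h e1 e2 a b"
      using \<Delta>.acts_ex[OF h] by blast
    obtain g where "g \<in> G" "acts \<pi> g e1 e2 a b"
      using \<Gamma>.ex_acts[OF ok] by blast
    with c[OF ok h _ ha] show "h \<in> ?c ` G" by blast
  qed
  with iso show ?thesis unfolding pair_iso_def by blast
qed

text \<open>The labels are pulled back along the isomorphism f. Conjugation by f carries G onto H,
  so each lattice map acts on one side exactly when it acts on the other.\<close>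

lemma lattice_cover_transport:
  assumes "graph_group_pair \<Gamma> G" and "pair_iso \<Gamma> G \<Delta> H" and "lattice_cover B r s \<Delta> H \<rho>"
  shows "\<exists>\<pi>. lattice_cover B r s \<Gamma> G \<pi>"
proof -
  interpret \<Delta>: lattice_cover B r s \<Delta> H \<rho> by fact
  let ?V = "pverts \<Gamma>"
  interpret perm_grp ?V G using assms(1) graph_group_pair_iff by blast
  interpret pair_graph \<Gamma> using assms(1) graph_group_pair_iff by blast
  let ?c = "\<lambda>f g. \<lambda>y\<in>pverts \<Delta>. f (g (inv_into ?V f y))"
  obtain f where f: "graph_iso f \<Gamma> \<Delta>" and cG: "?c f ` G = H"
    using assms(2) unfolding pair_iso_def by blast
  have bij: "bij_betw f ?V (pverts \<Delta>)" using f by (simp add: graph_iso_def)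
  define \<pi> where "\<pi> x y = inv_into ?V f (\<rho> x y)" for x y
  have \<pi>V: "\<pi> x y \<in> ?V" and f\<pi>: "f (\<pi> x y) = \<rho> x y" if "even (x + y)" for x y
    using bij \<Delta>.mem_verts[OF that] unfolding \<pi>_def
    by (auto simp: bij_betw_def intro!: inv_into_into f_inv_into_f)
  have V\<pi>: "\<exists>x y. even (x + y) \<and> v = \<pi> x y" if "v \<in> ?V" for v
  proof -
    have "f v \<in> pverts \<Delta>" using bij that by (auto simp: bij_betw_def)
    then obtain x y where "even (x + y)" "f v = \<rho> x y" using \<Delta>.vertsE by blast
    moreover from this have "v = \<pi> x y"
      using inv_into_f_f[of f ?V v] bij that unfolding \<pi>_def by (auto simp: bij_betw_def)
    ultimately show ?thesis by blast
  qed
  have \<pi>eq: "u = v \<longleftrightarrow> f u = f v" if "u \<in> ?V" "v \<in> ?V" for u v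
    using bij that by (auto simp: bij_betw_def inj_on_def)
  have acts: "acts \<pi> g e1 e2 a b \<longleftrightarrow>
     acts \<rho> (?c f g) e1 e2 a b"
    if "g \<in> G" "admissible B e1 e2 a b" for g e1 e2 a b
  proof -
    have "g (\<pi> x y) = \<pi> (e1 * x + a) (e2 * y + b) \<longleftrightarrow> ?c f g (\<rho> x y) = \<rho> (e1 * x + a) (e2 * y + b)"
      if xy: "even (x + y)" for x y
    proof -
      have ev: "even ((e1 * x + a) + (e2 * y + b))"
        using xy \<open>admissible B e1 e2 a b\<close> by (rule admissible_parity[rotated])
      have "?c f g (\<rho> x y) = f (g (\<pi> x y))" using \<Delta>.mem_verts[OF xy] by (simp add: \<pi>_def)
      then show ?thesis
        using \<pi>eq[OF closed[OF \<open>g \<in> G\<close> \<pi>V[OF xy]] \<pi>V[OF ev]] f\<pi>[OF ev] by simp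
    qed
    then show ?thesis unfolding acts_def by blast
  qed
  have "lattice_cover B r s \<Gamma> G \<pi>"
  proof
    show "?V = {\<pi> x y | x y. even (x + y)}" using \<pi>V V\<pi> by blast
    show "\<pi> x y = \<pi> x' y' \<longleftrightarrow> int r dvd x - x' \<and> int s dvd y - y' \<and> (B \<longrightarrow> even (x - x'))"
      if "even (x + y)" "even (x' + y')" for x y x' y'
      using \<pi>eq[OF \<pi>V[OF that(1)] \<pi>V[OF that(2)]] f\<pi> that \<Delta>.eq_iff[OF that] by simp
    have arc: "(\<pi> x y, \<pi> x' y') \<in> parcs \<Gamma> \<longleftrightarrow> (\<rho> x y, \<rho> x' y') \<in> parcs \<Delta>"
      if "even (x + y)" "even (x' + y')" for x y x' y'
      using f \<pi>V f\<pi> that by (simp add: graph_iso_def)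
    show "parcs \<Gamma> = lattice_arcs \<pi>"
    proof (intro equalityI subsetI)
      fix e assume e: "e \<in> parcs \<Gamma>"
      obtain u v where uv: "e = (u, v)" by (cases e)
      with e have "u \<in> ?V" "v \<in> ?V" using in_arcsD1 in_arcsD2 by blast+
      then obtain x y x' y' where *: "even (x + y)" "u = \<pi> x y" "even (x' + y')" "v = \<pi> x' y'"
        using V\<pi> by metis
      with e uv arc have "(\<rho> x y, \<rho> x' y') \<in> parcs \<Delta>" by simp
      then obtain a b where ab: "\<bar>a\<bar> = 1" "\<bar>b\<bar> = 1" "\<rho> x' y' = \<rho> (x + a) (y + b)"
        using \<Delta>.arc_iff * by blast
      then have "\<pi> x' y' = \<pi> (x + a) (y + b)" by (simp add: \<pi>_def)
      with ab * uv show "e \<in> lattice_arcs \<pi>" unfolding lattice_arcs_def by blast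
    next
      fix e assume "e \<in> lattice_arcs \<pi>"
      then obtain x y a b where *: "e = (\<pi> x y, \<pi> (x + a) (y + b))" "even (x + y)"
        "\<bar>a\<bar> = 1" "\<bar>b\<bar> = 1" unfolding lattice_arcs_def by blast
      then have "even ((x + a) + (y + b))" by (simp add: abs_eq_one_odd)
      with * \<Delta>.arcI arc show "e \<in> parcs \<Gamma>" by blast
    qed
    show "\<exists>g\<in>G. acts \<pi> g e1 e2 a b"
      if ok: "admissible B e1 e2 a b" for e1 e2 a b
    proof -
      obtain h where "h \<in> H" "acts \<rho> h e1 e2 a b"
        using \<Delta>.ex_acts[OF ok] by blast
      with cG obtain g where "g \<in> G" "h = ?c f g" by blast
      then show ?thesis
        using acts[OF _ ok] \<open>acts \<rho> h e1 e2 a b\<close> by blast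
    qed
    show "\<exists>e1 e2 a b. admissible B e1 e2 a b \<and>
        acts \<pi> g e1 e2 a b" if "g \<in> G" for g
    proof -
      have "?c f g \<in> H" using cG that by blast
      then obtain e1 e2 a b where "admissible B e1 e2 a b"
        "acts \<rho> (?c f g) e1 e2 a b"
        using \<Delta>.acts_ex by blast
      with acts[OF that] show ?thesis by blast
    qed
    show "G \<subseteq> extensional ?V" using subset_Bij by (auto simp: Bij_def)
  qed
  then show ?thesis by blast
qed

section \<open>Generators\<close>

lemma admissible_cases:
  assumes "admissible B e1 e2 a b"
  obtains (shift) "e1 = 1" "e2 = 1" "even (a + b)" "B \<longrightarrow> even a"
  | (reflect) "\<not> B" "e1 = -1" "e2 = 1" "even (a + b)"
  | (rotate) "B" "e1 = -1" "e2 = -1" "even a" "even b"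
  | (glide1) "B" "e1 = -1" "e2 = 1" "odd a" "odd b"
  | (glide2) "B" "e1 = 1" "e2 = -1" "odd a" "odd b"
proof -
  have "e1 = 1 \<or> e1 = -1" "e2 = 1 \<or> e2 = -1" using assms by (auto simp: admissible_def)
  with assms that show thesis by (auto simp: admissible_def split: if_splits)
qed

lemma admissible_comp:
  assumes "admissible B e1 e2 a b" "admissible B e1' e2' a' b'"
  shows "admissible B (e1 * e1') (e2 * e2') (e1 * a' + a) (e2 * b' + b)"
  using assms by (elim admissible_cases) (auto simp: admissible_def)

lemma admissible_inv:
  assumes "admissible B e1 e2 a b"
  shows "admissible B e1 e2 (- e1 * a) (- e2 * b)"
  using assms by (elim admissible_cases) (auto simp: admissible_def)

text \<open>A closure principle serving both directions: the model groups are known through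
  generators, the abstract groups through a stabilizer generator and one step along an arc. In each
  case these two maps already give all admissible maps.\<close>

lemma admissible_generated:
  fixes Q :: "int \<Rightarrow> int \<Rightarrow> int \<Rightarrow> int \<Rightarrow> bool"
  assumes comp: "\<And>e1 e2 a b e1' e2' a' b'. \<lbrakk>Q e1 e2 a b; Q e1' e2' a' b'\<rbrakk> \<Longrightarrow>
      Q (e1 * e1') (e2 * e2') (e1 * a' + a) (e2 * b' + b)"
    and inv: "\<And>e1 e2 a b. \<lbrakk>Q e1 e2 a b; \<bar>e1\<bar> = 1; \<bar>e2\<bar> = 1\<rbrakk> \<Longrightarrow> Q e1 e2 (- e1 * a) (- e2 * b)"
    and refl: "Q (-1) (if B then -1 else 1) 0 0"
    and step: "Q (if B then -1 else 1) 1 1 1"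
    and adm: "admissible B e1 e2 a b"
  shows "Q e1 e2 a b"
proof -
  have zero: "Q 1 1 0 0" using comp[OF refl refl] by (cases B) auto
  have add: "Q 1 1 (u + u') (v + v')" if "Q 1 1 u v" "Q 1 1 u' v'" for u v u' v'
    using comp[OF that] by (simp add: add.commute)
  have neg: "Q 1 1 (- u) (- v)" if "Q 1 1 u v" for u v
    using inv[OF that] by simp
  have mult: "Q 1 1 (k * u) (k * v)" if "Q 1 1 u v" for k u v
  proof (induction k rule: int_induct[where k = 0])
    case base
    show ?case using zero by simp
  next
    case (step1 i)
    from add[OF step1(2) that] show ?case by (simp add: algebra_simps)
  next
    case (step2 i)
    from add[OF step2(2) neg[OF that]] show ?case by (simp add: algebra_simps)
  qed
  \<comment> \<open>With \<open>B\<close>, the squares of the two glides are (0, 2) and (2, 0).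
    Otherwise conjugating the step by the reflection gives (-1, 1), and the sum and difference with
    (1, 1) are the required translations.\<close>
  have two1: "Q 1 1 2 0" and two2: "Q 1 1 0 2"
  proof -
    have "Q 1 1 2 0 \<and> Q 1 1 0 2"
    proof (cases B)
      case True
      have "Q 1 (-1) 1 1" using comp[OF step refl] True by simp
      from comp[OF this this] comp[OF step step] True show ?thesis by simp
    next
      case False
      have m: "Q 1 1 (-1) 1" using comp[OF comp[OF refl step] refl] False by simp
      have p: "Q 1 1 1 1" using step False by simp
      from add[OF m p] add[OF neg[OF m] p] show ?thesis by simp
    qed
    then show "Q 1 1 2 0" "Q 1 1 0 2" by blast+
  qed
  have ev: "Q 1 1 (2 * k) (2 * l)" for k l
    using add[OF mult[OF two1, of k] mult[OF two2, of l]] by (simp add: mult.commute)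
  have shift: "Q 1 1 a b" if "even (a + b)" "B \<longrightarrow> even a" for a b
  proof (cases "even a")
    case True
    with that obtain k l where "a = 2 * k" "b = 2 * l" by (auto elim!: evenE)
    with ev show ?thesis by simp
  next
    case False
    with that have "odd a" "odd b" "\<not> B" by auto
    then obtain k l where kl: "a = 2 * k + 1" "b = 2 * l + 1" by (auto elim!: oddE)
    have "Q 1 1 1 1" using step \<open>\<not> B\<close> by simp
    from add[OF ev this] kl show ?thesis by simp
  qed
  from adm show ?thesis
  proof (cases rule: admissible_cases)
    case shift
    then show ?thesis using \<open>\<And>b a. \<lbrakk>even (a + b); B \<longrightarrow> even a\<rbrakk> \<Longrightarrow> Q 1 1 a b\<close> by simp
  next
    case reflect
    then have "Q 1 1 a b" using shift by simp
    from comp[OF this refl] reflect show ?thesis by simp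
  next
    case rotate
    then have "Q 1 1 a b" using shift by simp
    from comp[OF this refl] rotate show ?thesis by simp
  next
    case glide1
    then have "Q 1 1 (a - 1) (b - 1)" using shift by simp
    from comp[OF this step] glide1 show ?thesis by simp
  next
    case glide2
    then have "Q 1 1 (a - 1) (b - 1)" using shift by simp
    from comp[OF comp[OF this step] refl] glide2 show ?thesis by simp
  qed
qed

section \<open>The model graphs are lattice quotients\<close>

lemma acts_compI:
  assumes "acts \<pi> g e1 e2 a b" "acts \<pi> h e1' e2' a' b'" "admissible B e1' e2' a' b'"
    and "\<And>x y. even (x + y) \<Longrightarrow> k (\<pi> x y) = g (h (\<pi> x y))"
  shows "acts \<pi> k (e1 * e1') (e2 * e2') (e1 * a' + a) (e2 * b' + b)"
  unfolding acts_def
proof (intro allI impI)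
  fix x y :: int assume xy: "even (x + y)"
  have "k (\<pi> x y) = \<pi> (e1 * (e1' * x + a') + a) (e2 * (e2' * y + b') + b)"
    using assms(1,2,4) xy admissible_parity[OF assms(3) xy] unfolding acts_def by simp
  then show "k (\<pi> x y) = \<pi> (e1 * e1' * x + (e1 * a' + a)) (e2 * e2' * y + (e2 * b' + b))"
    by (simp add: algebra_simps)
qed

lemma acts_inverseI:
  assumes "acts \<pi> g e1 e2 a b" "admissible B e1 e2 a b"
    and "\<And>x y. even (x + y) \<Longrightarrow> h (g (\<pi> x y)) = \<pi> x y"
  shows "acts \<pi> h e1 e2 (- e1 * a) (- e2 * b)"
  unfolding acts_def
proof (intro allI impI)
  fix x y :: int assume xy: "even (x + y)"
  let ?u = "e1 * x + - e1 * a" and ?v = "e2 * y + - e2 * b"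
  have ev: "even (?u + ?v)" by (rule admissible_parity[OF admissible_inv[OF assms(2)] xy])
  have "e1 * ?u + a = x" "e2 * ?v + b = y"
    using assms(2) by (auto elim!: admissible_cases simp: algebra_simps)
  then have "g (\<pi> ?u ?v) = \<pi> x y" using assms(1) ev unfolding acts_def by simp
  then show "h (\<pi> x y) = \<pi> ?u ?v" using assms(3)[OF ev] by simp
qed

lemma carrier_BijGroup: "carrier (BijGroup X) = Bij X"
  by (simp add: BijGroup_def)

text \<open>It suffices to look at generators and at two particular elements of the generated group.
  The restriction to the vertices accounts for the plus models, whose generators permute all of
  \<open>X_set r s\<close>.\<close>

lemma lattice_cover_generate:
  fixes \<pi> :: "int \<Rightarrow> int \<Rightarrow> 'a"
  assumes verts: "pverts \<Gamma> = {\<pi> x y | x y. even (x + y)}" and X: "pverts \<Gamma> \<subseteq> X"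
    and eq_iff: "\<And>x y x' y'. \<lbrakk>even (x + y); even (x' + y')\<rbrakk> \<Longrightarrow>
      \<pi> x y = \<pi> x' y' \<longleftrightarrow> int r dvd x - x' \<and> int s dvd y - y' \<and> (B \<longrightarrow> even (x - x'))"
    and arcs: "parcs \<Gamma> = lattice_arcs \<pi>"
    and S: "S \<subseteq> Bij X"
    and gens: "\<And>g. g \<in> S \<Longrightarrow> \<exists>e1 e2 a b. admissible B e1 e2 a b \<and> acts \<pi> g e1 e2 a b"
    and refl: "\<exists>g\<in>generate (BijGroup X) S. acts \<pi> g (-1) (if B then -1 else 1) 0 0"
    and step: "\<exists>g\<in>generate (BijGroup X) S. acts \<pi> g (if B then -1 else 1) 1 1 1"
  shows "lattice_cover B r s \<Gamma> ((\<lambda>g. restrict g (pverts \<Gamma>)) ` generate (BijGroup X) S) \<pi>"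
proof -
  interpret B: group "BijGroup X" by (rule group_BijGroup)
  let ?Gen = "generate (BijGroup X) S"
  have SB: "S \<subseteq> carrier (BijGroup X)" using S by (simp add: BijGroup_def)
  have Gen: "?Gen \<subseteq> Bij X"
    using B.generate_incl[OF SB] unfolding carrier_BijGroup .
  have sub: "subgroup ?Gen (BijGroup X)" by (rule B.generate_is_subgroup[OF SB])
  have \<pi>X: "\<pi> x y \<in> X" if "even (x + y)" for x y
    using X that unfolding verts by blast
  have comp: "acts \<pi> (g \<otimes>\<^bsub>BijGroup X\<^esub> h) (e1 * e1') (e2 * e2') (e1 * a' + a) (e2 * b' + b)"
    if "g \<in> ?Gen" "h \<in> ?Gen" "acts \<pi> g e1 e2 a b" "acts \<pi> h e1' e2' a' b'"
      "admissible B e1' e2' a' b'" for g h e1 e2 a b e1' e2' a' b'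
  proof (rule acts_compI[OF that(3-5)])
    have "g \<in> Bij X" "h \<in> Bij X" using that Gen by auto
    then show "(g \<otimes>\<^bsub>BijGroup X\<^esub> h) (\<pi> x y) = g (h (\<pi> x y))" if "even (x + y)" for x y
      using \<pi>X[OF that] by (simp add: BijGroup_def compose_def)
  qed
  have acts_inv: "acts \<pi> (inv\<^bsub>BijGroup X\<^esub> g) e1 e2 (- e1 * a) (- e2 * b)"
    if "g \<in> ?Gen" "acts \<pi> g e1 e2 a b" "admissible B e1 e2 a b" for g e1 e2 a b
  proof (rule acts_inverseI[OF that(2,3)])
    have g: "g \<in> Bij X" using that Gen by auto
    then show "(inv\<^bsub>BijGroup X\<^esub> g) (g (\<pi> x y)) = \<pi> x y" if "even (x + y)" for x y
      using \<pi>X[OF that] by (auto simp: inv_BijGroup Bij_def bij_betw_def)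
  qed
  have acts_one: "acts \<pi> (\<one>\<^bsub>BijGroup X\<^esub>) 1 1 0 0"
    using \<pi>X by (simp add: acts_def BijGroup_def)
  have adm: "\<exists>e1 e2 a b. admissible B e1 e2 a b \<and> acts \<pi> g e1 e2 a b" if "g \<in> ?Gen" for g
    using that
  proof (induction rule: generate.induct)
    case one
    have "admissible B 1 1 0 0" by (simp add: admissible_def)
    with acts_one show ?case by blast
  next
    case (incl h)
    then show ?case by (rule gens)
  next
    case (inv h)
    then obtain e1 e2 a b where *: "admissible B e1 e2 a b" "acts \<pi> h e1 e2 a b" using gens by blast
    have "h \<in> ?Gen" using inv by (rule generate.incl)
    from acts_inv[OF this *(2,1)]
    show ?case using admissible_inv[OF *(1)] by blast
  next
    case (eng h1 h2)
    from eng.IH obtain e1 e2 a b e1' e2' a' b' where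
      *: "admissible B e1 e2 a b" "acts \<pi> h1 e1 e2 a b"
      "admissible B e1' e2' a' b'" "acts \<pi> h2 e1' e2' a' b'" by metis
    from comp[OF eng.hyps *(2,4,3)] admissible_comp[OF *(1,3)] show ?case by blast
  qed
  \<comment> \<open>Admissibility is carried in the predicate because composing or inverting an
    action requires that points of even sum go to such points.\<close>
  let ?Q = "\<lambda>e1 e2 a b. admissible B e1 e2 a b \<and> (\<exists>g\<in>?Gen. acts \<pi> g e1 e2 a b)"
  have Q: "?Q e1 e2 a b" if ok: "admissible B e1 e2 a b" for e1 e2 a b
    using ok
  proof (rule admissible_generated[where Q = ?Q, rotated -1])
    fix e1 e2 a b e1' e2' a' b'
    assume 1: "?Q e1 e2 a b" and 2: "?Q e1' e2' a' b'"
    then obtain g h where gh: "g \<in> ?Gen" "h \<in> ?Gen" "acts \<pi> g e1 e2 a b" "acts \<pi> h e1' e2' a' b'"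
      by blast
    have "g \<otimes>\<^bsub>BijGroup X\<^esub> h \<in> ?Gen" using gh by (intro generate.eng)
    with comp[OF gh conjunct1[OF 2]] admissible_comp[OF conjunct1[OF 1] conjunct1[OF 2]]
    show "?Q (e1 * e1') (e2 * e2') (e1 * a' + a) (e2 * b' + b)" by blast
  next
    fix e1 e2 a b assume 1: "?Q e1 e2 a b"
    then obtain g where g: "g \<in> ?Gen" "acts \<pi> g e1 e2 a b" by blast
    have "inv\<^bsub>BijGroup X\<^esub> g \<in> ?Gen" by (rule subgroup.m_inv_closed[OF sub g(1)])
    with acts_inv[OF g conjunct1[OF 1]] admissible_inv[OF conjunct1[OF 1]]
    show "?Q e1 e2 (- e1 * a) (- e2 * b)" by blast
  next
    show "?Q (-1) (if B then -1 else 1) 0 0" using refl by (auto simp: admissible_def)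
    show "?Q (if B then -1 else 1) 1 1 1" using step by (auto simp: admissible_def)
  qed
  have V: "\<pi> x y \<in> pverts \<Gamma>" if "even (x + y)" for x y
    using that unfolding verts by blast
  show ?thesis
  proof
    fix e1 e2 a b assume "admissible B e1 e2 a b"
    then obtain g where g: "g \<in> ?Gen" "acts \<pi> g e1 e2 a b" using Q by blast
    have "acts \<pi> (restrict g (pverts \<Gamma>)) e1 e2 a b" using g(2) V unfolding acts_def by simp
    with g(1) show "\<exists>g\<in>(\<lambda>g. restrict g (pverts \<Gamma>)) ` ?Gen. acts \<pi> g e1 e2 a b" by blast
  next
    fix k assume "k \<in> (\<lambda>g. restrict g (pverts \<Gamma>)) ` ?Gen"
    then obtain g where g: "g \<in> ?Gen" "k = restrict g (pverts \<Gamma>)" by blast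
    obtain e1 e2 a b where *: "admissible B e1 e2 a b" "acts \<pi> g e1 e2 a b" using adm[OF g(1)] by blast
    then have "acts \<pi> k e1 e2 a b" using g(2) V unfolding acts_def by simp
    with *(1) show "\<exists>e1 e2 a b. admissible B e1 e2 a b \<and> acts \<pi> k e1 e2 a b" by blast
  next
    show "(\<lambda>g. restrict g (pverts \<Gamma>)) ` ?Gen \<subseteq> extensional (pverts \<Gamma>)" by auto
  qed (fact verts arcs | rule eq_iff, assumption+)+
qed

section \<open>Residue pairs as labels of the model graphs\<close>

definition residues2 :: "nat \<Rightarrow> nat \<Rightarrow> int \<Rightarrow> int \<Rightarrow> int \<times> int" where
  "residues2 r s x y = (x mod int r, y mod int s)"

lemma residues2_eq_iff:
  "residues2 r s x y = residues2 r s x' y' \<longleftrightarrow> int r dvd x - x' \<and> int s dvd y - y'"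
  by (simp add: residues2_def mod_eq_dvd_iff)

lemma abs_eq_one_iff: "\<bar>a\<bar> = 1 \<longleftrightarrow> a \<in> {1, -1}" for a :: int
  by auto

lemma BijI:
  assumes "f \<in> extensional X" "\<And>x. x \<in> X \<Longrightarrow> f x \<in> X" "\<And>x. x \<in> X \<Longrightarrow> g x \<in> X"
    "\<And>x. x \<in> X \<Longrightarrow> g (f x) = x" "\<And>x. x \<in> X \<Longrightarrow> f (g x) = x"
  shows "f \<in> Bij X"
  using assms by (auto simp: Bij_def intro!: bij_betw_byWitness[where f' = g])

context
  fixes r s :: nat
  assumes pos: "0 < r" "0 < s"
begin

abbreviation res where "res \<equiv> residues2 r s"

lemma residues2_in_X: "res x y \<in> X_set r s"
  using pos by (simp add: residues2_def X_set_def)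

lemma X_setE:
  assumes "v \<in> X_set r s"
  obtains x y where "v = res x y"
proof -
  obtain i j where "v = (i, j)" by (cases v)
  with assms have "v = res i j" by (auto simp: residues2_def X_set_def)
  with that show thesis .
qed

lemma mu_residues2: "mu r s (res x y) = res (x + 1) y"
  using residues2_in_X[of x y] by (simp add: mu_def residues2_def mod_simps)

lemma nu_residues2: "nu r s (res x y) = res x (y + 1)"
  using residues2_in_X[of x y] by (simp add: nu_def residues2_def mod_simps)

lemma sigma_residues2: "sigma r s (res x y) = res (- x) y"
  using residues2_in_X[of x y] by (simp add: sigma_def residues2_def mod_simps)

lemma tau_residues2: "tau r s (res x y) = res (- x) (- y)"
  using residues2_in_X[of x y] by (simp add: tau_def residues2_def mod_simps)

lemma mu_Bij: "mu r s \<in> Bij (X_set r s)"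
  by (rule BijI[where g = "\<lambda>(i, j). ((i - 1) mod int r, j)"]) (use pos in \<open>auto simp: mu_def X_set_def mod_simps\<close>)

lemma nu_Bij: "nu r s \<in> Bij (X_set r s)"
  by (rule BijI[where g = "\<lambda>(i, j). (i, (j - 1) mod int s)"]) (use pos in \<open>auto simp: nu_def X_set_def mod_simps\<close>)

lemma sigma_Bij: "sigma r s \<in> Bij (X_set r s)"
  by (rule BijI[where g = "sigma r s"]) (use pos in \<open>auto simp: sigma_def X_set_def mod_simps\<close>)

lemma tau_Bij: "tau r s \<in> Bij (X_set r s)"
  by (rule BijI[where g = "tau r s"]) (use pos in \<open>auto simp: tau_def X_set_def mod_simps\<close>)

lemmas gens_Bij = mu_Bij nu_Bij sigma_Bij tau_Bij
lemmas gens_residues2 = mu_residues2 nu_residues2 sigma_residues2 tau_residues2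

lemma mult_residues2:
  "\<lbrakk>g \<in> Bij (X_set r s); h \<in> Bij (X_set r s)\<rbrakk> \<Longrightarrow>
    (g \<otimes>\<^bsub>BijGroup (X_set r s)\<^esub> h) (res x y) = g (h (res x y))"
  using residues2_in_X[of x y] by (simp add: BijGroup_def compose_def)

lemma mult_Bij:
  "\<lbrakk>g \<in> Bij (X_set r s); h \<in> Bij (X_set r s)\<rbrakk> \<Longrightarrow> g \<otimes>\<^bsub>BijGroup (X_set r s)\<^esub> h \<in> Bij (X_set r s)"
  by (simp add: BijGroup_def compose_Bij)

lemma square_eq: "g \<in> Bij (X_set r s) \<Longrightarrow>
    g [^]\<^bsub>BijGroup (X_set r s)\<^esub> (2::nat) = g \<otimes>\<^bsub>BijGroup (X_set r s)\<^esub> g"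
proof -
  interpret B: group "BijGroup (X_set r s)" by (rule group_BijGroup)
  assume "g \<in> Bij (X_set r s)"
  then have "g \<in> carrier (BijGroup (X_set r s))" by (simp add: carrier_BijGroup)
  then show ?thesis by (simp add: numeral_2_eq_2)
qed

text \<open>Adding an odd modulus to its coordinate changes the parity of the sum and keeps the
  residues, so the points of even sum already cover all of X.\<close>

lemma ex_even_residues2:
  assumes "odd r \<or> odd s"
  shows "\<exists>u v. even (u + v) \<and> res u v = res x y"
proof (cases "even (x + y)")
  case False
  then have "even (x + int r + y) \<or> even (x + (y + int s))" using assms by auto
  moreover have "res (x + int r) y = res x y"
    "res x (y + int s) = res x y"
    by (simp_all add: residues2_def)
  ultimately show ?thesis by blast
qed blast

lemma X_set_eq_even:
  assumes "odd r \<or> odd s"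
  shows "X_set r s = {res x y | x y. even (x + y)}"
proof (intro equalityI subsetI)
  fix v assume "v \<in> X_set r s"
  then obtain x y where v: "v = res x y" by (rule X_setE)
  from ex_even_residues2[OF assms, of x y]
  obtain u w where "even (u + w)" "v = res u w" unfolding v by metis
  then show "v \<in> {res x y | x y. even (x + y)}" by blast
qed (use residues2_in_X in blast)

lemma residues2_add_cong:
  "res u v = res x y \<Longrightarrow> res (u + a) (v + b) = res (x + a) (y + b)"
  by (simp add: residues2_eq_iff)

lemma Gam_arcs: "parcs (Gam r s) =
   {(res x y, res (x + a) (y + b)) | x y a b. \<bar>a\<bar> = 1 \<and> \<bar>b\<bar> = 1}"
proof (intro equalityI subsetI)
  fix e assume "e \<in> parcs (Gam r s)"
  then obtain i j a b where *: "e = ((i, j), ((i + a) mod int r, (j + b) mod int s))"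
    "(i, j) \<in> X_set r s" "a \<in> {1, -1}" "b \<in> {1, -1}" by (auto simp: Gam_def)
  then have "e = (res i j, res (i + a) (j + b))"
    by (auto simp: residues2_def X_set_def)
  with * show "e \<in> {(res x y, res (x + a) (y + b)) | x y a b. \<bar>a\<bar> = 1 \<and> \<bar>b\<bar> = 1}"
    unfolding abs_eq_one_iff by blast
next
  fix e assume "e \<in> {(res x y, res (x + a) (y + b)) | x y a b. \<bar>a\<bar> = 1 \<and> \<bar>b\<bar> = 1}"
  then obtain x y a b where *: "e = (res x y, res (x + a) (y + b))"
    "a \<in> {1, -1}" "b \<in> {1, -1}" unfolding abs_eq_one_iff by blast
  let ?i = "x mod int r" and ?j = "y mod int s"
  have "e = ((?i, ?j), ((?i + a) mod int r, (?j + b) mod int s))"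
    using *(1) by (simp add: residues2_def mod_simps)
  moreover have "(?i, ?j) \<in> X_set r s" using residues2_in_X by (simp add: residues2_def)
  ultimately show "e \<in> parcs (Gam r s)" using *(2,3) unfolding Gam_def pair_pre_digraph.simps by blast
qed

lemma Gam_arcs_even:
  assumes "odd r \<or> odd s"
  shows "parcs (Gam r s) = lattice_arcs res"
  unfolding Gam_arcs
proof (intro equalityI subsetI)
  fix e assume "e \<in> {(res x y, res (x + a) (y + b)) | x y a b. \<bar>a\<bar> = 1 \<and> \<bar>b\<bar> = 1}"
  then obtain x y a b where *: "e = (res x y, res (x + a) (y + b))"
    "\<bar>a\<bar> = 1" "\<bar>b\<bar> = 1" by blast
  obtain u v where uv: "even (u + v)" "res u v = res x y"
    using ex_even_residues2[OF assms] by blast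
  from residues2_add_cong[OF uv(2)] * uv
  have "e = (res u v, res (u + a) (v + b))" by simp
  with * uv show "e \<in> lattice_arcs res" unfolding lattice_arcs_def by blast
qed (unfold lattice_arcs_def, blast)

lemma X_plus_eq:
  assumes "even r" "even s"
  shows "X_plus r s = {res x y | x y. even (x + y)}"
proof -
  have p: "even (x mod int r) \<longleftrightarrow> even x" "even (y mod int s) \<longleftrightarrow> even y" for x y
    using assms by (simp_all add: dvd_mod_iff)
  show ?thesis
  proof (intro equalityI subsetI)
    fix v assume v: "v \<in> X_plus r s"
    then have "v \<in> X_set r s" by (auto simp: X_plus_def)
    then obtain x y where xy: "v = res x y" by (rule X_setE)
    with v p have "even (x + y)" by (simp add: X_plus_def residues2_def)
    with xy show "v \<in> {res x y | x y. even (x + y)}" by blast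
  next
    fix v assume "v \<in> {res x y | x y. even (x + y)}"
    then obtain x y where xy: "v = res x y" "even (x + y)" by blast
    then show "v \<in> X_plus r s" using p residues2_in_X[of x y] by (simp add: X_plus_def residues2_def)
  qed
qed

lemma residues2_in_X_plus_iff:
  assumes "even r" "even s"
  shows "res x y \<in> X_plus r s \<longleftrightarrow> even (x + y)"
  using assms residues2_in_X[of x y] by (simp add: X_plus_def residues2_def dvd_mod_iff)

lemma Gam_plus_arcs:
  assumes "even r" "even s"
  shows "parcs (Gam_plus r s) = lattice_arcs res"
proof (intro equalityI subsetI)
  fix e assume "e \<in> parcs (Gam_plus r s)"
  then have "e \<in> parcs (Gam r s)" "fst e \<in> X_plus r s" by (auto simp: Gam_plus_def)
  then obtain x y a b where *: "e = (res x y, res (x + a) (y + b))"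
    "\<bar>a\<bar> = 1" "\<bar>b\<bar> = 1" "res x y \<in> X_plus r s" unfolding Gam_arcs by force
  with residues2_in_X_plus_iff[OF assms] show "e \<in> lattice_arcs res" unfolding lattice_arcs_def by blast
next
  fix e assume "e \<in> lattice_arcs res"
  then obtain x y a b where *: "e = (res x y, res (x + a) (y + b))"
    "\<bar>a\<bar> = 1" "\<bar>b\<bar> = 1" "even (x + y)" unfolding lattice_arcs_def by blast
  then have "even ((x + a) + (y + b))" by (simp add: abs_eq_one_odd)
  then have "e \<in> X_plus r s \<times> X_plus r s" using * residues2_in_X_plus_iff[OF assms] by simp
  moreover have "e \<in> parcs (Gam r s)" unfolding Gam_arcs using * by blast
  ultimately show "e \<in> parcs (Gam_plus r s)" by (simp add: Gam_plus_def)
qed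

lemma restrict_generate:
  assumes "S \<subseteq> Bij X"
  shows "(\<lambda>g. restrict g X) ` generate (BijGroup X) S = generate (BijGroup X) S"
proof -
  interpret B: group "BijGroup X" by (rule group_BijGroup)
  have "generate (BijGroup X) S \<subseteq> Bij X"
    using B.generate_incl[of S] assms by (simp add: carrier_BijGroup)
  then have "restrict g X = g" if "g \<in> generate (BijGroup X) S" for g
    using that Bij_imp_extensional extensional_restrict by blast
  then show ?thesis by simp
qed

lemma acts_residues2I:
  assumes "\<And>x y. g (res x y) = res (F x) (G y)"
    and "\<And>x. int r dvd F x - (e1 * x + a)" and "\<And>y. int s dvd G y - (e2 * y + b)"
  shows "acts res g e1 e2 a b"
  unfolding acts_def assms(1) residues2_eq_iff using assms(2,3) by blast

lemma lattice_cover_G_grp: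
  assumes "odd r \<or> odd s"
  shows "lattice_cover False r s (Gam r s) (G_grp r s) res"
proof -
  let ?S = "{mu r s, nu r s, sigma r s}"
  have S: "?S \<subseteq> Bij (X_set r s)" using gens_Bij by blast
  have V: "pverts (Gam r s) = X_set r s" by (simp add: Gam_def)
  \<comment> \<open>The evident translation (1, 0) has odd sum and is not admissible. An odd modulus
    is added to one entry: (1 + r, 0) or (1, s). The generator \<open>nu\<close> is treated
    alike.\<close>
  have mu: "\<exists>e1 e2 a b. admissible False e1 e2 a b \<and> acts res (mu r s) e1 e2 a b"
  proof (cases "odd r")
    case True
    have "acts res (mu r s) 1 1 (1 + int r) 0"
      by (rule acts_residues2I[where F = "\<lambda>x. x + 1" and G = "\<lambda>y. y"])
         (simp_all add: gens_residues2)
    moreover have "admissible False 1 1 (1 + int r) 0" using True by (simp add: admissible_def)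
    ultimately show ?thesis by blast
  next
    case False
    have "acts res (mu r s) 1 1 1 (int s)"
      by (rule acts_residues2I[where F = "\<lambda>x. x + 1" and G = "\<lambda>y. y"])
         (simp_all add: gens_residues2)
    moreover have "admissible False 1 1 1 (int s)" using False assms by (simp add: admissible_def)
    ultimately show ?thesis by blast
  qed
  have nu: "\<exists>e1 e2 a b. admissible False e1 e2 a b \<and> acts res (nu r s) e1 e2 a b"
  proof (cases "odd r")
    case True
    have "acts res (nu r s) 1 1 (int r) 1"
      by (rule acts_residues2I[where F = "\<lambda>x. x" and G = "\<lambda>y. y + 1"])
         (simp_all add: gens_residues2)
    moreover have "admissible False 1 1 (int r) 1" using True by (simp add: admissible_def)
    ultimately show ?thesis by blast
  next
    case False
    have "acts res (nu r s) 1 1 0 (1 + int s)"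
      by (rule acts_residues2I[where F = "\<lambda>x. x" and G = "\<lambda>y. y + 1"])
         (simp_all add: gens_residues2)
    moreover have "admissible False 1 1 0 (1 + int s)" using False assms by (simp add: admissible_def)
    ultimately show ?thesis by blast
  qed
  have sigma: "acts res (sigma r s) (-1) 1 0 0"
    by (rule acts_residues2I[where F = "uminus" and G = "\<lambda>y. y"])
         (simp_all add: gens_residues2)
  have step: "acts res (mu r s \<otimes>\<^bsub>BijGroup (X_set r s)\<^esub> nu r s) 1 1 1 1"
    by (simp add: acts_def mult_residues2 gens_Bij gens_residues2)
  have "lattice_cover False r s (Gam r s)
      ((\<lambda>g. restrict g (pverts (Gam r s))) ` generate (BijGroup (X_set r s)) ?S) res"
  proof (rule lattice_cover_generate)
    show "\<exists>e1 e2 a b. admissible False e1 e2 a b \<and> acts res g e1 e2 a b"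
      if "g \<in> ?S" for g
    proof -
      have "admissible False (-1) 1 0 0" by (simp add: admissible_def)
      with that mu nu sigma show ?thesis by blast
    qed
    show "\<exists>g\<in>generate (BijGroup (X_set r s)) ?S.
        acts res g (-1) (if False then - 1 else 1) 0 0"
      using sigma by (auto intro!: bexI[of _ "sigma r s"] generate.incl)
    show "\<exists>g\<in>generate (BijGroup (X_set r s)) ?S. acts res g (if False then - 1 else 1) 1 1 1"
      using step by (auto intro!: bexI[of _ "mu r s \<otimes>\<^bsub>BijGroup (X_set r s)\<^esub> nu r s"]
          generate.eng[OF generate.incl generate.incl])
  qed (use V S X_set_eq_even[OF assms] Gam_arcs_even[OF assms] residues2_eq_iff in simp_all)
  then show ?thesis unfolding V restrict_generate[OF S] G_grp_def .
qed

lemma lattice_cover_H_grp: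
  assumes "odd r" "even s"
  shows "lattice_cover True r s (Gam r s) (H_grp r s) res"
proof -
  let ?B = "BijGroup (X_set r s)"
  let ?sn = "sigma r s \<otimes>\<^bsub>?B\<^esub> nu r s"
  let ?S = "{mu r s, ?sn, tau r s}"
  have S: "?S \<subseteq> Bij (X_set r s)" using gens_Bij mult_Bij by blast
  have V: "pverts (Gam r s) = X_set r s" by (simp add: Gam_def)
  have o: "odd r \<or> odd s" using assms by blast
  \<comment> \<open>With \<open>B\<close> a translation needs an even first entry and a glide two
    odd entries; adding the odd modulus r gives (1 + r, 0) here and (r, 1) for the product of
    \<open>sigma\<close> and \<open>nu\<close>.\<close>
  have mu: "acts res (mu r s) 1 1 (1 + int r) 0"
    by (rule acts_residues2I[where F = "\<lambda>x. x + 1" and G = "\<lambda>y. y"])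
         (simp_all add: gens_residues2)
  have sn: "acts res ?sn (-1) 1 (int r) 1"
    by (rule acts_residues2I[where F = uminus and G = "\<lambda>y. y + 1"])
       (simp_all add: mult_residues2 gens_Bij gens_residues2)
  have tau: "acts res (tau r s) (-1) (-1) 0 0"
    by (rule acts_residues2I[where F = "uminus" and G = "uminus"])
         (simp_all add: gens_residues2)
  have step: "acts res (mu r s \<otimes>\<^bsub>?B\<^esub> ?sn) (-1) 1 1 1"
    by (simp add: acts_def mult_residues2 mult_Bij gens_Bij gens_residues2)
  have ok: "admissible True 1 1 (1 + int r) 0" "admissible True (-1) 1 (int r) 1"
    "admissible True (-1) (-1) 0 0"
    using assms by (simp_all add: admissible_def)
  have "lattice_cover True r s (Gam r s)
      ((\<lambda>g. restrict g (pverts (Gam r s))) ` generate ?B ?S) res"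
  proof (rule lattice_cover_generate)
    show "\<exists>e1 e2 a b. admissible True e1 e2 a b \<and> acts res g e1 e2 a b"
      if "g \<in> ?S" for g
      using that mu sn tau ok by blast
    show "\<exists>g\<in>generate ?B ?S. acts res g (-1) (if True then - 1 else 1) 0 0"
      using tau by (auto intro!: bexI[of _ "tau r s"] generate.incl)
    show "\<exists>g\<in>generate ?B ?S. acts res g (if True then - 1 else 1) 1 1 1"
      using step by (auto intro!: bexI[of _ "mu r s \<otimes>\<^bsub>?B\<^esub> ?sn"] generate.eng[OF generate.incl generate.incl])
    fix x y x' y' :: int
    assume "even (x + y)" "even (x' + y')"
    \<comment> \<open>Since s is even, y - y' is even, and the even sums pass this on to x - x'; so
      residue pairs need no additional parity information.\<close>
    moreover have "even (y - y')" if "int s dvd y - y'"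
      using assms(2) that by (meson dvd_trans even_of_nat)
    ultimately show "res x y = res x' y' \<longleftrightarrow>
        int r dvd x - x' \<and> int s dvd y - y' \<and> (True \<longrightarrow> even (x - x'))"
      unfolding residues2_eq_iff by auto
  qed (use V S X_set_eq_even[OF o] Gam_arcs_even[OF o] in simp_all)
  then show ?thesis unfolding V restrict_generate[OF S] H_grp_def .
qed

lemma lattice_cover_G_plus_grp:
  assumes "even r" "even s"
  shows "lattice_cover False r s (Gam_plus r s) (G_plus_grp r s) res"
proof -
  let ?B = "BijGroup (X_set r s)"
  let ?mn = "mu r s \<otimes>\<^bsub>?B\<^esub> nu r s" and ?mm = "mu r s [^]\<^bsub>?B\<^esub> (2::nat)"
  let ?S = "{?mm, ?mn, sigma r s}"
  have mm: "?mm = mu r s \<otimes>\<^bsub>?B\<^esub> mu r s" by (rule square_eq[OF mu_Bij])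
  have S: "?S \<subseteq> Bij (X_set r s)" unfolding mm using gens_Bij mult_Bij by blast
  have V: "pverts (Gam_plus r s) = X_plus r s" by (simp add: Gam_plus_def)
  have acts_mm: "acts res ?mm 1 1 2 0" and acts_mn: "acts res ?mn 1 1 1 1"
    and sigma: "acts res (sigma r s) (-1) 1 0 0"
    unfolding mm by (simp_all add: acts_def mult_residues2 gens_Bij gens_residues2 add.commute)
  have ok: "admissible False 1 1 2 0" "admissible False 1 1 1 1" "admissible False (-1) 1 0 0"
    by (simp_all add: admissible_def)
  have "lattice_cover False r s (Gam_plus r s)
      ((\<lambda>g. restrict g (pverts (Gam_plus r s))) ` generate ?B ?S) res"
  proof (rule lattice_cover_generate)
    show "\<exists>e1 e2 a b. admissible False e1 e2 a b \<and> acts res g e1 e2 a b"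
      if "g \<in> ?S" for g
      using that acts_mm acts_mn sigma ok by blast
    show "\<exists>g\<in>generate ?B ?S. acts res g (-1) (if False then - 1 else 1) 0 0"
      using sigma by (auto intro!: bexI[of _ "sigma r s"] generate.incl)
    show "\<exists>g\<in>generate ?B ?S. acts res g (if False then - 1 else 1) 1 1 1"
      using acts_mn by (auto intro!: bexI[of _ ?mn] generate.incl)
  qed (use V S X_plus_eq[OF assms] Gam_plus_arcs[OF assms] residues2_eq_iff in
      \<open>auto simp: X_plus_def\<close>)
  then show ?thesis unfolding V G_plus_grp_def .
qed

lemma lattice_cover_H_plus_grp:
  assumes "even r" "even s"
  shows "lattice_cover True r s (Gam_plus r s) (H_plus_grp r s) res"
proof -
  let ?B = "BijGroup (X_set r s)"
  let ?smn = "sigma r s \<otimes>\<^bsub>?B\<^esub> mu r s \<otimes>\<^bsub>?B\<^esub> nu r s" and ?mm = "mu r s [^]\<^bsub>?B\<^esub> (2::nat)"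
  let ?S = "{?mm, ?smn, tau r s}"
  have mm: "?mm = mu r s \<otimes>\<^bsub>?B\<^esub> mu r s" by (rule square_eq[OF mu_Bij])
  have S: "?S \<subseteq> Bij (X_set r s)" unfolding mm using gens_Bij mult_Bij by blast
  have V: "pverts (Gam_plus r s) = X_plus r s" by (simp add: Gam_plus_def)
  have acts_mm: "acts res ?mm 1 1 2 0"
    and acts_smn: "acts res ?smn (-1) 1 (-1) 1"
    and tau: "acts res (tau r s) (-1) (-1) 0 0"
    \<comment> \<open>The generator is (x, y) -> (-x - 1, y + 1); the square of \<open>mu\<close>
      turns its translation part (-1, 1) into (1, 1).\<close>
    and step: "acts res (?mm \<otimes>\<^bsub>?B\<^esub> ?smn) (-1) 1 1 1"
    unfolding mm by (simp_all add: acts_def mult_residues2 mult_Bij gens_Bij gens_residues2 algebra_simps)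
  have ok: "admissible True 1 1 2 0" "admissible True (-1) 1 (-1) 1" "admissible True (-1) (-1) 0 0"
    by (simp_all add: admissible_def)
  have "lattice_cover True r s (Gam_plus r s)
      ((\<lambda>g. restrict g (pverts (Gam_plus r s))) ` generate ?B ?S) res"
  proof (rule lattice_cover_generate)
    show "\<exists>e1 e2 a b. admissible True e1 e2 a b \<and> acts res g e1 e2 a b"
      if "g \<in> ?S" for g
      using that acts_mm acts_smn tau ok by blast
    show "\<exists>g\<in>generate ?B ?S. acts res g (-1) (if True then - 1 else 1) 0 0"
      using tau by (auto intro!: bexI[of _ "tau r s"] generate.incl)
    show "\<exists>g\<in>generate ?B ?S. acts res g (if True then - 1 else 1) 1 1 1"
      using step by (auto intro!: bexI[of _ "?mm \<otimes>\<^bsub>?B\<^esub> ?smn"] generate.eng[OF generate.incl generate.incl])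
    show "pverts (Gam_plus r s) \<subseteq> X_set r s" by (auto simp: V X_plus_def)
    fix x y x' y' :: int
    have "even (x - x')" if "int r dvd x - x'"
      using assms(1) that by (meson dvd_trans even_of_nat)
    then show "res x y = res x' y' \<longleftrightarrow>
        int r dvd x - x' \<and> int s dvd y - y' \<and> (True \<longrightarrow> even (x - x'))"
      unfolding residues2_eq_iff by auto
  qed (use V S X_plus_eq[OF assms] Gam_plus_arcs[OF assms] in simp_all)
  then show ?thesis unfolding V H_plus_grp_def .
qed

text \<open>The layer of the double cover is recorded as the parity of x: every arc changes x by an
  odd amount and switches the layer. For odd r this parity is independent of x modulo r, which
  yields the extra condition on x - x' that goes with \<open>B\<close>.\<close>

definition residues3 :: "int \<Rightarrow> int \<Rightarrow> (int \<times> int) \<times> int" where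
  "residues3 x y = (res x y, x mod 2)"

lemma residues3_eq_iff:
  "residues3 x y = residues3 x' y' \<longleftrightarrow> int r dvd x - x' \<and> int s dvd y - y' \<and> even (x - x')"
  by (simp add: residues3_def residues2_eq_iff mod_eq_dvd_iff)

lemma residues3_in_X2: "residues3 x y \<in> X2_set r s"
  using residues2_in_X by (simp add: residues3_def X2_set_def)

lemma gens2_residues3:
  "mu2 r s (res x y, d mod 2) = (res (x + 1) y, d mod 2)"
  "nu2 r s (res x y, d mod 2) = (res x (y + 1), d mod 2)"
  "sigma2 r s (res x y, d mod 2) = (res x (- y), (d + 1) mod 2)"
  "tau2 r s (res x y, d mod 2) = (res (- x) (- y), d mod 2)"
  using residues2_in_X[of x y]
  by (simp_all add: mu2_def nu2_def sigma2_def tau2_def residues2_def X2_set_def mod_simps)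

lemma X2_setE:
  assumes "v \<in> X2_set r s"
  obtains x y d where "v = (res x y, d mod 2)"
proof -
  obtain u d where v: "v = (u, d)" by (cases v)
  with assms have "u \<in> X_set r s" "d = d mod 2" by (auto simp: X2_set_def)
  moreover from this obtain x y where "u = res x y" by (metis X_setE)
  ultimately show thesis using that v by metis
qed

text \<open>Since both moduli are odd, each entry can be given the parity of the layer d without
  changing its residue; two entries of equal parity have an even sum.\<close>

lemma ex_even_residues3:
  assumes "odd r" "odd s"
  shows "\<exists>u v. even (u + v) \<and> residues3 u v = (res x y, d mod 2)"
proof -
  define u where "u = (if even (x - d) then x else x + int r)"
  define v where "v = (if even (y - d) then y else y + int s)"
  have "even (u - d)" "even (v - d)" using assms by (auto simp: u_def v_def)
  then have "even (u + v)" "u mod 2 = d mod 2" by (presburger)+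
  moreover have "res u v = res x y"
    by (auto simp: residues2_eq_iff u_def v_def)
  ultimately show ?thesis unfolding residues3_def by auto
qed

lemma gens2_Bij:
  "mu2 r s \<in> Bij (X2_set r s)" "nu2 r s \<in> Bij (X2_set r s)"
  "sigma2 r s \<in> Bij (X2_set r s)" "tau2 r s \<in> Bij (X2_set r s)"
proof -
  note defs = mu2_def nu2_def sigma2_def tau2_def X2_set_def X_set_def mod_simps
  show "mu2 r s \<in> Bij (X2_set r s)"
    by (rule BijI[where g = "\<lambda>((i, j), d). (((i - 1) mod int r, j), d)"]) (use pos in \<open>auto simp: defs\<close>)
  show "nu2 r s \<in> Bij (X2_set r s)"
    by (rule BijI[where g = "\<lambda>((i, j), d). ((i, (j - 1) mod int s), d)"]) (use pos in \<open>auto simp: defs\<close>)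
  show "sigma2 r s \<in> Bij (X2_set r s)"
    by (rule BijI[where g = "sigma2 r s"]) (use pos in \<open>auto simp: defs\<close>)
  show "tau2 r s \<in> Bij (X2_set r s)"
    by (rule BijI[where g = "tau2 r s"]) (use pos in \<open>auto simp: defs\<close>)
qed

lemma mult_X2:
  "\<lbrakk>g \<in> Bij (X2_set r s); h \<in> Bij (X2_set r s)\<rbrakk> \<Longrightarrow>
    (g \<otimes>\<^bsub>BijGroup (X2_set r s)\<^esub> h) (res x y, d mod 2) = g (h (res x y, d mod 2))"
  using residues2_in_X[of x y] by (simp add: BijGroup_def compose_def X2_set_def)

lemma mult_Bij_X2:
  "\<lbrakk>g \<in> Bij (X2_set r s); h \<in> Bij (X2_set r s)\<rbrakk> \<Longrightarrow> g \<otimes>\<^bsub>BijGroup (X2_set r s)\<^esub> h \<in> Bij (X2_set r s)"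
  by (simp add: BijGroup_def compose_Bij)

lemma Gam2_verts:
  assumes "odd r" "odd s"
  shows "X2_set r s = {residues3 x y | x y. even (x + y)}"
proof (intro equalityI subsetI)
  fix v assume "v \<in> X2_set r s"
  then obtain x y d where v: "v = (res x y, d mod 2)" by (rule X2_setE)
  from ex_even_residues3[OF assms, of x y d]
  obtain u w where "even (u + w)" "v = residues3 u w" unfolding v by metis
  then show "v \<in> {residues3 x y | x y. even (x + y)}" by blast
qed (use residues3_in_X2 in blast)

lemma Gam2_arcs:
  assumes "odd r" "odd s"
  shows "parcs (Gam2 r s) = lattice_arcs residues3"
proof (intro equalityI subsetI)
  fix e assume "e \<in> parcs (Gam2 r s)"
  then obtain u v d where e: "e = ((u, d), (v, (d + 1) mod 2))" "(u, v) \<in> parcs (Gam r s)" "d \<in> {0..<2}"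
    by (auto simp: Gam2_def double_cover_def)
  then obtain x y a b where *: "u = res x y" "v = res (x + a) (y + b)"
    "\<bar>a\<bar> = 1" "\<bar>b\<bar> = 1" unfolding Gam_arcs by blast
  obtain x' y' where xy: "even (x' + y')" "residues3 x' y' = (res x y, d mod 2)"
    using ex_even_residues3[OF assms] by blast
  have d: "d mod 2 = d" using e(3) by simp
  have x': "x' mod 2 = d" using xy(2) d by (simp add: residues3_def)
  have "odd a" using * by (simp add: abs_eq_one_odd)
  then have "(x' + a) mod 2 = (d + 1) mod 2" using x' by presburger
  then have "residues3 (x' + a) (y' + b) = (v, (d + 1) mod 2)"
    using xy(2) * residues2_add_cong[of x' y' x y a b] by (simp add: residues3_def)
  then have "e = (residues3 x' y', residues3 (x' + a) (y' + b))" using e(1) xy(2) * d by simp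
  with * xy(1) show "e \<in> lattice_arcs residues3" unfolding lattice_arcs_def by blast
next
  fix e assume "e \<in> lattice_arcs residues3"
  then obtain x y a b where *: "e = (residues3 x y, residues3 (x + a) (y + b))"
    "\<bar>a\<bar> = 1" "\<bar>b\<bar> = 1" unfolding lattice_arcs_def by blast
  have "odd a" using * by (simp add: abs_eq_one_odd)
  then have "(x + a) mod 2 = (x mod 2 + 1) mod 2" by presburger
  moreover have "(res x y, res (x + a) (y + b)) \<in> parcs (Gam r s)"
    unfolding Gam_arcs using * by blast
  moreover have "x mod 2 \<in> {0..<2}" by simp
  ultimately show "e \<in> parcs (Gam2 r s)"
    unfolding Gam2_def double_cover_def pair_pre_digraph.simps *(1) residues3_def by blast
qed

text \<open>Here c is the change of layer. It must have the parity of the translation part a, as an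
  odd factor e1 leaves the parity of x alone.\<close>

lemma acts_residues3I:
  assumes "\<And>x y d. g (res x y, d mod 2) = (res (F x) (G y), (d + c) mod 2)"
    and "\<And>x. int r dvd F x - (e1 * x + a)" and "\<And>y. int s dvd G y - (e2 * y + b)"
    and "odd e1" and "even (c - a)"
  shows "acts residues3 g e1 e2 a b"
  unfolding acts_def
proof (intro allI impI)
  fix x y :: int
  have "even ((x + c) - (e1 * x + a))" using assms(4,5) by (auto simp: even_add)
  then have "(x + c) mod 2 = (e1 * x + a) mod 2" by (simp add: mod_eq_dvd_iff)
  then show "g (residues3 x y) = residues3 (e1 * x + a) (e2 * y + b)"
    using assms(1)[of x y x] assms(2,3) by (simp add: residues3_def residues2_eq_iff)
qed

lemma lattice_cover_G2_grp:
  assumes "odd r" "odd s"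
  shows "lattice_cover True r s (Gam2 r s) (G2_grp r s) residues3"
proof -
  let ?B = "BijGroup (X2_set r s)"
  let ?S = "{mu2 r s, nu2 r s, sigma2 r s, tau2 r s}"
  \<comment> \<open>The product of \<open>sigma2\<close> and \<open>tau2\<close> negates only the
    first coordinate and switches the layer; \<open>mu2\<close> and \<open>nu2\<close> then supply
    the translation part (1, 1).\<close>
  let ?h = "mu2 r s \<otimes>\<^bsub>?B\<^esub> (nu2 r s \<otimes>\<^bsub>?B\<^esub> (sigma2 r s \<otimes>\<^bsub>?B\<^esub> tau2 r s))"
  have S: "?S \<subseteq> Bij (X2_set r s)" using gens2_Bij by blast
  have V: "pverts (Gam2 r s) = X2_set r s" by (simp add: Gam2_def double_cover_def X2_set_def Gam_def)
  \<comment> \<open>The parity of each translation part is forced by the layer: \<open>mu2\<close>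
    and \<open>nu2\<close> keep it and need even entries, while \<open>sigma2\<close> switches it
    and is given the odd entries r and s.\<close>
  have mu: "acts residues3 (mu2 r s) 1 1 (1 + int r) 0"
    by (rule acts_residues3I[where F = "\<lambda>x. x + 1" and G = "\<lambda>y. y" and c = 0])
       (use assms in \<open>simp_all add: gens2_residues3\<close>)
  have nu: "acts residues3 (nu2 r s) 1 1 0 (1 + int s)"
    by (rule acts_residues3I[where F = "\<lambda>x. x" and G = "\<lambda>y. y + 1" and c = 0])
       (use assms in \<open>simp_all add: gens2_residues3\<close>)
  have sigma: "acts residues3 (sigma2 r s) 1 (-1) (int r) (int s)"
    by (rule acts_residues3I[where F = "\<lambda>x. x" and G = uminus and c = 1])
       (use assms in \<open>simp_all add: gens2_residues3\<close>)
  have tau: "acts residues3 (tau2 r s) (-1) (-1) 0 0"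
    by (rule acts_residues3I[where F = uminus and G = uminus and c = 0])
       (use assms in \<open>simp_all add: gens2_residues3\<close>)
  have step: "acts residues3 ?h (-1) 1 1 1"
    by (rule acts_residues3I[where F = "\<lambda>x. - x + 1" and G = "\<lambda>y. y + 1" and c = 1])
       (simp_all add: gens2_residues3 mult_X2 mult_Bij_X2 gens2_Bij)
  have ok: "admissible True 1 1 (1 + int r) 0" "admissible True 1 1 0 (1 + int s)"
    "admissible True 1 (-1) (int r) (int s)" "admissible True (-1) (-1) 0 0"
    using assms by (simp_all add: admissible_def)
  have "lattice_cover True r s (Gam2 r s)
      ((\<lambda>g. restrict g (pverts (Gam2 r s))) ` generate ?B ?S) residues3"
  proof (rule lattice_cover_generate)
    show "\<exists>e1 e2 a b. admissible True e1 e2 a b \<and> acts residues3 g e1 e2 a b" if "g \<in> ?S" for g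
      using that mu nu sigma tau ok by blast
    show "\<exists>g\<in>generate ?B ?S. acts residues3 g (-1) (if True then - 1 else 1) 0 0"
      using tau by (auto intro!: bexI[of _ "tau2 r s"] generate.incl)
    have "?h \<in> generate ?B ?S"
      by (intro generate.eng generate.incl) auto
    with step show "\<exists>g\<in>generate ?B ?S. acts residues3 g (if True then - 1 else 1) 1 1 1" by auto
  qed (use V S Gam2_verts[OF assms] Gam2_arcs[OF assms] residues3_eq_iff in simp_all)
  then show ?thesis unfolding V restrict_generate[OF S] G2_grp_def .
qed

end

section \<open>Cyclic quotients\<close>

text \<open>Shift invariance makes the fibre of 0 a subgroup of the integers and the other fibres
  its cosets. A finite range makes the subgroup nonzero, and d is its least positive
  element.\<close>

lemma shift_invariant_period:
  fixes \<theta> :: "int \<Rightarrow> 'b"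
  assumes fin: "finite (range \<theta>)" and shift: "\<And>n m. \<theta> n = \<theta> m \<longleftrightarrow> \<theta> (n + 1) = \<theta> (m + 1)"
  shows "\<exists>d::nat. 0 < d \<and> (\<forall>n m. \<theta> n = \<theta> m \<longleftrightarrow> n mod int d = m mod int d)"
proof -
  have shiftk: "\<theta> n = \<theta> m \<longleftrightarrow> \<theta> (n + k) = \<theta> (m + k)" for n m k
  proof (induction k rule: int_induct[where k = 0])
    case (step1 i)
    then show ?case using shift[of "n + i" "m + i"] by (simp add: add.assoc)
  next
    case (step2 i)
    then show ?case using shift[of "n + (i - 1)" "m + (i - 1)"] by (simp add: add.assoc)
  qed simp
  have zero: "\<theta> n = \<theta> m \<longleftrightarrow> \<theta> (n - m) = \<theta> 0" for n m
    using shiftk[of n m "- m"] by simp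
  have "\<not> inj \<theta>" using fin finite_imageD infinite_UNIV_int by blast
  then obtain n m where nm: "\<theta> n = \<theta> m" "n \<noteq> m" by (auto simp: inj_def)
  have "\<exists>d::nat. 0 < d \<and> \<theta> (int d) = \<theta> 0"
  proof (cases "n > m")
    case True
    then have "0 < nat (n - m) \<and> \<theta> (int (nat (n - m))) = \<theta> 0" using zero[of n m] nm by simp
    then show ?thesis by blast
  next
    case False
    then have "0 < nat (m - n) \<and> \<theta> (int (nat (m - n))) = \<theta> 0" using zero[of m n] nm by simp
    then show ?thesis by blast
  qed
  define d where "d = (LEAST d::nat. 0 < d \<and> \<theta> (int d) = \<theta> 0)"
  have d: "0 < d" "\<theta> (int d) = \<theta> 0"
    using LeastI_ex[OF \<open>\<exists>d::nat. 0 < d \<and> \<theta> (int d) = \<theta> 0\<close>] unfolding d_def by blast+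
  have least: "\<theta> (int e) \<noteq> \<theta> 0" if "0 < e" "e < d" for e
    using not_less_Least[of e "\<lambda>d. 0 < d \<and> \<theta> (int d) = \<theta> 0"] that unfolding d_def by blast
  have per: "\<theta> (n + int d * k) = \<theta> n" for n k
  proof (induction k rule: int_induct[where k = 0])
    case (step1 i)
    have "\<theta> (n + int d * i + int d) = \<theta> (n + int d * i)"
      using shiftk[of "int d" 0 "n + int d * i"] d(2) by (simp add: add.commute)
    with step1 show ?case by (simp add: algebra_simps)
  next
    case (step2 i)
    have "\<theta> (n + int d * (i - 1) + int d) = \<theta> (n + int d * (i - 1))"
      using shiftk[of "int d" 0 "n + int d * (i - 1)"] d(2) by (simp add: add.commute)
    with step2 show ?case by (simp add: algebra_simps)
  qed simp
  have red: "\<theta> n = \<theta> (n mod int d)" for n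
    using per[of "n mod int d" "n div int d"] by (simp add: mult.commute)
  have "\<theta> n = \<theta> m \<longleftrightarrow> n mod int d = m mod int d" for n m
  proof
    assume "\<theta> n = \<theta> m"
    then have "\<theta> ((n - m) mod int d) = \<theta> 0" using zero[of n m] red[of "n - m"] by simp
    moreover have "0 \<le> (n - m) mod int d" "(n - m) mod int d < int d" using d(1) by simp_all
    ultimately have "(n - m) mod int d = 0"
      using least[of "nat ((n - m) mod int d)"] by (cases "(n - m) mod int d = 0") (auto simp: nat_less_iff)
    then show "n mod int d = m mod int d" by (simp add: mod_eq_dvd_iff dvd_eq_mod_eq_0)
  next
    assume "n mod int d = m mod int d"
    then show "\<theta> n = \<theta> m" using red[of n] red[of m] by simp
  qed
  with d(1) show ?thesis by blast
qed

section \<open>The quotients that being basic permits\<close>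

definition cyclic_or_complete :: "'b pair_pre_digraph \<Rightarrow> bool" where
  "cyclic_or_complete Q \<longleftrightarrow>
     K\<^bsub>1\<^esub> (with_proj Q) \<or> K\<^bsub>2\<^esub> (with_proj Q) \<or> is_cycle_graph Q"

text \<open>The graph is unrolled to the infinite path by \<open>\<theta>\<close>, whose period d
  decides the outcome: 1 gives a single vertex, as then no B differs from \<open>\<theta> n\<close>,
  2 merges both neighbours into one, and d at least 3 gives a cycle of length d.\<close>

lemma cyclic_or_completeI:
  fixes \<theta> :: "int \<Rightarrow> 'b"
  assumes fin: "finite (pverts Q)" and verts: "pverts Q = range \<theta>"
    and shift: "\<And>n m. \<theta> n = \<theta> m \<longleftrightarrow> \<theta> (n + 1) = \<theta> (m + 1)"
    and arcs: "\<And>n B. (\<theta> n, B) \<in> parcs Q \<longleftrightarrow> \<theta> n \<noteq> B \<and> (B = \<theta> (n + 1) \<or> B = \<theta> (n - 1))"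
    and arcs_verts: "parcs Q \<subseteq> pverts Q \<times> pverts Q"
  shows "cyclic_or_complete Q"
proof -
  from fin verts have "finite (range \<theta>)" by simp
  then obtain d where d: "0 < d" and eq: "\<And>n m. \<theta> n = \<theta> m \<longleftrightarrow> n mod int d = m mod int d"
    using shift_invariant_period[of \<theta>] shift by metis
  have inj: "inj_on \<theta> {0..<int d}" by (rule inj_onI) (simp add: eq)
  have img: "\<theta> ` {0..<int d} = pverts Q"
  proof -
    have "\<theta> n \<in> \<theta> ` {0..<int d}" for n
      using d by (intro image_eqI[of _ _ "n mod int d"]) (simp_all add: eq)
    then show ?thesis unfolding verts by blast
  qed
  have card: "card (pverts Q) = d" using card_image[OF inj] img by simp
  consider "d = 1" | "d = 2" | "3 \<le> d" using d by linarith
  then show ?thesis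
  proof cases
    case 1
    then have e: "\<theta> n = \<theta> m" for n m by (simp add: eq)
    have "parcs Q = {}"
    proof (rule equals0I)
      fix a assume a: "a \<in> parcs Q"
      with arcs_verts obtain n B where "a = (\<theta> n, B)" unfolding verts by blast
      with a arcs e show False by metis
    qed
    moreover have "u = v" if "u \<in> pverts Q" "v \<in> pverts Q" for u v
      using that e unfolding verts by blast
    ultimately have "K\<^bsub>1\<^esub> (with_proj Q)"
      using fin card 1 unfolding complete_digraph_pair_def by auto
    then show ?thesis by (simp add: cyclic_or_complete_def)
  next
    case 2
    have step: "v = \<theta> (n + 1)" if nv: "\<theta> n \<noteq> v" "v \<in> pverts Q" for n v
    proof -
      obtain m where m: "v = \<theta> m" using nv(2) unfolding verts by blast
      have "n mod 2 \<noteq> m mod 2" using nv(1) 2 unfolding m eq by simp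
      then have "m mod 2 = (n + 1) mod 2" by presburger
      then show ?thesis unfolding m eq using 2 by simp
    qed
    have "parcs Q = {(u, v). (u, v) \<in> pverts Q \<times> pverts Q \<and> u \<noteq> v}"
    proof (intro equalityI subsetI)
      fix a assume a: "a \<in> parcs Q"
      with arcs_verts obtain n B where "a = (\<theta> n, B)" "B \<in> pverts Q" unfolding verts by blast
      with a arcs show "a \<in> {(u, v). (u, v) \<in> pverts Q \<times> pverts Q \<and> u \<noteq> v}" by (auto simp: verts)
    next
      fix a assume "a \<in> {(u, v). (u, v) \<in> pverts Q \<times> pverts Q \<and> u \<noteq> v}"
      then obtain n v where "a = (\<theta> n, v)" "v \<in> pverts Q" "\<theta> n \<noteq> v" by (auto simp: verts)
      with step[of n v] arcs show "a \<in> parcs Q" by auto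
    qed
    then have "K\<^bsub>2\<^esub> (with_proj Q)"
      using fin card 2 unfolding complete_digraph_pair_def by auto
    then show ?thesis by (simp add: cyclic_or_complete_def)
  next
    case 3
    let ?f = "inv_into {0..<int d} \<theta>"
    have f: "?f (\<theta> n) = n mod int d" for n
    proof -
      have "?f (\<theta> (n mod int d)) = n mod int d"
        by (rule inv_into_f_f[OF inj]) (use d in simp)
      moreover have "\<theta> (n mod int d) = \<theta> n" by (simp add: eq)
      ultimately show ?thesis by simp
    qed
    have "bij_betw ?f (pverts Q) {0..<int d}"
      using inj img by (intro bij_betw_inv_into bij_betw_imageI)
    moreover have "(u, v) \<in> parcs Q \<longleftrightarrow> (?f u, ?f v) \<in> parcs (cycle_graph d)"
      if uv: "u \<in> pverts Q" "v \<in> pverts Q" for u v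
    proof -
      obtain n m where nm: "u = \<theta> n" "v = \<theta> m" using uv unfolding verts by blast
      have ne: "n mod int d \<noteq> (n + 1) mod int d" "n mod int d \<noteq> (n - 1) mod int d"
        using 3 by (auto simp: mod_eq_dvd_iff zdvd_not_zless)
      have "(u, v) \<in> parcs Q \<longleftrightarrow> n mod int d \<noteq> m mod int d \<and>
          (m mod int d = (n + 1) mod int d \<or> m mod int d = (n - 1) mod int d)"
        unfolding nm arcs eq ..
      also have "\<dots> \<longleftrightarrow> (m mod int d = (n + 1) mod int d \<or> m mod int d = (n - 1) mod int d)"
        using ne by metis
      also have "\<dots> \<longleftrightarrow> (?f u, ?f v) \<in> parcs (cycle_graph d)"
        using d unfolding nm f by (simp add: cycle_graph_def mod_simps)
      finally show ?thesis .
    qed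
    ultimately have "graph_iso ?f Q (cycle_graph d)"
      unfolding graph_iso_def by (simp add: cycle_graph_def)
    with 3 show ?thesis unfolding cyclic_or_complete_def is_cycle_graph_def by blast
  qed
qed

text \<open>The test used against being basic: all permitted quotients have valency at most 2, so
  three distinct neighbours of one orbit are a contradiction.\<close>

lemma cyclic_or_complete_valency:
  assumes "cyclic_or_complete Q" and A: "A \<in> pverts Q"
    and arcs: "(A, B1) \<in> parcs Q" "(A, B2) \<in> parcs Q" "(A, B3) \<in> parcs Q"
    and B: "B1 \<in> pverts Q" "B2 \<in> pverts Q" "B3 \<in> pverts Q"
  shows "B1 = B2 \<or> B1 = B3 \<or> B2 = B3"
proof (rule ccontr)
  assume ne: "\<not> ?thesis"
  from assms(1) consider "K\<^bsub>1\<^esub> (with_proj Q)" | "K\<^bsub>2\<^esub> (with_proj Q)" | "is_cycle_graph Q"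
    unfolding cyclic_or_complete_def by blast
  then show False
  proof cases
    case 3
    then obtain r f where f: "graph_iso f Q (cycle_graph r)" by (auto simp: is_cycle_graph_def)
    then have "(f A, f X) \<in> parcs (cycle_graph r)" if "(A, X) \<in> parcs Q" "X \<in> pverts Q" for X
      using that A by (auto simp: graph_iso_def)
    then have fX: "f X = (f A + 1) mod int r \<or> f X = (f A - 1) mod int r"
      if "(A, X) \<in> parcs Q" "X \<in> pverts Q" for X
      using that by (auto simp: cycle_graph_def)
    have "f X \<noteq> f Y" if "X \<noteq> Y" "X \<in> pverts Q" "Y \<in> pverts Q" for X Y
      using f that by (auto simp: graph_iso_def bij_betw_def inj_on_def)
    then have "f B1 \<noteq> f B2" "f B1 \<noteq> f B3" "f B2 \<noteq> f B3" using ne B by auto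
    with fX[OF arcs(1) B(1)] fX[OF arcs(2) B(2)] fX[OF arcs(3) B(3)] show False by metis
  next
    case 1
    then have "finite (pverts Q)" "card (pverts Q) = 1" unfolding complete_digraph_pair_def by auto
    then show False using ne B by (auto simp: card_1_singleton_iff)
  next
    case 2
    then have "finite (pverts Q)" "card (pverts Q) = 2" unfolding complete_digraph_pair_def by auto
    moreover have "card {B1, B2, B3} = 3" "{B1, B2, B3} \<subseteq> pverts Q" using ne B by auto
    ultimately show False using card_mono[of "pverts Q" "{B1, B2, B3}"] by simp
  qed
qed

lemma cyclic_or_complete_card:
  assumes "cyclic_or_complete Q" "B1 \<in> pverts Q" "B2 \<in> pverts Q" "B3 \<in> pverts Q"
    "B1 \<noteq> B2" "B1 \<noteq> B3" "B2 \<noteq> B3"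
  shows "is_cycle_graph Q"
proof -
  have "card (pverts Q) \<ge> 3" if "finite (pverts Q)"
    using card_mono[OF that, of "{B1, B2, B3}"] assms by simp
  then have "\<not> K\<^bsub>1\<^esub> (with_proj Q)" "\<not> K\<^bsub>2\<^esub> (with_proj Q)"
    unfolding complete_digraph_pair_def by auto
  with assms(1) show ?thesis by (simp add: cyclic_or_complete_def)
qed

section \<open>Connected graphs and normal quotients\<close>

definition arc_closed :: "'a pair_pre_digraph \<Rightarrow> 'a set \<Rightarrow> bool" where
  "arc_closed \<Gamma> W \<longleftrightarrow> (\<forall>v w. v \<in> W \<longrightarrow> (v, w) \<in> parcs \<Gamma> \<longrightarrow> w \<in> W)"

text \<open>Connectedness as an induction principle: a set that contains one vertex and is closed
  under arcs contains them all. The witness for the converse is the set of vertices reachable from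
  u.\<close>

lemma connected_iff:
  assumes "pair_graph \<Gamma>"
  shows "Digraph_Component.connected (with_proj \<Gamma>) \<longleftrightarrow> pverts \<Gamma> \<noteq> {} \<and>
    (\<forall>u\<in>pverts \<Gamma>. \<forall>W. u \<in> W \<longrightarrow> arc_closed \<Gamma> W \<longrightarrow> pverts \<Gamma> \<subseteq> W)"
proof -
  interpret pair_graph \<Gamma> by fact
  have "(\<Union>e\<in>parcs \<Gamma>. {(fst e, snd e), (snd e, fst e)}) = parcs \<Gamma>"
    using arcs_symmetric by force
  then have mk: "mk_symmetric (with_proj \<Gamma>) = \<Gamma>"
    by (simp add: mk_symmetric_def)
  have reach: "u \<rightarrow>\<^sup>*\<^bsub>with_proj \<Gamma>\<^esub> v \<longleftrightarrow> v \<in> pverts \<Gamma> \<and>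
      (\<forall>W. u \<in> W \<longrightarrow> arc_closed \<Gamma> W \<longrightarrow> v \<in> W)"
    if u: "u \<in> pverts \<Gamma>" for u v
  proof
    assume "u \<rightarrow>\<^sup>*\<^bsub>with_proj \<Gamma>\<^esub> v"
    then have "(u, v) \<in> rtrancl_on (pverts \<Gamma>) (parcs \<Gamma>)" by (simp add: reachable_def)
    then show "v \<in> pverts \<Gamma> \<and>
      (\<forall>W. u \<in> W \<longrightarrow> arc_closed \<Gamma> W \<longrightarrow> v \<in> W)"
      by (induction rule: rtrancl_on_induct) (auto simp: u arc_closed_def)
  next
    assume *: "v \<in> pverts \<Gamma> \<and>
      (\<forall>W. u \<in> W \<longrightarrow> arc_closed \<Gamma> W \<longrightarrow> v \<in> W)"
    let ?W = "{v. (u, v) \<in> rtrancl_on (pverts \<Gamma>) (parcs \<Gamma>)}"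
    have "u \<in> ?W" using u by (simp add: rtrancl_on_refl)
    moreover have "arc_closed \<Gamma> ?W"
      using in_arcsD2 by (auto simp: arc_closed_def intro: rtrancl_on_into_rtrancl_on)
    ultimately have "v \<in> ?W" by (rule *[THEN conjunct2, THEN spec, THEN mp, THEN mp])
    then show "u \<rightarrow>\<^sup>*\<^bsub>with_proj \<Gamma>\<^esub> v" by (simp add: reachable_def)
  qed
  show ?thesis
    unfolding Digraph_Component.connected_def mk strongly_connected_def with_proj_simps
  proof (rule conj_cong[OF refl], rule ball_cong[OF refl])
    fix u assume "u \<in> pverts \<Gamma>"
    note r = reach[OF this]
    show "(\<forall>v\<in>pverts \<Gamma>. u \<rightarrow>\<^sup>*\<^bsub>with_proj \<Gamma>\<^esub> v) \<longleftrightarrow>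
      (\<forall>W. u \<in> W \<longrightarrow> arc_closed \<Gamma> W \<longrightarrow> pverts \<Gamma> \<subseteq> W)"
      unfolding r by blast
  qed
qed

locale graph_grp =
  fixes \<Gamma> :: "'a pair_pre_digraph" and G :: "('a \<Rightarrow> 'a) set"
  assumes pair: "graph_group_pair \<Gamma> G"

sublocale graph_grp \<subseteq> perm_grp "pverts \<Gamma>" G
  using pair graph_group_pair_iff by blast

context graph_grp
begin

abbreviation V where "V \<equiv> pverts \<Gamma>"

lemma pair_graph: "pair_graph \<Gamma>"
  using pair graph_group_pair_iff by blast

lemma finite_verts: "finite (V)"
  using pair_graph by (simp add: pair_graph_def pair_digraph_def pair_fin_digraph_def pair_fin_digraph_axioms_def)

lemma arc_verts: "(u, v) \<in> parcs \<Gamma> \<Longrightarrow> u \<in> V \<and> v \<in> V"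
proof -
  interpret pair_graph \<Gamma> by (rule pair_graph)
  show "(u, v) \<in> parcs \<Gamma> \<Longrightarrow> u \<in> V \<and> v \<in> V"
    using in_arcsD1 in_arcsD2 by blast
qed

lemma arc_sym: "(u, v) \<in> parcs \<Gamma> \<Longrightarrow> (v, u) \<in> parcs \<Gamma>"
proof -
  interpret pair_graph \<Gamma> by (rule pair_graph)
  show "(u, v) \<in> parcs \<Gamma> \<Longrightarrow> (v, u) \<in> parcs \<Gamma>" by (rule arcs_symmetric)
qed

lemma arc_image: "\<lbrakk>g \<in> G; (u, v) \<in> parcs \<Gamma>\<rbrakk> \<Longrightarrow> (g u, g v) \<in> parcs \<Gamma>"
  using pair arc_verts[of u v] unfolding graph_group_pair_iff by simp

text \<open>Normality without nontriviality, because quotients by shift groups and orbit kernels are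
  studied before it is known whether these groups are trivial.\<close>

definition normal_sub :: "('a \<Rightarrow> 'a) set \<Rightarrow> bool" where
  "normal_sub N \<longleftrightarrow> perm_grp (V) N \<and> N \<subseteq> G \<and>
     (\<forall>g\<in>G. \<forall>n\<in>N. \<exists>n'\<in>N. \<forall>x\<in>V. n' (g x) = g (n x))"

lemma nontrivial_normal_iff':
  "nontrivial_normal (V) G N \<longleftrightarrow> normal_sub N \<and> (\<exists>n\<in>N. \<exists>x\<in>V. n x \<noteq> x)"
  unfolding nontrivial_normal_iff normal_sub_def by simp

end

locale normal_quotient = graph_grp +
  fixes N :: "('a \<Rightarrow> 'a) set"
  assumes normal: "normal_sub N"

sublocale normal_quotient \<subseteq> N: perm_grp V N
  using normal unfolding normal_sub_def by blast

context normal_quotient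
begin

abbreviation orbN :: "'a \<Rightarrow> 'a set" where "orbN \<equiv> N.orb"

abbreviation Q where "Q \<equiv> quotient_graph \<Gamma> N"

lemma N_subset: "N \<subseteq> G"
  using normal unfolding normal_sub_def by blast

lemma orbN_image1:
  assumes "g \<in> G" "x \<in> V" "y \<in> V" "orbN x = orbN y"
  shows "orbN (g x) = orbN (g y)"
proof -
  obtain n where n: "n \<in> N" "n x = y" using assms N.orb_eq_iff by blast
  then obtain n' where "n' \<in> N" "\<forall>x\<in>V. n' (g x) = g (n x)"
    using normal assms(1) unfolding normal_sub_def by blast
  then have "n' \<in> N" "n' (g x) = g y" using n assms by auto
  then show ?thesis using N.orb_eq_iff[of "g x" "g y"] assms by auto
qed

lemma orbN_image:
  assumes "g \<in> G" "x \<in> V" "y \<in> V"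
  shows "orbN (g x) = orbN (g y) \<longleftrightarrow> orbN x = orbN y"
proof
  obtain h where h: "h \<in> G" "\<forall>x\<in>V. h (g x) = x" using ex_inverse[OF assms(1)] by blast
  assume "orbN (g x) = orbN (g y)"
  then show "orbN x = orbN y" using orbN_image1[of h "g x" "g y"] assms h by simp
qed (rule orbN_image1[OF assms])

lemma Q_verts: "pverts Q = orbN ` V"
  by (simp add: quotient_graph_def N.perm_orbits_eq)

text \<open>An arc leaving an orbit can be moved by N until it starts at a prescribed vertex of that
  orbit, so adjacency in the quotient can be read at a single vertex.\<close>

lemma Q_arc_iff:
  assumes x: "x \<in> V"
  shows "(orbN x, B) \<in> parcs Q \<longleftrightarrow> orbN x \<noteq> B \<and> (\<exists>v. (x, v) \<in> parcs \<Gamma> \<and> B = orbN v)"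
proof
  assume "(orbN x, B) \<in> parcs Q"
  then obtain u v where B: "orbN x \<noteq> B" "u \<in> orbN x" "v \<in> B" "(u, v) \<in> parcs \<Gamma>" "B \<in> orbN ` V"
    by (auto simp: quotient_graph_def N.perm_orbits_eq)
  then obtain z where z: "z \<in> V" "B = orbN z" by blast
  have v: "v \<in> V" "u \<in> V" using arc_verts[OF B(4)] by auto
  have vB: "orbN v = B" using N.mem_orb_iff[OF z(1), of v] B(3) z(2) by simp
  have "orbN u = orbN x" using N.mem_orb_iff[OF x, of u] B(2) by simp
  then obtain n where n: "n \<in> N" "n u = x" using N.orb_eq_iff[OF v(2) x] by blast
  have "(x, n v) \<in> parcs \<Gamma>" using arc_image[of n u v] n N_subset B(4) by auto
  moreover have "orbN v = orbN (n v)"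
    using N.orb_eq_iff[OF v(1), of "n v"] n(1) v(1) by auto
  ultimately show "orbN x \<noteq> B \<and> (\<exists>v. (x, v) \<in> parcs \<Gamma> \<and> B = orbN v)" using B(1) vB by blast
next
  assume "orbN x \<noteq> B \<and> (\<exists>v. (x, v) \<in> parcs \<Gamma> \<and> B = orbN v)"
  then obtain v where v: "orbN x \<noteq> orbN v" "(x, v) \<in> parcs \<Gamma>" "B = orbN v" by blast
  have "v \<in> V" using arc_verts[OF v(2)] by blast
  then have "x \<in> orbN x" "v \<in> orbN v" "orbN x \<in> orbN ` V" "orbN v \<in> orbN ` V"
    using N.orb_self x by auto
  with v show "(orbN x, B) \<in> parcs Q"
    unfolding quotient_graph_def pair_pre_digraph.simps N.perm_orbits_eq by blast
qed

text \<open>The walk \<open>n \<mapsto> k\<^sup>n x0\<close> meets every orbit, so the quotient is the image of the infinite path.\<close>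

lemma cyclic_or_complete_quotient:
  assumes conn: "Digraph_Component.connected (with_proj \<Gamma>)"
    and k: "k \<in> G" "k' \<in> G" "\<And>x. x \<in> V \<Longrightarrow> k' (k x) = x" "\<And>x. x \<in> V \<Longrightarrow> k (k' x) = x"
    and x0: "(x0, k x0) \<in> parcs \<Gamma>"
    and nbrs: "\<And>v. (x0, v) \<in> parcs \<Gamma> \<Longrightarrow> orbN v = orbN (k x0) \<or> orbN v = orbN (k' x0)"
  shows "cyclic_or_complete Q"
proof -
  have x0V: "x0 \<in> V" using arc_verts[OF x0] by blast
  define p where "p n = (if 0 \<le> n then (k ^^ nat n) x0 else (k' ^^ nat (- n)) x0)" for n :: int
  have kV: "(k ^^ n) x0 \<in> V" "(k' ^^ n) x0 \<in> V" for n
    using k(1,2) x0V by (induction n) auto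
  then have pV: "p n \<in> V" for n by (simp add: p_def)
  have p0: "p 0 = x0" by (simp add: p_def)
  have pk: "p (n + 1) = k (p n)" for n
  proof (cases "0 \<le> n")
    case True
    then have "nat (n + 1) = Suc (nat n)" by simp
    with True show ?thesis by (simp add: p_def)
  next
    case False
    then obtain m where m: "nat (- n) = Suc m" by (cases "nat (- n)") auto
    then have n: "n = - int m - 1" using False by simp
    show ?thesis
    proof (cases "m = 0")
      case True
      with n k(4) x0V show ?thesis by (simp add: p_def)
    next
      case False
      then have "\<not> 0 \<le> n + 1" "nat (- (n + 1)) = m" using n by auto
      moreover have "k ((k' ^^ Suc m) x0) = (k' ^^ m) x0" using k(4)[OF kV(2)] by simp
      ultimately show ?thesis using m n by (simp add: p_def del: funpow.simps)
    qed
  qed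
  have pk': "p (n - 1) = k' (p n)" for n
    using pk[of "n - 1"] k(3)[OF pV, of "n - 1"] by simp
  define \<theta> where "\<theta> n = orbN (p n)" for n
  have shift: "\<theta> n = \<theta> m \<longleftrightarrow> \<theta> (n + 1) = \<theta> (m + 1)" for n m
    unfolding \<theta>_def pk using orbN_image[OF k(1) pV pV] by simp
  have arc: "(p n, p (n + 1)) \<in> parcs \<Gamma>" for n
  proof (induction n rule: int_induct[where k = 0])
    case base
    show ?case using x0 pk[of 0] p0 by simp
  next
    case (step1 i)
    from arc_image[OF k(1) step1(2)] show ?case by (simp only: pk)
  next
    case (step2 i)
    from arc_image[OF k(2) step2(2)] show ?case using pk'[of i] pk'[of "i + 1"] by simp
  qed
  have nbr: "orbN v = \<theta> (n + 1) \<or> orbN v = \<theta> (n - 1)" if "(p n, v) \<in> parcs \<Gamma>" for n v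
    using that
  proof (induction n arbitrary: v rule: int_induct[where k = 0])
    case base
    then show ?case using nbrs[of v] p0 pk[of 0] pk'[of 0] by (simp add: \<theta>_def)
  next
    case (step1 i)
    have v: "v \<in> V" using arc_verts[OF step1(3)] by blast
    have "(p i, k' v) \<in> parcs \<Gamma>" using arc_image[OF k(2) step1(3)] pk'[of "i + 1"] by simp
    from step1(2)[OF this] have "orbN (k' v) = orbN (p (i + 1)) \<or> orbN (k' v) = orbN (p (i - 1))"
      by (simp add: \<theta>_def)
    then have "orbN (k (k' v)) = orbN (k (p (i + 1))) \<or> orbN (k (k' v)) = orbN (k (p (i - 1)))"
      using orbN_image[OF k(1) _ pV] k(2) v by simp
    then show ?case using k(4)[OF v] pk[of "i + 1"] pk[of "i - 1"] by (simp add: \<theta>_def)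
  next
    case (step2 i)
    have v: "v \<in> V" using arc_verts[OF step2(3)] by blast
    have "(p i, k v) \<in> parcs \<Gamma>" using arc_image[OF k(1) step2(3)] pk[of "i - 1"] by simp
    from step2(2)[OF this] have "orbN (k v) = orbN (p (i + 1)) \<or> orbN (k v) = orbN (p (i - 1))"
      by (simp add: \<theta>_def)
    then have "orbN (k' (k v)) = orbN (k' (p (i + 1))) \<or> orbN (k' (k v)) = orbN (k' (p (i - 1)))"
      using orbN_image[OF k(2) _ pV] k(1) v by simp
    then show ?case using k(3)[OF v] pk'[of "i + 1"] pk'[of "i - 1"] by (simp add: \<theta>_def)
  qed
  have arcs: "(\<theta> n, B) \<in> parcs Q \<longleftrightarrow> \<theta> n \<noteq> B \<and> (B = \<theta> (n + 1) \<or> B = \<theta> (n - 1))" for n B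
  proof -
    have "(p n, p (n - 1)) \<in> parcs \<Gamma>" using arc_sym[OF arc[of "n - 1"]] by simp
    with nbr[of n] arc[of n] show ?thesis
      unfolding \<theta>_def Q_arc_iff[OF pV] by blast
  qed
  \<comment> \<open>The neighbours of an orbit on the walk are again on the walk, so the vertices
    with such an orbit form an arc-closed set and connectedness applies.\<close>
  have "V \<subseteq> {v \<in> V. orbN v \<in> range \<theta>}"
  proof -
    have "arc_closed \<Gamma> {v \<in> V. orbN v \<in> range \<theta>}"
      unfolding arc_closed_def
    proof (intro allI impI)
      fix v w assume v: "v \<in> {v \<in> V. orbN v \<in> range \<theta>}" and vw: "(v, w) \<in> parcs \<Gamma>"
      then obtain n where n: "orbN v = \<theta> n" "v \<in> V" by blast
      have w: "w \<in> V" using arc_verts[OF vw] by blast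
      show "w \<in> {v \<in> V. orbN v \<in> range \<theta>}"
      proof (cases "orbN v = orbN w")
        case True
        with n w show ?thesis by simp
      next
        case False
        then have "(\<theta> n, orbN w) \<in> parcs Q" using Q_arc_iff[OF n(2)] vw n(1) by auto
        then have "orbN w = \<theta> (n + 1) \<or> orbN w = \<theta> (n - 1)" using arcs[of n "orbN w"] by simp
        then show ?thesis using w by auto
      qed
    qed
    moreover have "x0 \<in> {v \<in> V. orbN v \<in> range \<theta>}" using x0V p0 unfolding \<theta>_def by blast
    ultimately show ?thesis using conn x0V unfolding connected_iff[OF pair_graph] by meson
  qed
  moreover have "range \<theta> \<subseteq> orbN ` V" using pV unfolding \<theta>_def by (intro image_subsetI imageI)
  ultimately have verts: "pverts Q = range \<theta>"
    unfolding Q_verts by (intro equalityI image_subsetI) auto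
  show ?thesis
  proof (rule cyclic_or_completeI[of _ \<theta>])
    show "finite (pverts Q)" unfolding Q_verts using finite_verts by simp
    show "parcs Q \<subseteq> pverts Q \<times> pverts Q" by (auto simp: quotient_graph_def)
  qed (fact verts shift arcs)+
qed

end

context graph_grp
begin

text \<open>If g moves every vertex within its orbit, it maps each orbit into itself, and
  surjectivity of g makes the image the whole orbit.\<close>

lemma mem_orbit_kernel_iff:
  assumes "normal_sub N"
  shows "g \<in> orbit_kernel (V) G N \<longleftrightarrow>
    g \<in> G \<and> (\<forall>x\<in>V. perm_grp.orb N (g x) = perm_grp.orb N x)"
proof -
  interpret normal_quotient \<Gamma> G N by unfold_locales fact
  have "(\<forall>B\<in>perm_orbits (V) N. g ` B = B) \<longleftrightarrow> (\<forall>x\<in>V. orbN (g x) = orbN x)"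
    if g: "g \<in> G"
  proof
    assume *: "\<forall>B\<in>perm_orbits (V) N. g ` B = B"
    show "\<forall>x\<in>V. orbN (g x) = orbN x"
    proof
      fix x assume x: "x \<in> V"
      then have "g ` orbN x = orbN x" using * unfolding N.perm_orbits_eq by blast
      then have "g x \<in> orbN x" using N.orb_self[OF x] by blast
      then show "orbN (g x) = orbN x" using N.mem_orb_iff[OF x] by blast
    qed
  next
    assume *: "\<forall>x\<in>V. orbN (g x) = orbN x"
    have "g ` orbN x = orbN x" if x: "x \<in> V" for x
    proof (intro equalityI subsetI)
      fix y assume "y \<in> g ` orbN x"
      then obtain z where z: "z \<in> orbN x" "y = g z" by blast
      then have "z \<in> V" "orbN z = orbN x" using N.mem_orb_iff[OF x] by auto
      then show "y \<in> orbN x" using N.mem_orb_iff[OF x] * z(2) g by simp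
    next
      fix y assume "y \<in> orbN x"
      then have y: "y \<in> V" "orbN y = orbN x" using N.mem_orb_iff[OF x] by auto
      obtain z where z: "z \<in> V" "g z = y" using surj[OF g y(1)] by blast
      then have "orbN z = orbN x" using * y(2) by auto
      then have "z \<in> orbN x" using N.mem_orb_iff[OF x] z by simp
      with z show "y \<in> g ` orbN x" by blast
    qed
    then show "\<forall>B\<in>perm_orbits (V) N. g ` B = B" unfolding N.perm_orbits_eq by blast
  qed
  then show ?thesis unfolding orbit_kernel_def by blast
qed

lemma normal_subI:
  assumes "N \<subseteq> G" "\<exists>e\<in>N. \<forall>x\<in>V. e x = x"
    and "\<And>g h. \<lbrakk>g \<in> N; h \<in> N\<rbrakk> \<Longrightarrow> \<exists>k\<in>N. \<forall>x\<in>V. k x = g (h x)"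
    and "\<And>g. g \<in> N \<Longrightarrow> \<exists>h\<in>N. \<forall>x\<in>V. h (g x) = x"
    and "\<And>g n. \<lbrakk>g \<in> G; n \<in> N\<rbrakk> \<Longrightarrow> \<exists>n'\<in>N. \<forall>x\<in>V. n' (g x) = g (n x)"
  shows "normal_sub N"
  unfolding normal_sub_def
proof (intro conjI)
  show "perm_grp (V) N"
    by unfold_locales (use assms subset_Bij in auto)
qed (use assms in auto)

end

section \<open>Lattice quotients in OG(4)\<close>

locale lattice_pair = graph_grp \<Gamma> G + lattice_cover B r s \<Gamma> G \<pi>
  for B r s and \<Gamma> :: "'a pair_pre_digraph" and G \<pi> +
  assumes r3: "3 \<le> r" and s3: "3 \<le> s"
begin

text \<open>Neighbours differ by 1 and two neighbours of one vertex by 0 or 2 in each coordinate;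
  moduli at least 3 keep such labels apart.\<close>

lemma not_dvd_small:
  assumes "\<bar>k\<bar> = 1 \<or> \<bar>k\<bar> = 2"
  shows "\<not> int r dvd k" "\<not> int s dvd k"
proof -
  have "k \<noteq> 0" using assms by auto
  then show "\<not> int r dvd k" "\<not> int s dvd k"
    using assms r3 s3 dvd_imp_le_int[of k "int r"] dvd_imp_le_int[of k "int s"] by auto
qed

lemma actsD: "\<lbrakk>acts \<pi> g e1 e2 a b; even (x + y)\<rbrakk> \<Longrightarrow> g (\<pi> x y) = \<pi> (e1 * x + a) (e2 * y + b)"
  by (simp add: acts_def)

lemma actsI:
  assumes "\<And>x y. even (x + y) \<Longrightarrow> g (\<pi> x y) = \<pi> (e1 * x + a) (e2 * y + b)"
  shows "acts \<pi> g e1 e2 a b"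
  using assms by (simp add: acts_def)

lemma acts_comp:
  assumes "acts \<pi> g e1 e2 a b" "acts \<pi> h e1' e2' a' b'" "admissible B e1' e2' a' b'"
    and "\<And>x. x \<in> V \<Longrightarrow> k x = g (h x)"
  shows "acts \<pi> k (e1 * e1') (e2 * e2') (e1 * a' + a) (e2 * b' + b)"
  by (rule acts_compI[OF assms(1-3)]) (use assms(4) mem_verts in blast)

lemma acts_inverse:
  assumes "acts \<pi> g e1 e2 a b" "admissible B e1 e2 a b"
    and "\<And>x. x \<in> V \<Longrightarrow> h (g x) = x"
  shows "acts \<pi> h e1 e2 (- e1 * a) (- e2 * b)"
  by (rule acts_inverseI[OF assms(1,2)]) (use assms(3) mem_verts in blast)

text \<open>Here n' is the conjugate of n by g. It has the signs of n because diagonal linear parts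
  commute; only the translation part changes.\<close>

lemma acts_conj:
  assumes "acts \<pi> n f1 f2 a b" "admissible B f1 f2 a b"
    and "acts \<pi> g e1 e2 c d" "admissible B e1 e2 c d" "g \<in> G"
    and "\<And>x. x \<in> V \<Longrightarrow> n' (g x) = g (n x)"
  shows "acts \<pi> n' f1 f2 (c + e1 * a - f1 * c) (d + e2 * b - f2 * d)"
proof -
  obtain h where h: "h \<in> G" "\<forall>x\<in>V. h (g x) = x" "\<forall>x\<in>V. g (h x) = x"
    using ex_inv[OF assms(5)] by blast
  have ha: "acts \<pi> h e1 e2 (- e1 * c) (- e2 * d)" using acts_inverse[OF assms(3,4)] h(2) by blast
  have 1: "acts \<pi> (\<lambda>x. n (h x)) (f1 * e1) (f2 * e2) (f1 * (- e1 * c) + a) (f2 * (- e2 * d) + b)"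
    by (rule acts_comp[OF assms(1) ha admissible_inv[OF assms(4)]]) simp
  have 2: "acts \<pi> n' (e1 * (f1 * e1)) (e2 * (f2 * e2))
      (e1 * (f1 * (- e1 * c) + a) + c) (e2 * (f2 * (- e2 * d) + b) + d)"
  proof (rule acts_comp[OF assms(3) 1 admissible_comp[OF assms(2) admissible_inv[OF assms(4)]]])
    fix x assume x: "x \<in> V"
    then show "n' x = g (n (h x))" using assms(6)[of "h x"] h by simp
  qed
  have "e1 = 1 \<or> e1 = -1" "e2 = 1 \<or> e2 = -1" using assms(4) by (auto elim!: admissible_cases)
  with 2 show ?thesis by (elim disjE) (simp_all add: algebra_simps)
qed

lemma origin: "\<pi> 0 0 \<in> V" by (rule mem_verts) simp

lemma connected: "Digraph_Component.connected (with_proj \<Gamma>)"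
  unfolding connected_iff[OF pair_graph]
proof (intro conjI ballI allI impI)
  show "V \<noteq> {}" using origin by blast
  fix u W assume u: "u \<in> V" and uW: "u \<in> W" and W: "arc_closed \<Gamma> W"
  obtain x0 y0 where xy0: "even (x0 + y0)" "u = \<pi> x0 y0" using u by (rule vertsE)
  have step: "\<pi> (x + a) (y + b) \<in> W" if "\<pi> x y \<in> W" "even (x + y)" "\<bar>a\<bar> = 1" "\<bar>b\<bar> = 1" for x y a b
    using arcI[of x y a b] that W unfolding arc_closed_def by blast
  \<comment> \<open>Diagonal moves bring the second coordinate to its target; the first is then off
    by an even amount, which pairs of steps (1, 1), (1, -1) or their mirror images correct.\<close>
  have diag: "\<pi> (x0 + n) (y0 + n) \<in> W" for n
  proof (induction n rule: int_induct[where k = 0])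
    case base
    show ?case using xy0 uW by simp
  next
    case (step1 i)
    have "even ((x0 + i) + (y0 + i))" using xy0(1) by simp
    from step[OF step1(2) this, of 1 1] show ?case by (simp add: add.assoc)
  next
    case (step2 i)
    have "even ((x0 + i) + (y0 + i))" using xy0(1) by simp
    from step[OF step2(2) this, of "-1" "-1"] show ?case by (simp add: algebra_simps)
  qed
  have hor: "\<pi> (x + 2 * k) y \<in> W" if xy: "even (x + y)" "\<pi> x y \<in> W" for x y k
  proof (induction k rule: int_induct[where k = 0])
    case base
    show ?case using xy by simp
  next
    case (step1 i)
    have "\<pi> (x + 2 * i + 1) (y + 1) \<in> W" by (rule step[OF step1(2)]) (use xy in auto)
    then have "\<pi> (x + 2 * i + 1 + 1) (y + 1 + -1) \<in> W" by (rule step) (use xy in auto)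
    then show ?case by (simp add: algebra_simps)
  next
    case (step2 i)
    have "\<pi> (x + 2 * i + -1) (y + 1) \<in> W" by (rule step[OF step2(2)]) (use xy in auto)
    then have "\<pi> (x + 2 * i + -1 + -1) (y + 1 + -1) \<in> W" by (rule step) (use xy in auto)
    then show ?case by (simp add: algebra_simps)
  qed
  show "V \<subseteq> W"
  proof
    fix v assume "v \<in> V"
    then obtain x y where xy: "even (x + y)" "v = \<pi> x y" by (rule vertsE)
    let ?n = "y - y0"
    have "even (x - (x0 + ?n))" "even (x0 + ?n + (y0 + ?n))" using xy(1) xy0(1) by auto
    from this(1) obtain k where "x - (x0 + ?n) = 2 * k" by (rule evenE)
    then have k: "x = x0 + ?n + 2 * k" by simp
    from hor[OF \<open>even (x0 + ?n + (y0 + ?n))\<close> diag, of k]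
    show "v \<in> W" unfolding xy(2) by (simp add: k[symmetric])
  qed
qed

lemma nbrs_distinct:
  assumes "even (x + y)" "\<bar>a\<bar> = 1" "\<bar>b\<bar> = 1" "\<bar>a'\<bar> = 1" "\<bar>b'\<bar> = 1"
    and "\<pi> (x + a) (y + b) = \<pi> (x + a') (y + b')"
  shows "a = a' \<and> b = b'"
proof -
  have "even ((x + a) + (y + b))" "even ((x + a') + (y + b'))" using assms abs_eq_one_odd by simp_all
  with eq_iff assms(6) have "int r dvd a - a'" "int s dvd b - b'" by fastforce+
  moreover have "a - a' = 0 \<or> \<bar>a - a'\<bar> = 2" "b - b' = 0 \<or> \<bar>b - b'\<bar> = 2" using assms(2-5) by auto
  ultimately show ?thesis using not_dvd_small by auto
qed

lemma out_degree_4: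
  assumes "v \<in> V"
  shows "out_degree (with_proj \<Gamma>) v = 4"
proof -
  obtain x y where xy: "even (x + y)" "v = \<pi> x y" using assms by (rule vertsE)
  let ?f = "\<lambda>(a, b). (\<pi> x y, \<pi> (x + a) (y + b))"
  let ?S = "{1, -1 :: int} \<times> {1, -1 :: int}"
  have "out_arcs (with_proj \<Gamma>) v = ?f ` ?S"
  proof (intro equalityI subsetI)
    fix e assume "e \<in> out_arcs (with_proj \<Gamma>) v"
    then have e: "e \<in> parcs \<Gamma>" "fst e = v" by (auto simp: out_arcs_def)
    then have "(\<pi> x y, snd e) \<in> parcs \<Gamma>" using xy by (metis prod.collapse)
    then obtain a b where "\<bar>a\<bar> = 1" "\<bar>b\<bar> = 1" "snd e = \<pi> (x + a) (y + b)"
      using xy(1) by (rule arcE)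
    then show "e \<in> ?f ` ?S" using e xy(2)
      by (intro image_eqI[of _ _ "(a, b)"]) (auto simp: prod_eq_iff)
  next
    fix e assume "e \<in> ?f ` ?S"
    then obtain z where z: "z \<in> ?S" "e = ?f z" by blast
    obtain a b where "z = (a, b)" by (cases z)
    with z have "\<bar>a\<bar> = 1" "\<bar>b\<bar> = 1" "e = (\<pi> x y, \<pi> (x + a) (y + b))" by auto
    then show "e \<in> out_arcs (with_proj \<Gamma>) v"
      using arcI[OF xy(1)] xy(2) by (simp add: out_arcs_def)
  qed
  moreover have "inj_on ?f ?S"
  proof (rule inj_onI)
    fix z w assume "z \<in> ?S" "w \<in> ?S" "?f z = ?f w"
    moreover obtain a b a' b' where "z = (a, b)" "w = (a', b')" by (cases z, cases w)
    moreover have "\<bar>c\<bar> = 1" if "c \<in> {1, -1}" for c :: int using that by auto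
    ultimately show "z = w" using nbrs_distinct[OF xy(1), of a b a' b'] by auto
  qed
  then have "card (?f ` ?S) = 4" by (simp add: card_image)
  ultimately show ?thesis by (simp add: out_degree_def)
qed

lemma ex_from_origin:
  assumes "even (x + y)"
  shows "\<exists>g\<in>G. g (\<pi> 0 0) = \<pi> x y"
proof -
  have "admissible B 1 (if B \<and> odd x then -1 else 1) x y"
    using assms by (auto simp: admissible_def)
  from ex_acts[OF this] show ?thesis using actsD[of _ _ _ _ _ 0 0] by fastforce
qed

lemma vertex_transitive: "transitive_on G (\<lambda>g. g) (V)"
  unfolding transitive_on_def
proof (intro ballI)
  fix u v assume "u \<in> V" "v \<in> V"
  then obtain g h where gh: "g \<in> G" "g (\<pi> 0 0) = u" "h \<in> G" "h (\<pi> 0 0) = v"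
    using ex_from_origin by (metis vertsE)
  obtain g' where g': "g' \<in> G" "\<forall>x\<in>V. g' (g x) = x" using ex_inverse[OF gh(1)] by blast
  obtain k where k: "k \<in> G" "\<forall>x\<in>V. k x = h (g' x)" using ex_comp[OF gh(3) g'(1)] by blast
  have "g' u = \<pi> 0 0" using g'(2) gh(2) origin by blast
  then have "k u = v" using k(2) \<open>u \<in> V\<close> gh(4) by simp
  with k(1) show "\<exists>g\<in>G. g u = v" by blast
qed

text \<open>An admissible map sending the origin to (x, y) sends (1, 1) to (x + e1, y + e2), so the
  question is whether the direction of the edge is a permitted sign pair at one of its two
  ends.\<close>

lemma ex_from_base_edge:
  assumes "(u, v) \<in> parcs \<Gamma>"
  shows "\<exists>g\<in>G. g ` {\<pi> 0 0, \<pi> 1 1} = {u, v}"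
proof -
  obtain x y a b where *: "even (x + y)" "u = \<pi> x y" "v = \<pi> (x + a) (y + b)" "\<bar>a\<bar> = 1" "\<bar>b\<bar> = 1"
    using assms unfolding arcs lattice_arcs_def by blast
  have from_adm: "\<exists>g\<in>G. g ` {\<pi> 0 0, \<pi> 1 1} = {\<pi> c d, \<pi> (c + e1) (d + e2)}"
    if adm: "admissible B e1 e2 c d" for e1 e2 c d
  proof -
    obtain g where g: "g \<in> G" "acts \<pi> g e1 e2 c d" using ex_acts[OF adm] by blast
    have "g (\<pi> 0 0) = \<pi> c d" "g (\<pi> 1 1) = \<pi> (c + e1) (d + e2)"
      using actsD[OF g(2), of 0 0] actsD[OF g(2), of 1 1] by (simp_all add: add.commute)
    with g(1) show ?thesis by (intro bexI[of _ g]) auto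
  qed
  \<comment> \<open>If (a, b) is not a permitted sign pair at (x, y), the edge is read from its
    other end: both signs change and so does the parity of the first coordinate. Without
    \<open>B\<close> this makes the second sign 1; with \<open>B\<close> it repairs the parity
    condition.\<close>
  show ?thesis
  proof (cases "if B then a = b \<longleftrightarrow> even x else b = 1")
    case True
    then have "admissible B a b x y" using * by (auto simp: admissible_def)
    from from_adm[OF this] * show ?thesis by simp
  next
    case False
    have "odd a" "odd b" using * abs_eq_one_odd by auto
    then have "admissible B (-a) (-b) (x + a) (y + b)" using False * by (auto simp: admissible_def)
    from from_adm[OF this] * show ?thesis by (simp add: insert_commute)
  qed
qed

lemma edge_transitive: "transitive_on G (\<lambda>g e. g ` e) (graph_edges \<Gamma>)"
  unfolding transitive_on_def
proof (intro ballI)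
  fix e f assume "e \<in> graph_edges \<Gamma>" "f \<in> graph_edges \<Gamma>"
  then obtain u v u' v' where uv: "e = {u, v}" "(u, v) \<in> parcs \<Gamma>" "f = {u', v'}" "(u', v') \<in> parcs \<Gamma>"
    unfolding graph_edges_def mem_Collect_eq by (elim exE conjE)
  obtain g where g: "g \<in> G" "g ` {\<pi> 0 0, \<pi> 1 1} = e" using ex_from_base_edge[OF uv(2)] uv(1) by auto
  obtain h where h: "h \<in> G" "h ` {\<pi> 0 0, \<pi> 1 1} = f" using ex_from_base_edge[OF uv(4)] uv(3) by auto
  note gh = g h
  obtain g' where g': "g' \<in> G" "\<forall>x\<in>V. g' (g x) = x" using ex_inverse[OF gh(1)] by blast
  obtain k where k: "k \<in> G" "\<forall>x\<in>V. k x = h (g' x)" using ex_comp[OF gh(3) g'(1)] by blast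
  have V: "\<pi> 0 0 \<in> V" "\<pi> 1 1 \<in> V" by (auto intro!: mem_verts)
  have "k ` e = f"
    unfolding gh(2)[symmetric] gh(4)[symmetric] using k(2) g'(2) gh(1) V by simp
  with k(1) show "\<exists>g\<in>G. g ` e = f" by blast
qed

lemma not_arc_transitive: "\<not> transitive_on G (\<lambda>g. map_prod g g) (parcs \<Gamma>)"
proof
  assume tr: "transitive_on G (\<lambda>g. map_prod g g) (parcs \<Gamma>)"
  have "(\<pi> 0 0, \<pi> 1 1) \<in> parcs \<Gamma>" using arcI[of 0 0 1 1] by simp
  moreover from this have "(\<pi> 1 1, \<pi> 0 0) \<in> parcs \<Gamma>" by (rule arc_sym)
  ultimately obtain g where "g \<in> G" "map_prod g g (\<pi> 0 0, \<pi> 1 1) = (\<pi> 1 1, \<pi> 0 0)"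
    using tr unfolding transitive_on_def by blast
  then have g: "g \<in> G" "g (\<pi> 0 0) = \<pi> 1 1" "g (\<pi> 1 1) = \<pi> 0 0" by simp_all
  obtain e1 e2 a b where adm: "admissible B e1 e2 a b" and act: "acts \<pi> g e1 e2 a b"
    using acts_ex[OF g(1)] by blast
  have "\<pi> a b = \<pi> 1 1" "\<pi> (e1 + a) (e2 + b) = \<pi> 0 0"
    using actsD[OF act, of 0 0] actsD[OF act, of 1 1] g by simp_all
  moreover have "even (a + b)" "even ((e1 + a) + (e2 + b))"
    using admissible_parity[OF adm, of 0 0] admissible_parity[OF adm, of 1 1] by simp_all
  ultimately have d: "int r dvd a - 1" "int s dvd b - 1" "int r dvd e1 + a" "int s dvd e2 + b"
    "B \<longrightarrow> odd a"
    using eq_iff[of a b 1 1] eq_iff[of "e1 + a" "e2 + b" 0 0] by auto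
  have e: "e1 = 1 \<or> e1 = -1" "e2 = 1 \<or> e2 = -1" using adm by (auto elim!: admissible_cases)
  have "int r dvd (e1 + a) - (a - 1)" by (rule dvd_diff[OF d(3,1)])
  then have "e1 = -1" using not_dvd_small(1)[of 2] e(1) by auto
  moreover have "int s dvd (e2 + b) - (b - 1)" by (rule dvd_diff[OF d(4,2)])
  then have "e2 = -1" using not_dvd_small(2)[of 2] e(2) by auto
  \<comment> \<open>A swap of the ends of the base arc has both signs -1. Without \<open>B\<close>
    the second sign is always 1; with \<open>B\<close> equal signs need an even a, while a is odd
    because it labels the same vertex as 1.\<close>
  ultimately show False using adm d(5) by (auto simp: admissible_def split: if_splits)
qed

lemma OG4: "OG4 \<Gamma> G"
  unfolding OG4_def
  using pair connected out_degree_4 vertex_transitive edge_transitive not_arc_transitive by blast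

end

context lattice_pair
begin

section \<open>Translation subgroups\<close>

definition shift_group :: "(int \<Rightarrow> int \<Rightarrow> bool) \<Rightarrow> ('a \<Rightarrow> 'a) set" where
  "shift_group L = {g \<in> G. \<exists>a b. L a b \<and> acts \<pi> g 1 1 a b}"

text \<open>Conjugation by an admissible map multiplies the entries of a translation by signs, so
  closure under separate sign changes is what makes the translation group normal. The parity clause
  makes all its translations admissible.\<close>

definition sign_lattice :: "(int \<Rightarrow> int \<Rightarrow> bool) \<Rightarrow> bool" where
  "sign_lattice L \<longleftrightarrow> L 0 0 \<and> (\<forall>a b a' b'. L a b \<longrightarrow> L a' b' \<longrightarrow> L (a + a') (b + b')) \<and>
     (\<forall>a b. L a b \<longrightarrow> L (- a) b \<and> L a (- b)) \<and> (\<forall>a b. L a b \<longrightarrow> even (a + b) \<and> (B \<longrightarrow> even a))"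

lemma admissible_shift: "admissible B 1 1 a b \<longleftrightarrow> even (a + b) \<and> (B \<longrightarrow> even a)"
  by (auto simp: admissible_def)

lemma acts_eqI:
  assumes "acts \<pi> g e1 e2 a b" "acts \<pi> h e1 e2 a b" "v \<in> V"
  shows "g v = h v"
  using assms(3) by (rule vertsE) (use assms(1,2) in \<open>simp add: acts_def\<close>)

lemma ex_translation:
  assumes "sign_lattice L" "L a b"
  shows "\<exists>g\<in>shift_group L. acts \<pi> g 1 1 a b"
proof -
  have "admissible B 1 1 a b" using assms by (auto simp: sign_lattice_def admissible_shift)
  with assms(2) ex_acts show ?thesis unfolding shift_group_def by blast
qed

lemma normal_shift_group:
  assumes L: "sign_lattice L"
  shows "normal_sub (shift_group L)"
proof (rule normal_subI)
  have adm: "admissible B 1 1 a b" if "L a b" for a b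
    using that L by (auto simp: sign_lattice_def admissible_shift)
  show "shift_group L \<subseteq> G" by (auto simp: shift_group_def)
  have "L 0 0" using L by (simp add: sign_lattice_def)
  then obtain e where e: "e \<in> shift_group L" "acts \<pi> e 1 1 0 0" using ex_translation[OF L] by blast
  have "e x = x" if "x \<in> V" for x
    using that by (rule vertsE) (use actsD[OF e(2)] in simp)
  with e(1) show "\<exists>e\<in>shift_group L. \<forall>x\<in>V. e x = x" by blast
  show "\<exists>k\<in>shift_group L. \<forall>x\<in>V. k x = g (h x)"
    if "g \<in> shift_group L" "h \<in> shift_group L" for g h
  proof -
    from that obtain a b a' b' where *: "g \<in> G" "L a b" "acts \<pi> g 1 1 a b"
      "h \<in> G" "L a' b'" "acts \<pi> h 1 1 a' b'" unfolding shift_group_def by blast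
    obtain k where k: "k \<in> G" "\<forall>x\<in>V. k x = g (h x)" using ex_comp[OF *(1,4)] by blast
    have "acts \<pi> k (1 * 1) (1 * 1) (1 * a' + a) (1 * b' + b)"
      by (rule acts_comp[OF *(3,6) adm[OF *(5)]]) (use k(2) in blast)
    moreover have "L (a' + a) (b' + b)" using L *(2,5) unfolding sign_lattice_def by blast
    ultimately have "k \<in> shift_group L" using k(1) unfolding shift_group_def by auto
    with k(2) show ?thesis by blast
  qed
  show "\<exists>h\<in>shift_group L. \<forall>x\<in>V. h (g x) = x" if "g \<in> shift_group L" for g
  proof -
    from that obtain a b where *: "g \<in> G" "L a b" "acts \<pi> g 1 1 a b"
      unfolding shift_group_def by blast
    obtain h where h: "h \<in> G" "\<forall>x\<in>V. h (g x) = x" using ex_inverse[OF *(1)] by blast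
    have "acts \<pi> h 1 1 (- 1 * a) (- 1 * b)"
      by (rule acts_inverse[OF *(3) adm[OF *(2)]]) (use h(2) in blast)
    moreover have "L (- a) (- b)" using L *(2) unfolding sign_lattice_def by blast
    ultimately have "h \<in> shift_group L" using h(1) unfolding shift_group_def by auto
    with h(2) show ?thesis by blast
  qed
  show "\<exists>n'\<in>shift_group L. \<forall>x\<in>V. n' (g x) = g (n x)"
    if g: "g \<in> G" and n: "n \<in> shift_group L" for g n
  proof -
    from n obtain a b where *: "n \<in> G" "L a b" "acts \<pi> n 1 1 a b"
      unfolding shift_group_def by blast
    obtain e1 e2 c d where ga: "admissible B e1 e2 c d" "acts \<pi> g e1 e2 c d" using acts_ex[OF g] by blast
    have "e1 = 1 \<or> e1 = -1" "e2 = 1 \<or> e2 = -1" using ga(1) by (auto elim!: admissible_cases)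
    then have "L (e1 * a) (e2 * b)"
      using L *(2) unfolding sign_lattice_def by (elim disjE) auto
    then obtain n' where n': "n' \<in> shift_group L" "acts \<pi> n' 1 1 (e1 * a) (e2 * b)"
      using ex_translation[OF L] by blast
    have "acts \<pi> (\<lambda>x. n' (g x)) (1 * e1) (1 * e2) (1 * c + e1 * a) (1 * d + e2 * b)"
      by (rule acts_comp[OF n'(2) ga(2,1)]) simp
    moreover have "acts \<pi> (\<lambda>x. g (n x)) (e1 * 1) (e2 * 1) (e1 * a + c) (e2 * b + d)"
      by (rule acts_comp[OF ga(2) *(3) adm[OF *(2)]]) simp
    ultimately have "n' (g x) = g (n x)" if "x \<in> V" for x
      using acts_eqI[of "\<lambda>x. n' (g x)" e1 e2 "e1 * a + c" "e2 * b + d" "\<lambda>x. g (n x)" x] that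
      by (simp add: add.commute)
    with n'(1) show ?thesis by blast
  qed
qed

lemma orb_shift_group:
  assumes L: "sign_lattice L" and xy: "even (x + y)" "even (x' + y')"
    and eq: "perm_grp.orb (shift_group L) (\<pi> x y) = perm_grp.orb (shift_group L) (\<pi> x' y')"
  shows "\<exists>a b. L a b \<and> \<pi> x' y' = \<pi> (x + a) (y + b)"
proof -
  interpret normal_quotient \<Gamma> G "shift_group L"
    by unfold_locales (rule normal_shift_group[OF L])
  obtain n where n: "n \<in> shift_group L" "n (\<pi> x y) = \<pi> x' y'"
    using eq N.orb_eq_iff[OF mem_verts[OF xy(1)] mem_verts[OF xy(2)]] by blast
  then obtain a b where ab: "L a b" "acts \<pi> n 1 1 a b" unfolding shift_group_def by blast
  have "\<pi> x' y' = \<pi> (x + a) (y + b)" using actsD[OF ab(2) xy(1)] n(2) by simp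
  with ab(1) show ?thesis by blast
qed

lemma nontrivial_shift_group:
  assumes L: "sign_lattice L" and ab: "L a b" "\<not> (int r dvd a \<and> int s dvd b)"
  shows "nontrivial_normal (V) G (shift_group L)"
proof -
  obtain g where g: "g \<in> shift_group L" "acts \<pi> g 1 1 a b" using ex_translation[OF L ab(1)] by blast
  have "g (\<pi> 0 0) = \<pi> a b" using actsD[OF g(2), of 0 0] by simp
  moreover have "\<pi> a b \<noteq> \<pi> 0 0"
    using eq_iff[of a b 0 0] ab L by (auto simp: sign_lattice_def)
  ultimately show ?thesis
    unfolding nontrivial_normal_iff' using normal_shift_group[OF L] g(1) origin by metis
qed

section \<open>Lifting normal subgroups to the lattice\<close>

lemma nbr_of_origin:
  assumes "(\<pi> 0 0, v) \<in> parcs \<Gamma>"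
  shows "v \<in> {\<pi> 1 1, \<pi> 1 (-1), \<pi> (-1) 1, \<pi> (-1) (-1)}"
proof -
  obtain a b where "\<bar>a\<bar> = 1" "\<bar>b\<bar> = 1" "v = \<pi> (0 + a) (0 + b)"
    using assms by (rule arcE) simp
  then have "a = 1 \<or> a = -1" "b = 1 \<or> b = -1" by auto
  with \<open>v = \<pi> (0 + a) (0 + b)\<close> show ?thesis by auto
qed

end

locale lattice_normal = lattice_pair B r s \<Gamma> G \<pi> + normal_quotient \<Gamma> G N
  for B r s and \<Gamma> :: "'a pair_pre_digraph" and G \<pi> N
begin

text \<open>The lattice maps that induce elements of N, so that products and commutators become
  arithmetic of integers. By \<open>T_kernel\<close> the kernel translations are always among
  them.\<close>

definition NN :: "int \<Rightarrow> int \<Rightarrow> int \<Rightarrow> int \<Rightarrow> bool" where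
  "NN e1 e2 a b \<longleftrightarrow> (\<exists>n\<in>N. acts \<pi> n e1 e2 a b)"

abbreviation T where "T \<equiv> NN 1 1"

lemma NN_comp:
  assumes "NN e1 e2 a b" "NN e1' e2' a' b'" "admissible B e1' e2' a' b'"
  shows "NN (e1 * e1') (e2 * e2') (e1 * a' + a) (e2 * b' + b)"
proof -
  obtain g h where *: "g \<in> N" "acts \<pi> g e1 e2 a b" "h \<in> N" "acts \<pi> h e1' e2' a' b'"
    using assms(1,2) unfolding NN_def by blast
  obtain k where k: "k \<in> N" "\<forall>x\<in>V. k x = g (h x)" using N.ex_comp[OF *(1,3)] by blast
  with acts_comp[OF *(2,4) assms(3), of k] show ?thesis unfolding NN_def by blast
qed

lemma NN_inv:
  assumes "NN e1 e2 a b" "admissible B e1 e2 a b"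
  shows "NN e1 e2 (- e1 * a) (- e2 * b)"
proof -
  obtain g where *: "g \<in> N" "acts \<pi> g e1 e2 a b" using assms(1) unfolding NN_def by blast
  obtain h where h: "h \<in> N" "\<forall>x\<in>V. h (g x) = x" using N.ex_inverse[OF *(1)] by blast
  with acts_inverse[OF *(2) assms(2), of h] show ?thesis unfolding NN_def by blast
qed

text \<open>For normal N the commutator of g in G with n in N lies in N, and it is a translation
  since diagonal sign matrices commute. This is the source of all short translations.\<close>

lemma NN_commutator:
  assumes NN: "NN f1 f2 a b" and f: "admissible B f1 f2 a b" and e: "admissible B e1 e2 c d"
  shows "T (c + e1 * a - f1 * c - a) (d + e2 * b - f2 * d - b)"
proof -
  obtain n where n: "n \<in> N" "acts \<pi> n f1 f2 a b" using NN unfolding NN_def by blast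
  obtain g where g: "g \<in> G" "acts \<pi> g e1 e2 c d" using ex_acts[OF e] by blast
  obtain n' where n': "n' \<in> N" "\<forall>x\<in>V. n' (g x) = g (n x)"
    using normal n(1) g(1) unfolding normal_sub_def by blast
  have "acts \<pi> n' f1 f2 (c + e1 * a - f1 * c) (d + e2 * b - f2 * d)"
    by (rule acts_conj[OF n(2) f g(2) e g(1)]) (use n'(2) in blast)
  then have "NN f1 f2 (c + e1 * a - f1 * c) (d + e2 * b - f2 * d)" using n'(1) unfolding NN_def by blast
  from NN_comp[OF this NN_inv[OF NN f] admissible_inv[OF f]]
  have "NN (f1 * f1) (f2 * f2) (f1 * (- f1 * a) + (c + e1 * a - f1 * c)) (f2 * (- f2 * b) + (d + e2 * b - f2 * d))" .
  moreover have "f1 = 1 \<or> f1 = -1" "f2 = 1 \<or> f2 = -1" using f by (auto elim!: admissible_cases)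
  ultimately show ?thesis by (elim disjE) (simp_all add: algebra_simps)
qed

lemma T_add:
  assumes "T a b" "T a' b'" "even (a' + b')" "B \<longrightarrow> even a'"
  shows "T (a + a') (b + b')"
  using NN_comp[OF assms(1,2)] assms(3,4) by (simp add: admissible_shift add.commute)

lemma T_neg:
  assumes "T a b" "even (a + b)" "B \<longrightarrow> even a"
  shows "T (- a) (- b)"
  using NN_inv[OF assms(1)] assms(2,3) by (simp add: admissible_shift)

lemma T_kernel:
  assumes "even (a + b)" "B \<longrightarrow> even a" "int r dvd a" "int s dvd b"
  shows "T a b"
proof -
  obtain e where e: "e \<in> N" "\<forall>x\<in>V. e x = x" using N.ex_id by blast
  have "acts \<pi> e 1 1 a b"
  proof (rule actsI)
    fix x y :: int assume xy: "even (x + y)"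
    then have "\<pi> x y = \<pi> (x + a) (y + b)"
      using eq_iff[of x y "x + a" "y + b"] assms by auto
    then show "e (\<pi> x y) = \<pi> (1 * x + a) (1 * y + b)" using e(2) mem_verts[OF xy] by simp
  qed
  with e(1) show ?thesis unfolding NN_def by blast
qed

lemma T_mult:
  assumes "T a b" "even (a + b)" "B \<longrightarrow> even a"
  shows "T (k * a) (k * b)"
proof (induction k rule: int_induct[where k = 0])
  case base
  show ?case using T_kernel[of 0 0] by simp
next
  case (step1 i)
  from T_add[OF step1(2) assms] show ?case by (simp add: algebra_simps)
next
  case (step2 i)
  have "even (- a + - b)" using assms(2) by simp
  with T_add[OF step2(2) T_neg[OF assms]] assms(3) show ?case by (simp add: algebra_simps)
qed

lemma T_gcd1: "\<lbrakk>T a 0; T b 0; even a; even b\<rbrakk> \<Longrightarrow> T (gcd a b) 0"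
proof -
  assume *: "T a 0" "T b 0" "even a" "even b"
  obtain u v where "u * a + v * b = gcd a b" using bezout_int by blast
  moreover have "T (u * a + v * b) (u * 0 + v * 0)"
    by (rule T_add) (use T_mult[of a 0 u] T_mult[of b 0 v] * in auto)
  ultimately show ?thesis by simp
qed

lemma T_gcd2: "\<lbrakk>T 0 a; T 0 b; even a; even b\<rbrakk> \<Longrightarrow> T 0 (gcd a b)"
proof -
  assume *: "T 0 a" "T 0 b" "even a" "even b"
  obtain u v where "u * a + v * b = gcd a b" using bezout_int by blast
  moreover have "T (u * 0 + v * 0) (u * a + v * b)"
    by (rule T_add) (use T_mult[of 0 a u] T_mult[of 0 b v] * in auto)
  ultimately show ?thesis by simp
qed

lemma orbN_T:
  assumes "T a b" "even (a + b)" "even (x + y)"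
  shows "orbN (\<pi> (x + a) (y + b)) = orbN (\<pi> x y)"
proof -
  obtain n where n: "n \<in> N" "acts \<pi> n 1 1 a b" using assms(1) unfolding NN_def by blast
  have "n (\<pi> x y) = \<pi> (x + a) (y + b)" using actsD[OF n(2) assms(3)] by simp
  moreover have "even ((x + a) + (y + b))" using assms(2,3) by simp
  ultimately show ?thesis
    using N.orb_eq_iff[OF mem_verts[OF assms(3)] mem_verts, of "x + a" "y + b"] n(1) by auto
qed

text \<open>The lattice map sending the origin to (1, 1) drives the walk; its inverse sends the
  origin to (-e1, -e2). It remains to see that the four neighbours of the origin fall into the
  orbits of these two points.\<close>

lemma cyclic_or_complete_step:
  assumes adm: "admissible B e1 e2 1 1"
    and nbrs: "\<And>v. (\<pi> 0 0, v) \<in> parcs \<Gamma> \<Longrightarrow> orbN v = orbN (\<pi> 1 1) \<or> orbN v = orbN (\<pi> (- e1) (- e2))"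
  shows "cyclic_or_complete Q"
proof -
  obtain k where k: "k \<in> G" "acts \<pi> k e1 e2 1 1" using ex_acts[OF adm] by blast
  obtain k' where k': "k' \<in> G" "\<forall>x\<in>V. k' (k x) = x" "\<forall>x\<in>V. k (k' x) = x"
    using ex_inv[OF k(1)] by blast
  have "acts \<pi> k' e1 e2 (- e1 * 1) (- e2 * 1)" using acts_inverse[OF k(2) adm] k'(2) by blast
  then have k'0: "k' (\<pi> 0 0) = \<pi> (- e1) (- e2)" using actsD[of k' _ _ _ _ 0 0] by fastforce
  have k0: "k (\<pi> 0 0) = \<pi> 1 1" using actsD[OF k(2), of 0 0] by simp
  show ?thesis
  proof (rule cyclic_or_complete_quotient[OF connected k(1) k'(1)])
    show "(\<pi> 0 0, k (\<pi> 0 0)) \<in> parcs \<Gamma>" using arcI[of 0 0 1 1] k0 by simp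
  qed (use k' nbrs k0 k'0 in simp_all)
qed

text \<open>The translation (2, 0) merges neighbours of the origin with equal second coordinate. The
  glide with signs (-1, 1) walks between the two resulting orbits and is admissible for either value
  of \<open>B\<close>.\<close>

lemma cyclic_of_T20:
  assumes "T 2 0"
  shows "cyclic_or_complete Q"
proof (rule cyclic_or_complete_step)
  show "admissible B (-1) 1 1 1" by (simp add: admissible_def)
  have "orbN (\<pi> (-1) 1) = orbN (\<pi> 1 1)" "orbN (\<pi> 1 (-1)) = orbN (\<pi> (-1) (-1))"
    using orbN_T[OF assms, of "-1" 1] orbN_T[OF assms, of "-1" "-1"] by simp_all
  then show "orbN v = orbN (\<pi> 1 1) \<or> orbN v = orbN (\<pi> (- (- 1)) (- 1))" if "(\<pi> 0 0, v) \<in> parcs \<Gamma>" for v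
    using nbr_of_origin[OF that] by auto
qed

lemma cyclic_of_T02:
  assumes "T 0 2"
  shows "cyclic_or_complete Q"
proof (rule cyclic_or_complete_step)
  \<comment> \<open>The translation part (1, 1) has odd entries: with \<open>B\<close> the signs
    must differ, without \<open>B\<close> the second must be 1.\<close>
  let ?e = "if B then -1 else 1 :: int"
  show "admissible B 1 ?e 1 1" by (simp add: admissible_def)
  have "orbN (\<pi> (-1) 1) = orbN (\<pi> (-1) (-1))" "orbN (\<pi> 1 (-1)) = orbN (\<pi> 1 1)"
    using orbN_T[OF assms, of "-1" "-1"] orbN_T[OF assms, of 1 "-1"] by simp_all
  then show "orbN v = orbN (\<pi> 1 1) \<or> orbN v = orbN (\<pi> (- 1) (- ?e))" if "(\<pi> 0 0, v) \<in> parcs \<Gamma>" for v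
    using nbr_of_origin[OF that] by auto
qed

text \<open>The translation (2, 2) merges (-1, -1) with (1, 1), and its difference with (4, 0),
  which is (-2, 2), merges (1, -1) with (-1, 1).\<close>

lemma cyclic_of_T22:
  assumes "T 2 2" "T 4 0"
  shows "cyclic_or_complete Q"
proof (rule cyclic_or_complete_step)
  show "admissible B (-1) 1 1 1" by (simp add: admissible_def)
  have "T (2 + - 4) (2 + - 0)" by (rule T_add[OF assms(1) T_neg[OF assms(2)]]) auto
  then have m: "T (-2) 2" by simp
  have "orbN (\<pi> (-1) (-1)) = orbN (\<pi> 1 1)" "orbN (\<pi> 1 (-1)) = orbN (\<pi> (-1) 1)"
    using orbN_T[OF assms(1), of "-1" "-1"] orbN_T[OF m, of 1 "-1"] by simp_all
  then show "orbN v = orbN (\<pi> 1 1) \<or> orbN v = orbN (\<pi> (- (- 1)) (- 1))" if "(\<pi> 0 0, v) \<in> parcs \<Gamma>" for v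
    using nbr_of_origin[OF that] by auto
qed

text \<open>A map with a sign -1 has commutators whose entries are short up to a correction lying in
  N itself: none is required for the reflection, a multiple of (4, 0) for the rotation, and the
  square of the map for a glide.\<close>

lemma cyclic_of_nonshift:
  assumes NN: "NN f1 f2 a b" and f: "admissible B f1 f2 a b" and ne: "\<not> (f1 = 1 \<and> f2 = 1)"
  shows "cyclic_or_complete Q"
proof -
  note comm = NN_commutator[OF NN f]
  have glide: "admissible B (-1) 1 1 1" by (simp add: admissible_def)
  from f show ?thesis
  proof (cases rule: admissible_cases)
    case shift
    with ne show ?thesis by simp
  next
    case reflect
    have "admissible B 1 1 1 1" using reflect(1) by (simp add: admissible_def)
    from comm[OF this] reflect have "T 2 0" by simp
    then show ?thesis by (rule cyclic_of_T20)
  next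
    case rotate
    obtain k where k: "a = 2 * k" using rotate(4) by (rule evenE)
    have "admissible B 1 1 2 0" by (simp add: admissible_def)
    from comm[OF this] rotate have T40: "T 4 0" by simp
    from comm[OF glide] rotate k have T: "T (2 - 4 * k) 2" by simp
    \<comment> \<open>The commutator with the glide is (2 - 2a, 2); as a is even, it differs from
      (2, 2) by a multiple of (4, 0).\<close>
    have "T (2 - 4 * k + k * 4) (2 + k * 0)"
      by (rule T_add[OF T T_mult[OF T40]]) auto
    then have "T 2 2" by simp
    then show ?thesis using T40 by (rule cyclic_of_T22)
  next
    case glide1
    have "admissible B 1 (-1) 1 1" using glide1(1) by (simp add: admissible_def)
    from comm[OF this] glide1 have T: "T 2 (- 2 * b)" by simp
    \<comment> \<open>Squaring the glide cancels the first entry and leaves (0, 2b), exactly the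
      correction needed for (2, -2b).\<close>
    from NN_comp[OF NN NN f] glide1 have T': "T 0 (2 * b)" by simp
    have "T (2 + 0) (- 2 * b + 2 * b)" by (rule T_add[OF T T']) auto
    then show ?thesis using cyclic_of_T20 by simp
  next
    case glide2
    from comm[OF glide] glide2 have T: "T (- 2 * a) 2" by simp
    from NN_comp[OF NN NN f] glide2 have T': "T (2 * a) 0" by simp
    have "T (- 2 * a + 2 * a) (2 + 0)" by (rule T_add[OF T T']) auto
    then show ?thesis using cyclic_of_T02 by simp
  qed
qed

text \<open>The commutator of the translation with the glide of signs (-1, 1) is (-2a, 0), because
  the glide reverses only the first entry; twice the translation then leaves (0, 2b).\<close>

lemma T_double:
  assumes "T a b" "even (a + b)" "B \<longrightarrow> even a"
  shows "T (2 * a) 0" "T 0 (2 * b)"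
proof -
  have adm: "admissible B 1 1 a b" using assms(2,3) by (simp add: admissible_shift)
  have r: "admissible B (-1) 1 1 1" by (simp add: admissible_def)
  have m: "T (- 2 * a) 0" using NN_commutator[OF assms(1) adm r] by simp
  from T_neg[OF this] show p: "T (2 * a) 0" by simp
  have "T (2 * a + - 2 * a) (2 * b + 0)"
    by (rule T_add[OF T_mult[OF assms, of 2] m]) auto
  then show "T 0 (2 * b)" by simp
qed

end

section \<open>Normal subgroups as kernels on invariants\<close>

context graph_grp
begin

text \<open>The hypothesis says that G permutes the fibres of F, and the set in question is the
  kernel of that action.\<close>

lemma normal_sub_invariants:
  assumes F: "\<And>g x y. \<lbrakk>g \<in> G; x \<in> V; y \<in> V; F x = F y\<rbrakk> \<Longrightarrow> F (g x) = F (g y)"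
  shows "normal_sub {g \<in> G. \<forall>x\<in>V. F (g x) = F x}" (is "normal_sub ?K")
proof (rule normal_subI)
  show "?K \<subseteq> G" by blast
  obtain e where e: "e \<in> G" "\<forall>x\<in>V. e x = x" using ex_id by blast
  then show "\<exists>e\<in>?K. \<forall>x\<in>V. e x = x" by (intro bexI[of _ e]) auto
  show "\<exists>k\<in>?K. \<forall>x\<in>V. k x = g (h x)" if gh: "g \<in> ?K" "h \<in> ?K" for g h
  proof -
    obtain k where k: "k \<in> G" "\<forall>x\<in>V. k x = g (h x)" using ex_comp gh by blast
    with gh show ?thesis by (intro bexI[of _ k]) simp_all
  qed
  show "\<exists>h\<in>?K. \<forall>x\<in>V. h (g x) = x" if g: "g \<in> ?K" for g
  proof -
    obtain h where h: "h \<in> G" "\<forall>x\<in>V. h (g x) = x" "\<forall>x\<in>V. g (h x) = x" using ex_inv g by blast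
    have "F (h y) = F y" if y: "y \<in> V" for y
    proof -
      have "F (g (h y)) = F (h y)" using g closed[OF h(1) y] by blast
      then show ?thesis using h(3) y by simp
    qed
    with h show ?thesis by (intro bexI[of _ h]) simp_all
  qed
  show "\<exists>n'\<in>?K. \<forall>x\<in>V. n' (g x) = g (n x)" if g: "g \<in> G" and n: "n \<in> ?K" for g n
  proof -
    obtain h where h: "h \<in> G" "\<forall>x\<in>V. h (g x) = x" "\<forall>x\<in>V. g (h x) = x" using ex_inv[OF g] by blast
    obtain l where l: "l \<in> G" "\<forall>x\<in>V. l x = n (h x)" using ex_comp[of n h] n h(1) by blast
    obtain k where k: "k \<in> G" "\<forall>x\<in>V. k x = g (l x)" using ex_comp[OF g l(1)] by blast
    have "F (k y) = F y" if y: "y \<in> V" for y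
    proof -
      have "F (g (n (h y))) = F (g (h y))" by (rule F[OF g]) (use n h(1) y in simp_all)
      then show ?thesis using k(2) l(2) h(3) y by simp
    qed
    with k l h g show ?thesis by (intro bexI[of _ k]) simp_all
  qed
qed

lemma normal_orbit_kernels:
  assumes M: "normal_sub M" and N: "normal_sub N"
  shows "normal_sub (orbit_kernel V G M \<inter> orbit_kernel V G N)"
proof -
  interpret M: normal_quotient \<Gamma> G M by unfold_locales (rule M)
  interpret N: normal_quotient \<Gamma> G N by unfold_locales (rule N)
  have "normal_sub {g \<in> G. \<forall>x\<in>V. (M.orbN (g x), N.orbN (g x)) = (M.orbN x, N.orbN x)}"
    by (rule normal_sub_invariants[of "\<lambda>x. (M.orbN x, N.orbN x)"]) (simp add: M.orbN_image N.orbN_image)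
  moreover have "orbit_kernel V G M \<inter> orbit_kernel V G N =
      {g \<in> G. \<forall>x\<in>V. (M.orbN (g x), N.orbN (g x)) = (M.orbN x, N.orbN x)}"
    using mem_orbit_kernel_iff[OF M] mem_orbit_kernel_iff[OF N] by auto
  ultimately show ?thesis by simp
qed

end

section \<open>The basic pairs among the lattice quotients\<close>

lemma gcd_double_prime:
  fixes a :: int
  assumes "prime p" "\<not> int p dvd a"
  shows "gcd (2 * a) (2 * int p) = 2"
proof -
  have "coprime (int p) a" using assms by (intro prime_imp_coprime) simp_all
  then have "gcd a (int p) = 1" by (simp add: coprime_commute coprime_iff_gcd_eq_1)
  then show ?thesis by (simp add: gcd_mult_distrib_int[symmetric])
qed

context lattice_normal
begin

text \<open>Any element of N with a sign -1 already forces a permitted quotient, so a counterexample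
  consists of translations, one of which lies outside the kernel.\<close>

lemma nontrivial_cases:
  assumes "\<exists>n\<in>N. \<exists>x\<in>V. n x \<noteq> x" and "\<not> cyclic_or_complete Q"
  shows "\<exists>a b. T a b \<and> even (a + b) \<and> (B \<longrightarrow> even a) \<and> \<not> (int r dvd a \<and> int s dvd b)"
proof -
  obtain n v where n: "n \<in> N" "v \<in> V" "n v \<noteq> v" using assms(1) by blast
  then obtain e1 e2 a b where n': "admissible B e1 e2 a b" "acts \<pi> n e1 e2 a b"
    using N_subset acts_ex by blast
  have NN: "NN e1 e2 a b" using n(1) n'(2) unfolding NN_def by blast
  have e: "e1 = 1" "e2 = 1" using cyclic_of_nonshift[OF NN n'(1)] assms(2) by auto
  obtain x y where xy: "even (x + y)" "v = \<pi> x y" using n(2) by (rule vertsE)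
  have ev: "even (a + b)" "B \<longrightarrow> even a" using n'(1) unfolding e admissible_shift by auto
  have "n v = \<pi> (x + a) (y + b)" using actsD[OF n'(2) xy(1)] xy(2) e by simp
  then have "\<not> (int r dvd a \<and> int s dvd b)"
    using n(3) xy ev eq_iff[of "x + a" "y + b" x y] by auto
  with NN ev show ?thesis unfolding e by blast
qed

text \<open>Combining (2a, 0) with the kernel translation (2p, 0) by Bezout gives (2, 0) unless p
  divides a, and likewise for q and b. Then a is divisible by 2p, or p = 2 and a is 2 modulo 4.
  Reducing by the kernel leaves (2, 0), (0, 2), or (2, 2) together with (4, 0).\<close>

lemma cyclic_or_complete_even:
  assumes nt: "\<exists>n\<in>N. \<exists>x\<in>V. n x \<noteq> x"
    and r: "r = 2 * p" "prime p" and s: "s = 2 * q" "prime q" and pq: "B \<or> p = 2 \<or> q = 2"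
  shows "cyclic_or_complete Q"
proof (rule ccontr)
  assume nc: "\<not> cyclic_or_complete Q"
  have "\<not> T 2 0" "\<not> T 0 2" "\<not> (T 2 2 \<and> T 4 0)"
    using nc cyclic_of_T20 cyclic_of_T02 cyclic_of_T22 by blast+
  note noT = this
  obtain a b where T: "T a b" and ev: "even (a + b)" "B \<longrightarrow> even a" and ne: "\<not> (int r dvd a \<and> int s dvd b)"
    using nontrivial_cases[OF nt nc] by blast
  have K: "T (2 * int p) 0" "T 0 (2 * int q)"
    using T_kernel[of "int r" 0] T_kernel[of 0 "int s"] r(1) s(1) by simp_all
  have pa: "int p dvd a"
  proof (rule ccontr)
    assume "\<not> int p dvd a"
    with T_gcd1[OF T_double(1)[OF T ev] K(1)] gcd_double_prime[OF r(2)] noT(1) show False by simp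
  qed
  have qb: "int q dvd b"
  proof (rule ccontr)
    assume "\<not> int q dvd b"
    with T_gcd2[OF T_double(2)[OF T ev] K(2)] gcd_double_prime[OF s(2)] noT(2) show False by simp
  qed
  have even: "even a" "even b"
  proof -
    \<comment> \<open>If p = 2 or q = 2, the divisibility just obtained makes one entry even;
      otherwise \<open>B\<close> does. The even sum gives the other entry.\<close>
    have "B \<or> even a \<or> even b" using pq pa qb by auto
    then show "even a" "even b" using ev by auto
  qed
  have dvd2: "int (2 * m) dvd c \<or> (m = 2 \<and> (\<exists>k. c = 4 * k + 2))" if m: "prime m" "int m dvd c" "even c" for m c
  proof (cases "m = 2")
    case True
    with m(3) show ?thesis by presburger
  next
    case False
    then have "odd m" using m(1) prime_odd_nat[of m] prime_ge_2_nat[of m] by force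
    then have "coprime 2 (int m)" by simp
    then have "2 * int m dvd c" using m(2,3) by (intro divides_mult) auto
    then show ?thesis by simp
  qed
  have A: "int r dvd a \<or> (p = 2 \<and> (\<exists>k. a = 4 * k + 2))" using dvd2[OF r(2) pa even(1)] r(1) by simp
  have B: "int s dvd b \<or> (q = 2 \<and> (\<exists>k. b = 4 * k + 2))" using dvd2[OF s(2) qb even(2)] s(1) by simp
  have redb: "T a 0" if "int s dvd b"
  proof -
    have "T 0 (- b)" by (rule T_kernel) (use that even in auto)
    then have "T (a + 0) (b + - b)" by (rule T_add[OF T]) (use even in auto)
    then show ?thesis by simp
  qed
  have reda: "T 0 b" if "int r dvd a"
  proof -
    have "T (- a) 0" by (rule T_kernel) (use that even in auto)
    then have "T (a + - a) (b + 0)" by (rule T_add[OF T]) (use even in auto)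
    then show ?thesis by simp
  qed
  have p4: "T (4 * k) 0" if "p = 2" for k using T_mult[OF K(1), of k] that by (simp add: mult.commute)
  have q4: "T 0 (4 * k)" if "q = 2" for k using T_mult[OF K(2), of k] that by (simp add: mult.commute)
  consider "\<not> int r dvd a" "int s dvd b" | "int r dvd a" "\<not> int s dvd b" | "\<not> int r dvd a" "\<not> int s dvd b"
    using ne by blast
  then show False
  proof cases
    case 1
    then obtain k where k: "p = 2" "a = 4 * k + 2" using A by blast
    have "T (a + 4 * (- k)) (0 + 0)" by (rule T_add[OF redb[OF 1(2)] p4[OF k(1)]]) auto
    then show False using k(2) noT(1) by simp
  next
    case 2
    then obtain k where k: "q = 2" "b = 4 * k + 2" using B by blast
    have "T (0 + 0) (b + 4 * (- k))" by (rule T_add[OF reda[OF 2(1)] q4[OF k(1)]]) auto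
    then show False using k(2) noT(2) by simp
  next
    case 3
    then obtain k l where k: "p = 2" "a = 4 * k + 2" "q = 2" "b = 4 * l + 2" using A B by blast
    have "T (a + 4 * (- k)) (b + 0)" by (rule T_add[OF T p4[OF k(1)]]) auto
    then have "T (a + 4 * (- k) + 0) (b + 0 + 4 * (- l))" by (rule T_add[OF _ q4[OF k(3)]]) auto
    then have "T 2 2" using k by simp
    moreover have "T 4 0" using p4[OF k(1), of 1] by simp
    ultimately show False using noT(3) by blast
  qed
qed

lemma cyclic_or_complete_odd:
  assumes nt: "\<exists>n\<in>N. \<exists>x\<in>V. n x \<noteq> x"
    and "\<not> B" "prime r" "odd r" "prime s" "odd s"
  shows "cyclic_or_complete Q"
proof (rule ccontr)
  assume nc: "\<not> cyclic_or_complete Q"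
  then have noT: "\<not> T 2 0" "\<not> T 0 2" using cyclic_of_T20 cyclic_of_T02 by blast+
  obtain a b where T: "T a b" and ev: "even (a + b)" "B \<longrightarrow> even a" and ne: "\<not> (int r dvd a \<and> int s dvd b)"
    using nontrivial_cases[OF nt nc] by blast
  \<comment> \<open>The moduli are doubled because (r, 0) and (0, s) have odd sums and are not
    lattice translations.\<close>
  have K: "T (2 * int r) 0" "T 0 (2 * int s)"
    using T_kernel[of "2 * int r" 0] T_kernel[of 0 "2 * int s"] by simp_all
  show False
  proof (cases "int r dvd a")
    case False
    with T_gcd1[OF T_double(1)[OF T ev] K(1)] gcd_double_prime[OF assms(3)] noT(1) show False by simp
  next
    case True
    with ne have "\<not> int s dvd b" by blast
    with T_gcd2[OF T_double(2)[OF T ev] K(2)] gcd_double_prime[OF assms(5)] noT(2) show False by simp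
  qed
qed

end

context lattice_pair
begin

lemma basicI:
  assumes "(\<not> B \<and> prime r \<and> odd r \<and> prime s \<and> odd s) \<or>
    (\<exists>p q. r = 2 * p \<and> prime p \<and> s = 2 * q \<and> prime q \<and> (B \<or> p = 2 \<or> q = 2))"
  shows "OG4_basic \<Gamma> G"
proof -
  have "cyclic_or_complete (quotient_graph \<Gamma> N)" if N: "nontrivial_normal (V) G N" for N
  proof -
    have n: "normal_sub N" and nt: "\<exists>n\<in>N. \<exists>x\<in>V. n x \<noteq> x"
      using N unfolding nontrivial_normal_iff' by blast+
    interpret lattice_normal B r s \<Gamma> G \<pi> N by unfold_locales (rule n)
    from assms show ?thesis
      using cyclic_or_complete_odd[OF nt] cyclic_or_complete_even[OF nt] by blast
  qed
  with OG4 show ?thesis unfolding OG4_basic_def cyclic_or_complete_def by blast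
qed

text \<open>Vertical translations preserve x, so their quotient is the cycle described by the first
  coordinate; horizontal ones give the second. These two quotients are the independent ones.\<close>

definition vertical :: "int \<Rightarrow> int \<Rightarrow> bool" where "vertical a b \<longleftrightarrow> a = 0 \<and> even b"
definition horizontal :: "int \<Rightarrow> int \<Rightarrow> bool" where "horizontal a b \<longleftrightarrow> even a \<and> b = 0"

lemma sign_lattice_axes: "sign_lattice vertical" "sign_lattice horizontal"
  by (auto simp: sign_lattice_def vertical_def horizontal_def)

lemma orb_vertical:
  assumes "even (x + y)" "even (x' + y')"
    "perm_grp.orb (shift_group vertical) (\<pi> x y) = perm_grp.orb (shift_group vertical) (\<pi> x' y')"
  shows "int r dvd x' - x"
proof -
  obtain a b where ab: "vertical a b" "\<pi> x' y' = \<pi> (x + a) (y + b)"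
    using orb_shift_group[OF sign_lattice_axes(1) assms] by blast
  then have "even ((x + a) + (y + b))" using assms(1) by (auto simp: vertical_def)
  with ab assms(2) eq_iff[of x' y' "x + a" "y + b"] show ?thesis by (simp add: vertical_def)
qed

lemma orb_horizontal:
  assumes "even (x + y)" "even (x' + y')"
    "perm_grp.orb (shift_group horizontal) (\<pi> x y) = perm_grp.orb (shift_group horizontal) (\<pi> x' y')"
  shows "int s dvd y' - y"
proof -
  obtain a b where ab: "horizontal a b" "\<pi> x' y' = \<pi> (x + a) (y + b)"
    using orb_shift_group[OF sign_lattice_axes(2) assms] by blast
  then have "even ((x + a) + (y + b))" using assms(1) by (auto simp: horizontal_def)
  with ab assms(2) eq_iff[of x' y' "x + a" "y + b"] show ?thesis by (simp add: horizontal_def)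
qed

lemma cyclic_vertical: "cyclic_normal_quotient \<Gamma> G (shift_group vertical)"
proof -
  let ?N = "shift_group vertical"
  have v: "vertical 0 2" by (simp add: vertical_def)
  interpret lattice_normal B r s \<Gamma> G \<pi> ?N
    by unfold_locales (rule normal_shift_group[OF sign_lattice_axes(1)])
  have "T 0 2" using ex_translation[OF sign_lattice_axes(1) v] unfolding NN_def .
  then have cc: "cyclic_or_complete Q" by (rule cyclic_of_T02)
  have V: "\<pi> 0 0 \<in> V" "\<pi> 1 1 \<in> V" "\<pi> 2 0 \<in> V" by (auto intro!: mem_verts)
  have "is_cycle_graph Q"
  proof (rule cyclic_or_complete_card[OF cc])
    show "orbN (\<pi> 0 0) \<in> pverts Q" "orbN (\<pi> 1 1) \<in> pverts Q" "orbN (\<pi> 2 0) \<in> pverts Q"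
      unfolding Q_verts using V by blast+
    show "orbN (\<pi> 0 0) \<noteq> orbN (\<pi> 1 1)" using orb_vertical[of 0 0 1 1] not_dvd_small(1)[of 1] by auto
    show "orbN (\<pi> 0 0) \<noteq> orbN (\<pi> 2 0)" using orb_vertical[of 0 0 2 0] not_dvd_small(1)[of 2] by auto
    show "orbN (\<pi> 1 1) \<noteq> orbN (\<pi> 2 0)" using orb_vertical[of 1 1 2 0] not_dvd_small(1)[of 1] by auto
  qed
  moreover have "nontrivial_normal (V) G ?N"
    by (rule nontrivial_shift_group[OF sign_lattice_axes(1) v]) (use not_dvd_small(2)[of 2] in simp)
  ultimately show ?thesis unfolding cyclic_normal_quotient_def by blast
qed

lemma cyclic_horizontal: "cyclic_normal_quotient \<Gamma> G (shift_group horizontal)"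
proof -
  let ?N = "shift_group horizontal"
  have v: "horizontal 2 0" by (simp add: horizontal_def)
  interpret lattice_normal B r s \<Gamma> G \<pi> ?N
    by unfold_locales (rule normal_shift_group[OF sign_lattice_axes(2)])
  have "T 2 0" using ex_translation[OF sign_lattice_axes(2) v] unfolding NN_def .
  then have cc: "cyclic_or_complete Q" by (rule cyclic_of_T20)
  have V: "\<pi> 0 0 \<in> V" "\<pi> 1 1 \<in> V" "\<pi> 0 2 \<in> V" by (auto intro!: mem_verts)
  have "is_cycle_graph Q"
  proof (rule cyclic_or_complete_card[OF cc])
    show "orbN (\<pi> 0 0) \<in> pverts Q" "orbN (\<pi> 1 1) \<in> pverts Q" "orbN (\<pi> 0 2) \<in> pverts Q"
      unfolding Q_verts using V by blast+
    show "orbN (\<pi> 0 0) \<noteq> orbN (\<pi> 1 1)" using orb_horizontal[of 0 0 1 1] not_dvd_small(2)[of 1] by auto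
    show "orbN (\<pi> 0 0) \<noteq> orbN (\<pi> 0 2)" using orb_horizontal[of 0 0 0 2] not_dvd_small(2)[of 2] by auto
    show "orbN (\<pi> 1 1) \<noteq> orbN (\<pi> 0 2)" using orb_horizontal[of 1 1 0 2] not_dvd_small(2)[of 1] by auto
  qed
  moreover have "nontrivial_normal (V) G ?N"
    by (rule nontrivial_shift_group[OF sign_lattice_axes(2) v]) (use not_dvd_small(1)[of 2] in simp)
  ultimately show ?thesis unfolding cyclic_normal_quotient_def by blast
qed

text \<open>The bound 2 covers the origin and all its neighbours, so N keeps these apart; three of
  the four neighbours already exceed valency 2.\<close>

lemma not_cyclic_valency4:
  assumes N: "normal_sub N"
    and ne: "\<And>x y x' y'. \<lbrakk>even (x + y); even (x' + y'); \<bar>x' - x\<bar> \<le> 2; \<bar>y' - y\<bar> \<le> 2;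
      perm_grp.orb N (\<pi> x y) = perm_grp.orb N (\<pi> x' y')\<rbrakk> \<Longrightarrow> x = x' \<and> y = y'"
  shows "\<not> cyclic_or_complete (quotient_graph \<Gamma> N)"
proof
  interpret normal_quotient \<Gamma> G N by unfold_locales (rule N)
  assume cc: "cyclic_or_complete Q"
  have V: "\<pi> 0 0 \<in> V" "\<pi> 1 1 \<in> V" "\<pi> 1 (-1) \<in> V" "\<pi> (-1) 1 \<in> V"
    by (auto intro!: mem_verts)
  have n: "orbN (\<pi> 0 0) \<noteq> orbN (\<pi> 1 1)" "orbN (\<pi> 0 0) \<noteq> orbN (\<pi> 1 (-1))" "orbN (\<pi> 0 0) \<noteq> orbN (\<pi> (-1) 1)"
    "orbN (\<pi> 1 1) \<noteq> orbN (\<pi> 1 (-1))" "orbN (\<pi> 1 1) \<noteq> orbN (\<pi> (-1) 1)" "orbN (\<pi> 1 (-1)) \<noteq> orbN (\<pi> (-1) 1)"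
    using ne[of 0 0 1 1] ne[of 0 0 1 "-1"] ne[of 0 0 "-1" 1] ne[of 1 1 1 "-1"] ne[of 1 1 "-1" 1]
      ne[of 1 "-1" "-1" 1] by auto
  have a: "(\<pi> 0 0, \<pi> 1 1) \<in> parcs \<Gamma>" "(\<pi> 0 0, \<pi> 1 (-1)) \<in> parcs \<Gamma>" "(\<pi> 0 0, \<pi> (-1) 1) \<in> parcs \<Gamma>"
    using arcI[of 0 0 1 1] arcI[of 0 0 1 "-1"] arcI[of 0 0 "-1" 1] by simp_all
  have arcs: "(orbN (\<pi> 0 0), orbN v) \<in> parcs Q" if "(\<pi> 0 0, v) \<in> parcs \<Gamma>" "orbN (\<pi> 0 0) \<noteq> orbN v" for v
    using that Q_arc_iff[OF V(1)] by blast
  have QV: "orbN v \<in> pverts Q" if "v \<in> V" for v using that unfolding Q_verts by blast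
  from cyclic_or_complete_valency[OF cc QV[OF V(1)] arcs[OF a(1) n(1)] arcs[OF a(2) n(2)] arcs[OF a(3) n(3)]
      QV[OF V(2)] QV[OF V(3)] QV[OF V(4)]] n(4-6)
  show False by blast
qed

text \<open>An element of both orbit kernels preserves both coordinates. At (0, 0) this kills its
  translation part and at (1, 1) its signs, as neither modulus divides 2. So the intersection is
  trivial and its quotient keeps valency 4.\<close>

lemma independent: "independent_quotients \<Gamma> G (shift_group vertical) (shift_group horizontal)"
proof -
  let ?K = "orbit_kernel (V) G (shift_group vertical) \<inter>
    orbit_kernel (V) G (shift_group horizontal)"
  note mem = mem_orbit_kernel_iff[OF normal_shift_group[OF sign_lattice_axes(1)]]
    mem_orbit_kernel_iff[OF normal_shift_group[OF sign_lattice_axes(2)]]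
  have KG: "?K \<subseteq> G" using mem by blast
  have triv: "g v = v" if g: "g \<in> ?K" and v: "v \<in> V" for g v
  proof -
    have gG: "g \<in> G" using g KG by blast
    then obtain e1 e2 a b where ga: "admissible B e1 e2 a b" "acts \<pi> g e1 e2 a b" using acts_ex by blast
    have gp: "g (\<pi> 0 0) = \<pi> a b" "g (\<pi> 1 1) = \<pi> (e1 + a) (e2 + b)"
      using actsD[OF ga(2), of 0 0] actsD[OF ga(2), of 1 1] by simp_all
    have V: "\<pi> 0 0 \<in> V" "\<pi> 1 1 \<in> V" by (auto intro!: mem_verts)
    have ev: "even (a + b)" "even ((e1 + a) + (e2 + b))"
      using admissible_parity[OF ga(1), of 0 0] admissible_parity[OF ga(1), of 1 1] by simp_all
    have ov: "perm_grp.orb (shift_group vertical) (g u) = perm_grp.orb (shift_group vertical) u"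
      and oh: "perm_grp.orb (shift_group horizontal) (g u) = perm_grp.orb (shift_group horizontal) u"
      if "u \<in> V" for u
      using g mem that by blast+
    have d: "int r dvd a" "int s dvd b"
      using orb_vertical[of a b 0 0] orb_horizontal[of a b 0 0] ov[OF V(1)] oh[OF V(1)] gp(1) ev(1)
      by simp_all
    have "int r dvd 1 - (e1 + a)" "int s dvd 1 - (e2 + b)"
      using orb_vertical[of "e1 + a" "e2 + b" 1 1] orb_horizontal[of "e1 + a" "e2 + b" 1 1]
        ov[OF V(2)] oh[OF V(2)] gp(2) ev(2) by simp_all
    then have "int r dvd 1 - (e1 + a) + a" "int s dvd 1 - (e2 + b) + b" using d by (simp_all only: dvd_add)
    then have "int r dvd 1 - e1" "int s dvd 1 - e2" by simp_all
    then have e: "e1 = 1" "e2 = 1"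
      using ga(1) not_dvd_small[of 2] by (auto elim!: admissible_cases)
    obtain x y where xy: "even (x + y)" "v = \<pi> x y" using v by (rule vertsE)
    have "g v = \<pi> (x + a) (y + b)" using actsD[OF ga(2) xy(1)] xy(2) e by simp
    also have "\<dots> = \<pi> x y"
      using eq_iff[of "x + a" "y + b" x y] xy(1) ev(1) d ga(1) e by (auto simp: admissible_shift)
    finally show ?thesis using xy(2) by simp
  qed
  have "normal_sub ?K"
    by (intro normal_orbit_kernels normal_shift_group sign_lattice_axes)
  then interpret K: normal_quotient \<Gamma> G ?K by unfold_locales
  have "\<not> cyclic_or_complete (quotient_graph \<Gamma> ?K)"
  proof (rule not_cyclic_valency4[OF \<open>normal_sub ?K\<close>])
    fix x y x' y' :: int
    assume *: "even (x + y)" "even (x' + y')" "\<bar>x' - x\<bar> \<le> 2" "\<bar>y' - y\<bar> \<le> 2"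
      "K.orbN (\<pi> x y) = K.orbN (\<pi> x' y')"
    then obtain k where k: "k \<in> ?K" "k (\<pi> x y) = \<pi> x' y'"
      using K.N.orb_eq_iff[OF mem_verts mem_verts] by blast
    then have "\<pi> x y = \<pi> x' y'" using triv[OF k(1) mem_verts[OF *(1)]] by simp
    then have "int r dvd x - x'" "int s dvd y - y'" using eq_iff *(1,2) by auto
    moreover have "x - x' = 0 \<or> \<bar>x - x'\<bar> = 1 \<or> \<bar>x - x'\<bar> = 2" "y - y' = 0 \<or> \<bar>y - y'\<bar> = 1 \<or> \<bar>y - y'\<bar> = 2"
      using *(3,4) by auto
    ultimately show "x = x' \<and> y = y'" using not_dvd_small by auto
  qed
  then show ?thesis unfolding independent_quotients_def cyclic_or_complete_def by blast
qed

lemma basic_independent_cycle_type: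
  assumes "(\<not> B \<and> prime r \<and> odd r \<and> prime s \<and> odd s) \<or>
    (\<exists>p q. r = 2 * p \<and> prime p \<and> s = 2 * q \<and> prime q \<and> (B \<or> p = 2 \<or> q = 2))"
  shows "basic_independent_cycle_type \<Gamma> G"
  unfolding basic_independent_cycle_type_def
  using basicI[OF assms] cyclic_vertical cyclic_horizontal independent by blast

text \<open>Otherwise the translations by the larger lattice have a quotient of valency 4.\<close>

lemma basic_kernel_maximal:
  assumes basic: "OG4_basic \<Gamma> G" and r': "r' dvd r" "3 \<le> r'" and s': "s' dvd s" "3 \<le> s'"
    and ab: "int r' dvd a" "int s' dvd b" "even (a + b)" "B \<longrightarrow> even a"
  shows "int r dvd a \<and> int s dvd b"
proof (rule ccontr)
  assume ne: "\<not> ?thesis"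
  \<comment> \<open>All translations of the lattice modulo the smaller moduli; (a, b) is one of them
    outside the kernel, while moduli at least 3 still separate the neighbours of a vertex.\<close>
  define L where "L x y \<longleftrightarrow> int r' dvd x \<and> int s' dvd y \<and> even (x + y) \<and> (B \<longrightarrow> even x)" for x y
  have L: "sign_lattice L" unfolding sign_lattice_def L_def by auto
  have "L a b" using ab by (simp add: L_def)
  have nt: "nontrivial_normal (V) G (shift_group L)"
    by (rule nontrivial_shift_group[OF L \<open>L a b\<close> ne])
  have "\<not> cyclic_or_complete (quotient_graph \<Gamma> (shift_group L))"
  proof (rule not_cyclic_valency4[OF normal_shift_group[OF L]])
    fix x y x' y' :: int
    assume *: "even (x + y)" "even (x' + y')" "\<bar>x' - x\<bar> \<le> 2" "\<bar>y' - y\<bar> \<le> 2"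
      "perm_grp.orb (shift_group L) (\<pi> x y) = perm_grp.orb (shift_group L) (\<pi> x' y')"
    obtain c d where cd: "L c d" "\<pi> x' y' = \<pi> (x + c) (y + d)"
      using orb_shift_group[OF L *(1,2,5)] by blast
    then have "even ((x + c) + (y + d))" using *(1) by (auto simp: L_def)
    then have "int r dvd x' - (x + c)" "int s dvd y' - (y + d)" using eq_iff cd(2) *(2) by auto
    then have "int r' dvd x' - (x + c)" "int s' dvd y' - (y + d)"
      using r'(1) s'(1) by (meson dvd_trans int_dvd_int_iff)+
    then have "int r' dvd (x' - (x + c)) + c" "int s' dvd (y' - (y + d)) + d"
      using cd(1) unfolding L_def by (simp_all only: dvd_add)
    then have "int r' dvd x' - x" "int s' dvd y' - y" by simp_all
    then show "x = x' \<and> y = y'"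
      using dvd_imp_le_int[of "x' - x" "int r'"] dvd_imp_le_int[of "y' - y" "int s'"] r'(2) s'(2) *(3,4)
      by fastforce
  qed
  with basic nt show False unfolding OG4_basic_def cyclic_or_complete_def by blast
qed

end

section \<open>Coordinates from a cyclic normal quotient\<close>

context graph_grp
begin

lemma OG4_edge:
  assumes "OG4 \<Gamma> G" "(x, w) \<in> parcs \<Gamma>" "(u, v) \<in> parcs \<Gamma>"
  shows "\<exists>g\<in>G. (g x = u \<and> g w = v) \<or> (g x = v \<and> g w = u)"
proof -
  have tr: "\<forall>e\<in>graph_edges \<Gamma>. \<forall>f\<in>graph_edges \<Gamma>. \<exists>g\<in>G. g ` e = f"
    using assms(1) by (simp add: OG4_def transitive_on_def)
  have "{x, w} \<in> graph_edges \<Gamma>" "{u, v} \<in> graph_edges \<Gamma>"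
    using assms(2,3) unfolding graph_edges_def by blast+
  from bspec[OF bspec[OF tr this(1)] this(2)] show ?thesis by (auto simp: doubleton_eq_iff)
qed

lemma OG4_vertex:
  assumes "OG4 \<Gamma> G" "x \<in> V" "y \<in> V"
  shows "\<exists>g\<in>G. g x = y"
proof -
  have "transitive_on G (\<lambda>g. g) (V)" using assms(1) by (simp add: OG4_def)
  with assms(2,3) show ?thesis by (simp add: transitive_on_def)
qed

text \<open>Labels of a cycle, meaningful only modulo r and kept as integers so that they can be
  shifted and negated. Group elements act on them as dihedral maps n -> e n + c.\<close>

definition cyclic_coordinate :: "nat \<Rightarrow> ('a \<Rightarrow> int) \<Rightarrow> bool" where
  "cyclic_coordinate r \<alpha> \<longleftrightarrow> 3 \<le> r \<and>
     (\<forall>g\<in>G. \<exists>e c. \<bar>e\<bar> = 1 \<and> (\<forall>x\<in>V. int r dvd \<alpha> (g x) - (e * \<alpha> x + c))) \<and>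
     (\<forall>u v. (u, v) \<in> parcs \<Gamma> \<longrightarrow> (\<exists>e. \<bar>e\<bar> = 1 \<and> int r dvd \<alpha> v - (\<alpha> u + e))) \<and>
     (\<forall>n. \<exists>x\<in>V. int r dvd \<alpha> x - n)"

text \<open>Automorphisms of a cycle are rotations and reflections: consecutive steps of opposite
  sign would return to the value two places before, which the second hypothesis forbids, so the
  first sign persists in both directions.\<close>

lemma affine_of_steps:
  fixes \<phi> :: "int \<Rightarrow> int"
  assumes step: "\<And>n. \<exists>e. \<bar>e\<bar> = 1 \<and> m dvd \<phi> (n + 1) - (\<phi> n + e)"
    and inj: "\<And>n. \<not> m dvd \<phi> (n + 2) - \<phi> n"
  shows "\<exists>e. \<bar>e\<bar> = 1 \<and> (\<forall>n. m dvd \<phi> n - (e * n + \<phi> 0))"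
proof -
  obtain e where e: "\<bar>e\<bar> = 1" "m dvd \<phi> (0 + 1) - (\<phi> 0 + e)" using step by blast
  have "m dvd \<phi> (n + 1) - (\<phi> n + e)" for n
  proof (induction n rule: int_induct[where k = 0])
    case base
    show ?case by (rule e(2))
  next
    case (step1 i)
    obtain d where d: "\<bar>d\<bar> = 1" "m dvd \<phi> (i + 1 + 1) - (\<phi> (i + 1) + d)" using step by blast
    have "d = e"
    proof (rule ccontr)
      assume "d \<noteq> e"
      then have "d = - e" using d(1) e(1) by auto
      moreover have "m dvd (\<phi> (i + 1 + 1) - (\<phi> (i + 1) + d)) + (\<phi> (i + 1) - (\<phi> i + e))"
        using d(2) step1(2) by (rule dvd_add)
      ultimately have "m dvd \<phi> (i + 1 + 1) - \<phi> i" by simp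
      then show False using inj[of i] by (simp add: add.assoc)
    qed
    with d(2) show ?case by simp
  next
    case (step2 i)
    obtain d where d: "\<bar>d\<bar> = 1" "m dvd \<phi> (i - 1 + 1) - (\<phi> (i - 1) + d)" using step by blast
    have "d = e"
    proof (rule ccontr)
      assume "d \<noteq> e"
      then have "d = - e" using d(1) e(1) by auto
      moreover have "m dvd (\<phi> (i + 1) - (\<phi> i + e)) + (\<phi> (i - 1 + 1) - (\<phi> (i - 1) + d))"
        using step2(2) d(2) by (rule dvd_add)
      ultimately have "m dvd \<phi> (i + 1) - \<phi> (i - 1)" by simp
      then show False using inj[of "i - 1"] by (simp add: add.commute)
    qed
    with d(2) show ?case by simp
  qed
  note st = this
  have "m dvd \<phi> n - (e * n + \<phi> 0)" for n
  proof (induction n rule: int_induct[where k = 0])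
    case base
    show ?case by simp
  next
    case (step1 i)
    have "m dvd (\<phi> (i + 1) - (\<phi> i + e)) + (\<phi> i - (e * i + \<phi> 0))"
      using st[of i] step1(2) by (rule dvd_add)
    then show ?case by (simp add: algebra_simps)
  next
    case (step2 i)
    have "m dvd (\<phi> i - (e * i + \<phi> 0)) - (\<phi> (i - 1 + 1) - (\<phi> (i - 1) + e))"
      using step2(2) st[of "i - 1"] by (rule dvd_diff)
    then show ?case by (simp add: algebra_simps)
  qed
  with e(1) show ?thesis by blast
qed

lemma ex_cyclic_coordinate:
  assumes OG4: "OG4 \<Gamma> G" and cyc: "cyclic_normal_quotient \<Gamma> G N"
  shows "\<exists>r \<alpha>. cyclic_coordinate r \<alpha> \<and>
    (\<forall>x\<in>V. \<forall>y\<in>V. perm_grp.orb N x = perm_grp.orb N y \<longleftrightarrow> int r dvd \<alpha> x - \<alpha> y)"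
proof -
  have "normal_sub N" using cyc nontrivial_normal_iff' by (simp add: cyclic_normal_quotient_def)
  then interpret normal_quotient \<Gamma> G N by unfold_locales
  obtain r f where r: "3 \<le> r" and f: "graph_iso f Q (cycle_graph r)"
    using cyc unfolding cyclic_normal_quotient_def is_cycle_graph_def by blast
  have bij: "bij_betw f (pverts Q) {0..<int r}"
    using f by (simp add: graph_iso_def cycle_graph_def)
  define \<alpha> where "\<alpha> x = f (orbN x)" for x
  have QV: "orbN x \<in> pverts Q" if "x \<in> V" for x using that by (simp add: Q_verts)
  have range: "\<alpha> x \<in> {0..<int r}" if "x \<in> V" for x
    using bij QV[OF that] unfolding \<alpha>_def bij_betw_def by blast
  have \<alpha>_eq: "orbN x = orbN y \<longleftrightarrow> \<alpha> x = \<alpha> y" if "x \<in> V" "y \<in> V" for x y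
    using bij QV that by (auto simp: \<alpha>_def bij_betw_def inj_on_def)
  have orb_dvd: "orbN x = orbN y \<longleftrightarrow> int r dvd \<alpha> x - \<alpha> y" if "x \<in> V" "y \<in> V" for x y
  proof -
    have "int r dvd \<alpha> x - \<alpha> y \<longleftrightarrow> \<alpha> x mod int r = \<alpha> y mod int r" by (simp add: mod_eq_dvd_iff)
    also have "\<dots> \<longleftrightarrow> \<alpha> x = \<alpha> y" using range[OF that(1)] range[OF that(2)] by simp
    finally show ?thesis using \<alpha>_eq[OF that] by simp
  qed
  have surj: "\<exists>x\<in>V. int r dvd \<alpha> x - n" for n
  proof -
    have "n mod int r \<in> {0..<int r}" using r by simp
    moreover have "f ` orbN ` V = {0..<int r}" using bij unfolding bij_betw_def Q_verts by simp
    ultimately have "n mod int r \<in> \<alpha> ` V" unfolding \<alpha>_def image_image by simp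
    then obtain x where "x \<in> V" "\<alpha> x = n mod int r" by auto
    moreover have "int r dvd n mod int r - n" by (simp add: mod_eq_dvd_iff[symmetric])
    ultimately show ?thesis by (intro bexI[of _ x]) simp_all
  qed
  have Qarc: "(orbN u, orbN v) \<in> parcs Q \<longleftrightarrow> \<alpha> v = (\<alpha> u + 1) mod int r \<or> \<alpha> v = (\<alpha> u - 1) mod int r"
    if "u \<in> V" "v \<in> V" for u v
  proof -
    have "(orbN u, orbN v) \<in> parcs Q \<longleftrightarrow> (\<alpha> u, \<alpha> v) \<in> parcs (cycle_graph r)"
      using f QV that unfolding graph_iso_def \<alpha>_def by blast
    then show ?thesis using range[OF that(1)] by (simp add: cycle_graph_def)
  qed
  \<comment> \<open>The cycle has an arc, so some arc of \<Gamma> joins different orbits; by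
    edge-transitivity every arc does.\<close>
  have ne_arc: "orbN u \<noteq> orbN v" if uv: "(u, v) \<in> parcs \<Gamma>" for u v
  proof -
    obtain x where x: "x \<in> V" "int r dvd \<alpha> x - 0" using surj by blast
    obtain y where y: "y \<in> V" "int r dvd \<alpha> y - (\<alpha> x + 1)" using surj by blast
    have "\<alpha> y mod int r = (\<alpha> x + 1) mod int r" using y(2) by (simp add: mod_eq_dvd_iff)
    then have "(orbN x, orbN y) \<in> parcs Q" using Qarc[OF x(1) y(1)] range[OF y(1)] by simp
    then have "orbN x \<noteq> orbN y \<and> (\<exists>w. (x, w) \<in> parcs \<Gamma> \<and> orbN y = orbN w)"
      using Q_arc_iff[OF x(1), of "orbN y"] by simp
    then obtain w where w: "(x, w) \<in> parcs \<Gamma>" "orbN x \<noteq> orbN w" by (elim conjE exE) simp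
    obtain g where g: "g \<in> G" "(g x = u \<and> g w = v) \<or> (g x = v \<and> g w = u)"
      using OG4_edge[OF OG4 w(1) uv] by blast
    have wV: "w \<in> V" using arc_verts[OF w(1)] by blast
    have "orbN (g x) \<noteq> orbN (g w)" using orbN_image[OF g(1) x(1) wV] w(2) by simp
    then show ?thesis using g(2) by auto
  qed
  have arc: "\<exists>e. \<bar>e\<bar> = 1 \<and> int r dvd \<alpha> v - (\<alpha> u + e)" if uv: "(u, v) \<in> parcs \<Gamma>" for u v
  proof -
    have V: "u \<in> V" "v \<in> V" using arc_verts[OF uv] by auto
    have "(orbN u, orbN v) \<in> parcs Q" using Q_arc_iff[OF V(1)] uv ne_arc[OF uv] by blast
    then have "\<alpha> v = (\<alpha> u + 1) mod int r \<or> \<alpha> v = (\<alpha> u + -1) mod int r" using Qarc[OF V] by simp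
    moreover have "int r dvd k mod int r - k" for k by (simp add: mod_eq_dvd_iff[symmetric])
    ultimately have "int r dvd \<alpha> v - (\<alpha> u + 1) \<or> int r dvd \<alpha> v - (\<alpha> u + -1)" by metis
    moreover have "\<bar>1::int\<bar> = 1" "\<bar>-1::int\<bar> = 1" by simp_all
    ultimately show ?thesis by blast
  qed
  have affine: "\<exists>e c. \<bar>e\<bar> = 1 \<and> (\<forall>x\<in>V. int r dvd \<alpha> (g x) - (e * \<alpha> x + c))" if g: "g \<in> G" for g
  proof -
    \<comment> \<open>X n is a vertex with label n, so the labels of the g (X n) form an integer
      sequence to which \<open>affine_of_steps\<close> applies.\<close>
    obtain X where X: "\<And>n. X n \<in> V" "\<And>n. int r dvd \<alpha> (X n) - n" using surj by metis
    have XX: "orbN (X n) = orbN x" if "x \<in> V" "int r dvd \<alpha> x - n" for x n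
      using orb_dvd[OF X(1) that(1)] dvd_diff[OF X(2)[of n] that(2)] by simp
    define \<phi> where "\<phi> n = \<alpha> (g (X n))" for n
    have "\<exists>e. \<bar>e\<bar> = 1 \<and> int r dvd \<phi> (n + 1) - (\<phi> n + e)" for n
    proof -
      have "int r dvd (\<alpha> (X (n + 1)) - (n + 1)) - (\<alpha> (X n) - n)" by (rule dvd_diff[OF X(2) X(2)])
      then have "\<alpha> (X (n + 1)) mod int r = (\<alpha> (X n) + 1) mod int r"
        by (simp add: mod_eq_dvd_iff algebra_simps)
      then have "(orbN (X n), orbN (X (n + 1))) \<in> parcs Q" using Qarc[OF X(1) X(1)] range[OF X(1)] by simp
      then obtain v where v: "(X n, v) \<in> parcs \<Gamma>" "orbN (X (n + 1)) = orbN v"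
        using Q_arc_iff[OF X(1), of n "orbN (X (n + 1))"] by (elim iffD1[elim_format] conjE exE) simp_all
      have vV: "v \<in> V" using arc_verts[OF v(1)] by blast
      have "\<alpha> (g (X (n + 1))) = \<alpha> (g v)"
        using orbN_image[OF g X(1) vV, of "n + 1"] v(2) \<alpha>_eq g X(1) vV by simp
      with arc[OF arc_image[OF g v(1)]] show ?thesis unfolding \<phi>_def by simp
    qed
    moreover have "\<not> int r dvd \<phi> (n + 2) - \<phi> n" for n
    proof
      assume "int r dvd \<phi> (n + 2) - \<phi> n"
      then have "orbN (g (X (n + 2))) = orbN (g (X n))" unfolding \<phi>_def using orb_dvd g X(1) by simp
      then have "orbN (X (n + 2)) = orbN (X n)" using orbN_image[OF g X(1) X(1)] by simp
      then have "int r dvd \<alpha> (X (n + 2)) - \<alpha> (X n)" using orb_dvd[OF X(1) X(1)] by simp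
      then have "int r dvd (\<alpha> (X (n + 2)) - \<alpha> (X n)) - ((\<alpha> (X (n + 2)) - (n + 2)) - (\<alpha> (X n) - n))"
        by (rule dvd_diff[OF _ dvd_diff[OF X(2) X(2)]])
      then have "int r dvd 2" by simp
      then show False using r zdvd_imp_le[of "int r" 2] by simp
    qed
    ultimately obtain e where e: "\<bar>e\<bar> = 1" "\<And>n. int r dvd \<phi> n - (e * n + \<phi> 0)"
      using affine_of_steps[of "int r" \<phi>] by blast
    have "int r dvd \<alpha> (g x) - (e * \<alpha> x + \<phi> 0)" if x: "x \<in> V" for x
    proof -
      have "orbN (X (\<alpha> x)) = orbN x" using XX[OF x] by simp
      then have "\<alpha> (g (X (\<alpha> x))) = \<alpha> (g x)" using orbN_image[OF g X(1) x] \<alpha>_eq g X(1) x by simp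
      then show ?thesis using e(2)[of "\<alpha> x"] by (simp add: \<phi>_def)
    qed
    with e(1) show ?thesis by blast
  qed
  have "cyclic_coordinate r \<alpha>"
    unfolding cyclic_coordinate_def using r affine arc surj by blast
  with orb_dvd show ?thesis by blast
qed

text \<open>Lets the base arc receive the labels 0 and 1: c moves the origin of the cycle and e
  chooses its direction.\<close>

lemma cyclic_coordinate_normalize:
  assumes \<alpha>: "cyclic_coordinate r \<alpha>" and e: "\<bar>e\<bar> = 1"
  shows "cyclic_coordinate r (\<lambda>x. e * (\<alpha> x - c))"
  unfolding cyclic_coordinate_def
proof (intro conjI ballI allI impI)
  have ee: "e = 1 \<or> e = -1" using e by auto
  show "3 \<le> r" using \<alpha> by (simp add: cyclic_coordinate_def)
  show "\<exists>f d. \<bar>f\<bar> = 1 \<and> (\<forall>x\<in>V. int r dvd e * (\<alpha> (g x) - c) - (f * (e * (\<alpha> x - c)) + d))"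
    if g: "g \<in> G" for g
  proof -
    obtain f d where fd: "\<bar>f\<bar> = 1" "\<forall>x\<in>V. int r dvd \<alpha> (g x) - (f * \<alpha> x + d)"
      using \<alpha> g unfolding cyclic_coordinate_def by blast
    have "e * (\<alpha> (g x) - c) - (f * (e * (\<alpha> x - c)) + e * (f * c + d - c)) = e * (\<alpha> (g x) - (f * \<alpha> x + d))" for x
      by (simp add: algebra_simps)
    then have "\<forall>x\<in>V. int r dvd e * (\<alpha> (g x) - c) - (f * (e * (\<alpha> x - c)) + e * (f * c + d - c))"
      using fd(2) by simp
    with fd(1) show ?thesis by blast
  qed
  show "\<exists>f. \<bar>f\<bar> = 1 \<and> int r dvd e * (\<alpha> v - c) - (e * (\<alpha> u - c) + f)" if uv: "(u, v) \<in> parcs \<Gamma>" for u v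
  proof -
    obtain f where f: "\<bar>f\<bar> = 1" "int r dvd \<alpha> v - (\<alpha> u + f)"
      using \<alpha> uv unfolding cyclic_coordinate_def by blast
    have "e * (\<alpha> v - c) - (e * (\<alpha> u - c) + e * f) = e * (\<alpha> v - (\<alpha> u + f))" by (simp add: algebra_simps)
    then have "int r dvd e * (\<alpha> v - c) - (e * (\<alpha> u - c) + e * f)" using f(2) by simp
    moreover have "\<bar>e * f\<bar> = 1" using e f(1) by (simp add: abs_mult)
    ultimately show ?thesis by blast
  qed
  show "\<exists>x\<in>V. int r dvd e * (\<alpha> x - c) - n" for n
  proof -
    obtain x where x: "x \<in> V" "int r dvd \<alpha> x - (e * n + c)"
      using \<alpha> unfolding cyclic_coordinate_def by blast
    have "e * (\<alpha> x - c) - n = e * (\<alpha> x - (e * n + c))" using ee by (auto simp: algebra_simps)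
    then have "int r dvd e * (\<alpha> x - c) - n" using x(2) by simp
    then show ?thesis using x(1) by blast
  qed
qed

end

section \<open>Groups with two independent coordinates\<close>

text \<open>The assumption \<open>faithful\<close> is the form in which independence of the two
  quotients enters. The coordinates are normalized so that the base arc runs from (0, 0) to (1,
  1).\<close>

locale coordinates = graph_grp \<Gamma> G
  for \<Gamma> :: "'a pair_pre_digraph" and G +
  fixes r s :: nat and \<alpha> \<beta> :: "'a \<Rightarrow> int" and x0 y0 :: 'a
  assumes OG4: "OG4 \<Gamma> G"
    and \<alpha>: "cyclic_coordinate r \<alpha>" and \<beta>: "cyclic_coordinate s \<beta>"
    and faithful: "\<lbrakk>g \<in> G; \<forall>x\<in>V. int r dvd \<alpha> (g x) - \<alpha> x; \<forall>x\<in>V. int s dvd \<beta> (g x) - \<beta> x;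
       x \<in> V\<rbrakk> \<Longrightarrow> g x = x"
    and base_arc: "(x0, y0) \<in> parcs \<Gamma>"
    and \<alpha>0: "\<alpha> x0 = 0" and \<beta>0: "\<beta> x0 = 0"
    and \<alpha>1: "int r dvd \<alpha> y0 - 1" and \<beta>1: "int s dvd \<beta> y0 - 1"
begin

lemma x0V [simp]: "x0 \<in> V" and y0V [simp]: "y0 \<in> V"
  using arc_verts[OF base_arc] by auto

lemma rs3: "3 \<le> r" "3 \<le> s"
  using \<alpha> \<beta> by (simp_all add: cyclic_coordinate_def)

lemma not_dvd_2: "\<not> int r dvd 2" "\<not> int s dvd 2" "\<not> int r dvd 1" "\<not> int s dvd 1"
  using rs3 zdvd_imp_le[of "int r" 2] zdvd_imp_le[of "int s" 2] zdvd_imp_le[of "int r" 1] zdvd_imp_le[of "int s" 1]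
  by auto

text \<open>The counterpart of \<open>acts\<close> before a labelling exists: the effect of g on the
  two coordinates, modulo r and s.\<close>

definition rel :: "('a \<Rightarrow> 'a) \<Rightarrow> int \<Rightarrow> int \<Rightarrow> int \<Rightarrow> int \<Rightarrow> bool" where
  "rel g e1 e2 a b \<longleftrightarrow> (\<forall>x\<in>V. int r dvd \<alpha> (g x) - (e1 * \<alpha> x + a) \<and> int s dvd \<beta> (g x) - (e2 * \<beta> x + b))"

lemma rel_ex: "g \<in> G \<Longrightarrow> \<exists>e1 e2 a b. \<bar>e1\<bar> = 1 \<and> \<bar>e2\<bar> = 1 \<and> rel g e1 e2 a b"
  using \<alpha> \<beta> unfolding cyclic_coordinate_def rel_def by meson

lemma rel_comp:
  assumes "rel g e1 e2 a b" "rel h e1' e2' a' b'" "h \<in> G" "\<forall>x\<in>V. k x = g (h x)"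
  shows "rel k (e1 * e1') (e2 * e2') (e1 * a' + a) (e2 * b' + b)"
  unfolding rel_def
proof
  fix x assume x: "x \<in> V"
  have hx: "h x \<in> V" using assms(3) x by simp
  have 1: "int r dvd \<alpha> (g (h x)) - (e1 * \<alpha> (h x) + a)" "int s dvd \<beta> (g (h x)) - (e2 * \<beta> (h x) + b)"
    "int r dvd \<alpha> (h x) - (e1' * \<alpha> x + a')" "int s dvd \<beta> (h x) - (e2' * \<beta> x + b')"
    using assms(1,2) x hx unfolding rel_def by blast+
  have "int r dvd (\<alpha> (g (h x)) - (e1 * \<alpha> (h x) + a)) + e1 * (\<alpha> (h x) - (e1' * \<alpha> x + a'))"
    "int s dvd (\<beta> (g (h x)) - (e2 * \<beta> (h x) + b)) + e2 * (\<beta> (h x) - (e2' * \<beta> x + b'))"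
    using 1 by simp_all
  then show "int r dvd \<alpha> (k x) - (e1 * e1' * \<alpha> x + (e1 * a' + a)) \<and>
      int s dvd \<beta> (k x) - (e2 * e2' * \<beta> x + (e2 * b' + b))"
    using assms(4) x by (simp add: algebra_simps)
qed

lemma rel_cong:
  assumes "rel g e1 e2 a b" "int r dvd a - a'" "int s dvd b - b'"
  shows "rel g e1 e2 a' b'"
  unfolding rel_def
proof
  fix x assume x: "x \<in> V"
  have 1: "int r dvd \<alpha> (g x) - (e1 * \<alpha> x + a)" "int s dvd \<beta> (g x) - (e2 * \<beta> x + b)"
    using assms(1) x unfolding rel_def by blast+
  have "int r dvd (\<alpha> (g x) - (e1 * \<alpha> x + a)) + (a - a')" "int s dvd (\<beta> (g x) - (e2 * \<beta> x + b)) + (b - b')"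
    using dvd_add[OF 1(1) assms(2)] dvd_add[OF 1(2) assms(3)] .
  then show "int r dvd \<alpha> (g x) - (e1 * \<alpha> x + a') \<and> int s dvd \<beta> (g x) - (e2 * \<beta> x + b')"
    by (simp add: algebra_simps)
qed

lemma rel_base:
  assumes "rel g e1 e2 a b"
  shows "int r dvd \<alpha> (g x0) - a" "int s dvd \<beta> (g x0) - b"
  using bspec[OF assms[unfolded rel_def] x0V] by (simp_all add: \<alpha>0 \<beta>0)

text \<open>The product of the inverse of h with g preserves both coordinates, so
  \<open>faithful\<close> applies to it.\<close>

lemma rel_unique:
  assumes "g \<in> G" "h \<in> G" "rel g e1 e2 a b" "rel h e1 e2 a b" "\<bar>e1\<bar> = 1" "\<bar>e2\<bar> = 1"
  shows "g = h"
proof (rule ext[OF assms(1,2)])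
  fix x assume x: "x \<in> V"
  obtain h' where h': "h' \<in> G" "\<forall>x\<in>V. h' (h x) = x" "\<forall>x\<in>V. h (h' x) = x" using ex_inv[OF assms(2)] by blast
  obtain k where k: "k \<in> G" "\<forall>x\<in>V. k x = h' (g x)" using ex_comp[OF h'(1) assms(1)] by blast
  have hk: "h (k y) = g y" if "y \<in> V" for y using k(2) h'(3) assms(1) that by simp
  have e: "e1 * e1 = 1" "e2 * e2 = 1" using assms(5,6) by (auto simp: abs_if split: if_splits)
  have "int r dvd \<alpha> (k y) - \<alpha> y \<and> int s dvd \<beta> (k y) - \<beta> y" if y: "y \<in> V" for y
  proof -
    have ky: "k y \<in> V" using k(1) y by simp
    have 1: "int r dvd \<alpha> (g y) - (e1 * \<alpha> y + a)" "int s dvd \<beta> (g y) - (e2 * \<beta> y + b)"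
      "int r dvd \<alpha> (g y) - (e1 * \<alpha> (k y) + a)" "int s dvd \<beta> (g y) - (e2 * \<beta> (k y) + b)"
      using assms(3,4) y ky hk[OF y] unfolding rel_def by metis+
    have "int r dvd e1 * ((\<alpha> (g y) - (e1 * \<alpha> y + a)) - (\<alpha> (g y) - (e1 * \<alpha> (k y) + a)))"
      "int s dvd e2 * ((\<beta> (g y) - (e2 * \<beta> y + b)) - (\<beta> (g y) - (e2 * \<beta> (k y) + b)))"
      using dvd_mult[OF dvd_diff[OF 1(1,3)]] dvd_mult[OF dvd_diff[OF 1(2,4)]] by simp_all
    moreover have "e1 * ((\<alpha> (g y) - (e1 * \<alpha> y + a)) - (\<alpha> (g y) - (e1 * \<alpha> (k y) + a))) = (e1 * e1) * (\<alpha> (k y) - \<alpha> y)"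
      "e2 * ((\<beta> (g y) - (e2 * \<beta> y + b)) - (\<beta> (g y) - (e2 * \<beta> (k y) + b))) = (e2 * e2) * (\<beta> (k y) - \<beta> y)"
      by (simp_all add: algebra_simps)
    ultimately show ?thesis by (simp add: e)
  qed
  then have "k x = x" using faithful[OF k(1) _ _ x] by blast
  then show "g x = h x" using hk[OF x] by simp
qed

lemma rel_id: "rel (\<lambda>x\<in>V. x) 1 1 0 0"
  by (simp add: rel_def)

lemma rel_inverse:
  assumes "g \<in> G" "h \<in> G" "rel g e1 e2 a b" "\<forall>x\<in>V. h (g x) = x" "\<bar>e1\<bar> = 1" "\<bar>e2\<bar> = 1"
  shows "rel h e1 e2 (- e1 * a) (- e2 * b)"
  unfolding rel_def
proof
  fix x assume "x \<in> V"
  then obtain y where y: "y \<in> V" "g y = x" using surj[OF assms(1)] by blast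
  have e: "e1 = 1 \<or> e1 = -1" "e2 = 1 \<or> e2 = -1" using assms(5,6) by auto
  have "int r dvd \<alpha> x - (e1 * \<alpha> y + a)" "int s dvd \<beta> x - (e2 * \<beta> y + b)" "h x = y"
    using assms(3,4) y unfolding rel_def by auto
  then have "int r dvd (- e1) * (\<alpha> x - (e1 * \<alpha> y + a))" "int s dvd (- e2) * (\<beta> x - (e2 * \<beta> y + b))" "h x = y"
    by (simp_all only: dvd_mult)
  with e show "int r dvd \<alpha> (h x) - (e1 * \<alpha> x + - e1 * a) \<and> int s dvd \<beta> (h x) - (e2 * \<beta> x + - e2 * b)"
    by (elim disjE) (simp_all add: algebra_simps)
qed

text \<open>Edge-transitivity carries the base arc to any given arc up to orientation. A swap of the
  base arc would correct the orientation and make G arc-transitive.\<close>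

lemma no_swap:
  assumes "g \<in> G" "g x0 = y0" "g y0 = x0"
  shows False
proof -
  have to: "\<exists>k\<in>G. k x0 = u \<and> k y0 = v" if uv: "(u, v) \<in> parcs \<Gamma>" for u v
  proof -
    obtain k where k: "k \<in> G" "(k x0 = u \<and> k y0 = v) \<or> (k x0 = v \<and> k y0 = u)"
      using OG4_edge[OF OG4 base_arc uv] by blast
    from k(2) consider "k x0 = u" "k y0 = v" | "k x0 = v" "k y0 = u" by blast
    then show ?thesis
    proof cases
      case 1
      with k(1) show ?thesis by blast
    next
      case 2
      obtain l where "l \<in> G" "\<forall>x\<in>V. l x = k (g x)" using ex_comp[OF k(1) assms(1)] by blast
      with 2 assms(2,3) show ?thesis by (intro bexI[of _ l]) simp_all
    qed
  qed
  have "transitive_on G (\<lambda>g. map_prod g g) (parcs \<Gamma>)"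
    unfolding transitive_on_def
  proof (intro ballI)
    fix e f assume e: "e \<in> parcs \<Gamma>" and f: "f \<in> parcs \<Gamma>"
    obtain u v u' v' where uv: "e = (u, v)" "f = (u', v')" by (cases e, cases f)
    obtain k where k: "k \<in> G" "k x0 = u" "k y0 = v" using to e uv by blast
    obtain l where l: "l \<in> G" "l x0 = u'" "l y0 = v'" using to f uv by blast
    obtain k' where k': "k' \<in> G" "\<forall>x\<in>V. k' (k x) = x" using ex_inverse[OF k(1)] by blast
    obtain m where m: "m \<in> G" "\<forall>x\<in>V. m x = l (k' x)" using ex_comp[OF l(1) k'(1)] by blast
    have "k' u = x0" "k' v = y0" "u \<in> V" "v \<in> V" using k' k arc_verts e uv by auto
    then have "map_prod m m e = f" using m(2) l uv by simp
    with m(1) show "\<exists>g\<in>G. map_prod g g e = f" by blast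
  qed
  then show False using OG4 unfolding OG4_def by blast
qed

lemma ex_base_shift: "\<exists>h\<in>G. h x0 = y0"
  by (rule OG4_vertex[OF OG4 x0V y0V])

text \<open>The edge {x0, v} is an image of the base edge under some k. If k reverses it, then k h
  fixes x0 and sends h^-1 x0 to v; so v is a stabilizer image of the out-neighbour y0 or of the
  in-neighbour h^-1 x0.\<close>

lemma nbr_cases:
  assumes h: "h \<in> G" "h x0 = y0" and h': "h' \<in> G" "\<forall>x\<in>V. h' (h x) = x" "\<forall>x\<in>V. h (h' x) = x"
    and v: "(x0, v) \<in> parcs \<Gamma>"
  shows "\<exists>g\<in>G. g x0 = x0 \<and> (v = g y0 \<or> v = g (h' x0))"
proof -
  obtain k where k: "k \<in> G" "(k x0 = x0 \<and> k y0 = v) \<or> (k x0 = v \<and> k y0 = x0)"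
    using OG4_edge[OF OG4 base_arc v] by blast
  from k(2) consider "k x0 = x0" "k y0 = v" | "k x0 = v" "k y0 = x0" by blast
  then show ?thesis
  proof cases
    case 1
    with k(1) show ?thesis by blast
  next
    case 2
    obtain g where g: "g \<in> G" "\<forall>x\<in>V. g x = k (h x)" using ex_comp[OF k(1) h(1)] by blast
    have "g x0 = x0" "g (h' x0) = v" using g(2) h h' 2 by simp_all
    with g(1) show ?thesis by blast
  qed
qed

lemma rel_stabilizer:
  assumes "g \<in> G" "g x0 = x0"
  shows "\<exists>e1 e2. \<bar>e1\<bar> = 1 \<and> \<bar>e2\<bar> = 1 \<and> rel g e1 e2 0 0"
proof -
  obtain e1 e2 a b where *: "\<bar>e1\<bar> = 1" "\<bar>e2\<bar> = 1" "rel g e1 e2 a b" using rel_ex[OF assms(1)] by blast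
  have "int r dvd 0 - a" "int s dvd 0 - b" using rel_base[OF *(3)] assms(2) \<alpha>0 \<beta>0 by simp_all
  then have "rel g e1 e2 0 0" using rel_cong[OF *(3), of 0 0] by simp
  with * show ?thesis by blast
qed

lemma rel_base_shift:
  assumes "h \<in> G" "h x0 = y0"
  shows "\<exists>f1 f2. \<bar>f1\<bar> = 1 \<and> \<bar>f2\<bar> = 1 \<and> rel h f1 f2 1 1"
proof -
  obtain f1 f2 a b where hr: "\<bar>f1\<bar> = 1" "\<bar>f2\<bar> = 1" "rel h f1 f2 a b" using rel_ex[OF assms(1)] by blast
  have "rel h f1 f2 1 1"
  proof (rule rel_cong[OF hr(3)])
    have "int r dvd (\<alpha> y0 - 1) - (\<alpha> y0 - a)" "int s dvd (\<beta> y0 - 1) - (\<beta> y0 - b)"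
      using rel_base[OF hr(3)] \<alpha>1 \<beta>1 assms(2) by (metis dvd_diff)+
    then show "int r dvd a - 1" "int s dvd b - 1" by simp_all
  qed
  with hr show ?thesis by blast
qed

text \<open>The stabilizer of \<open>x0\<close> acts freely on the out-neighbours and on the in-neighbours, and these are
  four vertices altogether.\<close>

lemma stabilizer_card: "card {g \<in> G. g x0 = x0} = 2"
proof -
  let ?S = "{g \<in> G. g x0 = x0}"
  obtain h where h: "h \<in> G" "h x0 = y0" using ex_base_shift by blast
  obtain h' where h': "h' \<in> G" "\<forall>x\<in>V. h' (h x) = x" "\<forall>x\<in>V. h (h' x) = x" using ex_inv[OF h(1)] by blast
  let ?z = "h' x0"
  have zV: "?z \<in> V" using h'(1) by simp
  have hz: "h ?z = x0" using h'(3) by simp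
  obtain f1 f2 where hr: "\<bar>f1\<bar> = 1" "\<bar>f2\<bar> = 1" "rel h f1 f2 1 1" using rel_base_shift[OF h] by blast
  from rel_inverse[OF h(1) h'(1) hr(3) h'(2) hr(1,2)] have r': "rel h' f1 f2 (- f1) (- f2)" by simp
  have \<alpha>z: "int r dvd \<alpha> ?z - - f1" "int s dvd \<beta> ?z - - f2" using rel_base[OF r'] by simp_all
  \<comment> \<open>At a vertex whose two labels are 1 or -1, the image under a stabilizer element
    reveals both signs of that element, and the signs determine it.\<close>
  have inj: "inj_on (\<lambda>g. g w) ?S"
    if w: "w \<in> V" and d: "\<bar>d1\<bar> = 1" "\<bar>d2\<bar> = 1" "int r dvd \<alpha> w - d1" "int s dvd \<beta> w - d2" for w d1 d2
  proof (rule inj_onI)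
    fix g k assume g: "g \<in> ?S" and k: "k \<in> ?S" and eq: "g w = k w"
    obtain e1 e2 where ge: "\<bar>e1\<bar> = 1" "\<bar>e2\<bar> = 1" "rel g e1 e2 0 0" using rel_stabilizer[of g] g by blast
    obtain c1 c2 where kc: "\<bar>c1\<bar> = 1" "\<bar>c2\<bar> = 1" "rel k c1 c2 0 0" using rel_stabilizer[of k] k by blast
    have 1: "int r dvd \<alpha> (g w) - e1 * \<alpha> w" "int s dvd \<beta> (g w) - e2 * \<beta> w"
      "int r dvd \<alpha> (g w) - c1 * \<alpha> w" "int s dvd \<beta> (g w) - c2 * \<beta> w"
      using ge(3) kc(3) w eq unfolding rel_def by auto
    have "int r dvd ((\<alpha> (g w) - e1 * \<alpha> w) - (\<alpha> (g w) - c1 * \<alpha> w)) - (c1 - e1) * (\<alpha> w - d1)"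
      "int s dvd ((\<beta> (g w) - e2 * \<beta> w) - (\<beta> (g w) - c2 * \<beta> w)) - (c2 - e2) * (\<beta> w - d2)"
      using dvd_diff[OF dvd_diff[OF 1(1,3)] dvd_mult[OF d(3)]] dvd_diff[OF dvd_diff[OF 1(2,4)] dvd_mult[OF d(4)]]
      by blast+
    then have "int r dvd (c1 - e1) * d1" "int s dvd (c2 - e2) * d2" by (simp_all add: algebra_simps)
    moreover have "d1 = 1 \<or> d1 = -1" "d2 = 1 \<or> d2 = -1" "e1 = 1 \<or> e1 = -1" "e2 = 1 \<or> e2 = -1"
      "c1 = 1 \<or> c1 = -1" "c2 = 1 \<or> c2 = -1" using d ge kc by auto
    ultimately have "e1 = c1" "e2 = c2" using not_dvd_2 by auto
    then show "g = k" using rel_unique[of g k e1 e2 0 0] g k ge kc by simp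
  qed
  have injy: "inj_on (\<lambda>g. g y0) ?S" by (rule inj[of _ 1 1]) (use \<alpha>1 \<beta>1 in simp_all)
  have injz: "inj_on (\<lambda>g. g ?z) ?S" by (rule inj[OF zV _ _ \<alpha>z]) (use hr in simp_all)
  have fin: "finite ?S"
  proof (rule finite_imageD[OF _ injy])
    show "finite ((\<lambda>g. g y0) ` ?S)" by (rule finite_subset[OF _ finite_verts]) auto
  qed
  let ?nb = "{v. (x0, v) \<in> parcs \<Gamma>}"
  have nb: "?nb = (\<lambda>g. g y0) ` ?S \<union> (\<lambda>g. g ?z) ` ?S"
  proof (intro equalityI subsetI)
    fix v assume "v \<in> ?nb"
    then obtain g where "g \<in> ?S" "v = g y0 \<or> v = g ?z" using nbr_cases[OF h h'] by blast
    then show "v \<in> (\<lambda>g. g y0) ` ?S \<union> (\<lambda>g. g ?z) ` ?S" by blast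
  next
    have "(?z, x0) \<in> parcs \<Gamma>" using arc_image[OF h'(1) base_arc] h(2) h'(2) x0V by force
    then have xz: "(x0, ?z) \<in> parcs \<Gamma>" by (rule arc_sym)
    fix v assume "v \<in> (\<lambda>g. g y0) ` ?S \<union> (\<lambda>g. g ?z) ` ?S"
    then obtain g where "g \<in> G" "g x0 = x0" "v = g y0 \<or> v = g ?z" by blast
    then show "v \<in> ?nb" using arc_image[of g x0 y0] arc_image[of g x0 ?z] base_arc xz by auto
  qed
  \<comment> \<open>If g y0 = k (h^-1 x0) with g and k in the stabilizer, then g^-1 k h^-1 exchanges
    x0 and y0.\<close>
  have disj: "(\<lambda>g. g y0) ` ?S \<inter> (\<lambda>g. g ?z) ` ?S = {}"
  proof (rule equals0I)
    fix v assume "v \<in> (\<lambda>g. g y0) ` ?S \<inter> (\<lambda>g. g ?z) ` ?S"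
    then obtain g k where g: "g \<in> G" "g x0 = x0" "k \<in> G" "k x0 = x0" "g y0 = k ?z" by auto
    obtain g' where g': "g' \<in> G" "\<forall>x\<in>V. g' (g x) = x" using ex_inverse[OF g(1)] by blast
    obtain m where m: "m \<in> G" "\<forall>x\<in>V. m x = g' (k x)" using ex_comp[OF g'(1) g(3)] by blast
    obtain l where l: "l \<in> G" "\<forall>x\<in>V. l x = m (h' x)" using ex_comp[OF m(1) h'(1)] by blast
    have "h' y0 = x0" using h(2) h'(2) x0V by force
    have "m x0 = x0" using m(2) g'(2) g(2,4) x0V by (metis)
    then have "l y0 = x0" using l(2) \<open>h' y0 = x0\<close> y0V by simp
    have "g' (k ?z) = y0" using g(5) g'(2) y0V by metis
    then have "l x0 = y0" using l(2) m(2) zV x0V by simp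
    then show False using no_swap[OF l(1)] \<open>l y0 = x0\<close> by blast
  qed
  have "card ?nb = card ?S + card ?S"
    unfolding nb using card_Un_disjoint[OF _ _ disj] fin card_image[OF injy] card_image[OF injz] by simp
  moreover have "card ?nb = 4"
  proof -
    have "out_arcs (with_proj \<Gamma>) x0 = Pair x0 ` ?nb" by (auto simp: out_arcs_def)
    then have "card ?nb = out_degree (with_proj \<Gamma>) x0"
      by (simp add: out_degree_def card_image inj_on_def)
    then show ?thesis using OG4 x0V unfolding OG4_def by simp
  qed
  ultimately show ?thesis by simp
qed

lemma stabilizer_generator:
  "\<exists>g0 e1 e2. g0 \<in> G \<and> g0 x0 = x0 \<and> \<bar>e1\<bar> = 1 \<and> \<bar>e2\<bar> = 1 \<and> rel g0 e1 e2 0 0 \<and>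
    \<not> (e1 = 1 \<and> e2 = 1) \<and> (\<forall>g\<in>G. g x0 = x0 \<longrightarrow> g = (\<lambda>x\<in>V. x) \<or> g = g0)"
proof -
  let ?S = "{g \<in> G. g x0 = x0}"
  have id: "(\<lambda>x\<in>V. x) \<in> ?S" using id_mem by simp
  obtain u v where uv: "?S = {u, v}" "u \<noteq> v" using stabilizer_card by (auto simp: card_2_iff)
  have "\<exists>g0. g0 \<in> ?S \<and> g0 \<noteq> (\<lambda>x\<in>V. x) \<and> (\<forall>g. g \<in> ?S \<longrightarrow> g = (\<lambda>x\<in>V. x) \<or> g = g0)"
  proof (cases "u = (\<lambda>x\<in>V. x)")
    case True
    then show ?thesis unfolding uv(1) using uv(2) by auto
  next
    case False
    then have "v = (\<lambda>x\<in>V. x)" using id unfolding uv(1) by simp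
    then show ?thesis unfolding uv(1) using uv(2) by auto
  qed
  then obtain g0 where g0: "g0 \<in> ?S" "g0 \<noteq> (\<lambda>x\<in>V. x)" "\<forall>g. g \<in> ?S \<longrightarrow> g = (\<lambda>x\<in>V. x) \<or> g = g0"
    by (elim exE conjE)
  then have g0S: "g0 \<in> G" "g0 x0 = x0" by simp_all
  obtain e1 e2 where e: "\<bar>e1\<bar> = 1" "\<bar>e2\<bar> = 1" "rel g0 e1 e2 0 0" using rel_stabilizer[OF g0S] by blast
  have "\<not> (e1 = 1 \<and> e2 = 1)"
    using rel_unique[OF g0S(1) id_mem, of 1 1 0 0] e(3) rel_id g0(2) by auto
  moreover have "g = (\<lambda>x\<in>V. x) \<or> g = g0" if "g \<in> G" "g x0 = x0" for g using that g0(3) by simp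
  ultimately show ?thesis using g0S e by blast
qed

end

section \<open>Reconstruction of the lattice labelling\<close>

context coordinates
begin

text \<open>The image of x0, with labels (0, 0), gives the translation part modulo r and s, and then
  the image of y0, with labels (1, 1), gives the signs.\<close>

lemma rel_determines:
  assumes g: "rel g e1 e2 a b" "rel g e1' e2' a' b'"
    and e: "\<bar>e1\<bar> = 1" "\<bar>e2\<bar> = 1" "\<bar>e1'\<bar> = 1" "\<bar>e2'\<bar> = 1"
  shows "int r dvd a - a' \<and> int s dvd b - b' \<and> e1 = e1' \<and> e2 = e2'"
proof -
  have 1: "int r dvd a - a'" "int s dvd b - b'"
    using dvd_diff[OF rel_base(1)[OF g(2)] rel_base(1)[OF g(1)]]
      dvd_diff[OF rel_base(2)[OF g(2)] rel_base(2)[OF g(1)]] by simp_all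
  have "int r dvd \<alpha> (g y0) - (e1 * \<alpha> y0 + a)" "int s dvd \<beta> (g y0) - (e2 * \<beta> y0 + b)"
    "int r dvd \<alpha> (g y0) - (e1' * \<alpha> y0 + a')" "int s dvd \<beta> (g y0) - (e2' * \<beta> y0 + b')"
    using g y0V unfolding rel_def by blast+
  note 2 = this
  have "int r dvd ((\<alpha> (g y0) - (e1' * \<alpha> y0 + a')) - (\<alpha> (g y0) - (e1 * \<alpha> y0 + a))) - (a - a')
      - (e1 - e1') * (\<alpha> y0 - 1)"
    by (intro dvd_diff 1 2 dvd_mult \<alpha>1)
  moreover have "int s dvd ((\<beta> (g y0) - (e2' * \<beta> y0 + b')) - (\<beta> (g y0) - (e2 * \<beta> y0 + b))) - (b - b')
      - (e2 - e2') * (\<beta> y0 - 1)"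
    by (intro dvd_diff 1 2 dvd_mult \<beta>1)
  ultimately have "int r dvd e1 - e1'" "int s dvd e2 - e2'" by (simp_all add: algebra_simps)
  moreover have "e1 = 1 \<or> e1 = -1" "e2 = 1 \<or> e2 = -1" "e1' = 1 \<or> e1' = -1" "e2' = 1 \<or> e2' = -1"
    using e by auto
  ultimately show ?thesis using 1 not_dvd_2 by auto
qed

lemma admissible_abs: "admissible B e1 e2 a b \<Longrightarrow> \<bar>e1\<bar> = 1 \<and> \<bar>e2\<bar> = 1"
  by (simp add: admissible_def)

text \<open>By \<open>admissible_generated\<close> every admissible map is realized by an element of
  G. Labels are the images of x0 under these elements, and the order of the stabilizer ensures that
  no further element or identification occurs.\<close>

lemma lattice_cover_of_generators:
  fixes B :: bool and \<rho> :: int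
  defines "\<rho> \<equiv> if B then -1 else 1"
  assumes g0: "g0 \<in> G" "g0 x0 = x0" "rel g0 (-1) \<rho> 0 0"
    and stab: "\<And>g. \<lbrakk>g \<in> G; g x0 = x0\<rbrakk> \<Longrightarrow> g = (\<lambda>x\<in>V. x) \<or> g = g0"
    and h: "h \<in> G" "h x0 = y0" "rel h \<rho> 1 1 1"
  shows "\<exists>\<pi>. lattice_cover B r s \<Gamma> G \<pi>"
proof -
  have \<rho>: "\<bar>\<rho>\<bar> = 1" by (simp add: \<rho>_def)
  have adm0: "admissible B (-1) \<rho> 0 0" and admh: "admissible B \<rho> 1 1 1"
    by (simp_all add: admissible_def \<rho>_def)
  have ex_rel: "\<exists>g\<in>G. rel g e1 e2 a b" if adm: "admissible B e1 e2 a b" for e1 e2 a b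
  proof -
    let ?Q = "\<lambda>e1 e2 a b. \<bar>e1\<bar> = 1 \<and> \<bar>e2\<bar> = 1 \<and> (\<exists>g\<in>G. rel g e1 e2 a b)"
    have "?Q e1 e2 a b"
    proof (rule admissible_generated[where Q = ?Q and B = B, OF _ _ _ _ adm])
      fix e1 e2 a b e1' e2' a' b' :: int
      assume 1: "?Q e1 e2 a b" and 2: "?Q e1' e2' a' b'"
      then obtain g k where gk: "g \<in> G" "rel g e1 e2 a b" "k \<in> G" "rel k e1' e2' a' b'" by blast
      obtain m where "m \<in> G" "\<forall>x\<in>V. m x = g (k x)" using ex_comp[OF gk(1,3)] by blast
      with rel_comp[OF gk(2,4,3)] 1 2
      show "?Q (e1 * e1') (e2 * e2') (e1 * a' + a) (e2 * b' + b)" by (auto simp: abs_mult)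
    next
      fix e1 e2 a b :: int
      assume 1: "?Q e1 e2 a b" "\<bar>e1\<bar> = 1" "\<bar>e2\<bar> = 1"
      then obtain g where g: "g \<in> G" "rel g e1 e2 a b" by blast
      obtain k where k: "k \<in> G" "\<forall>x\<in>V. k (g x) = x" using ex_inverse[OF g(1)] by blast
      from rel_inverse[OF g(1) k(1) g(2) k(2) 1(2,3)] k(1) 1(2,3) show "?Q e1 e2 (- e1 * a) (- e2 * b)" by blast
    next
      show "?Q (-1) (if B then -1 else 1) 0 0" using g0 \<rho> unfolding \<rho>_def by auto
      show "?Q (if B then -1 else 1) 1 1 1" using h \<rho> unfolding \<rho>_def by auto
    qed
    then show ?thesis by blast
  qed
  have rel_g0: "rel m (e1 * -1) (e2 * \<rho>) a b" if "rel g e1 e2 a b" "\<forall>x\<in>V. m x = g (g0 x)" for g m e1 e2 a b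
    using rel_comp[OF that(1) g0(3,1) that(2)] by simp
  \<comment> \<open>For a fixed translation part admissibility leaves exactly two sign pairs, which
    the signs of g0 interchange; so k is g or g g0, and both send x0 to the same vertex.\<close>
  have wd: "k x0 = g x0"
    if g: "g \<in> G" "admissible B e1 e2 x y" "rel g e1 e2 x y"
      and k: "k \<in> G" "admissible B e1' e2' x y" "rel k e1' e2' x y" for g k e1 e2 e1' e2' x y
  proof -
    note abs = admissible_abs[OF g(2)] admissible_abs[OF k(2)]
    consider "e1' = e1" "e2' = e2" | "e1' = e1 * -1" "e2' = e2 * \<rho>"
      using g(2) k(2) by (elim admissible_cases) (auto simp: \<rho>_def)
    then show ?thesis
    proof cases
      case 1
      then have "k = g" using rel_unique[OF k(1) g(1)] k(3) g(3) abs by simp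
      then show ?thesis by simp
    next
      case 2
      obtain m where m: "m \<in> G" "\<forall>x\<in>V. m x = g (g0 x)" using ex_comp[OF g(1) g0(1)] by blast
      have "rel m e1' e2' x y" using rel_g0[OF g(3) m(2)] 2 by simp
      then have "k = m" using rel_unique[OF k(1) m(1) k(3)] abs by simp
      then show ?thesis using m(2) g0(2) x0V by simp
    qed
  qed
  define \<pi> where "\<pi> x y = (SOME v. \<exists>g\<in>G. \<exists>e1 e2. admissible B e1 e2 x y \<and> rel g e1 e2 x y \<and> v = g x0)" for x y
  have \<pi>_eq: "\<pi> x y = g x0" if g: "g \<in> G" "admissible B e1 e2 x y" "rel g e1 e2 x y" for g e1 e2 x y
    unfolding \<pi>_def
  proof (rule some_equality)
    show "\<exists>k\<in>G. \<exists>e1 e2. admissible B e1 e2 x y \<and> rel k e1 e2 x y \<and> g x0 = k x0" using g by blast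
    fix v assume "\<exists>k\<in>G. \<exists>e1 e2. admissible B e1 e2 x y \<and> rel k e1 e2 x y \<and> v = k x0"
    then show "v = g x0" using wd[OF g] by blast
  qed
  have \<pi>_ex: "\<exists>g e1 e2. g \<in> G \<and> admissible B e1 e2 x y \<and> rel g e1 e2 x y \<and> \<pi> x y = g x0"
    if "even (x + y)" for x y
  proof -
    have adm: "admissible B 1 (if B \<and> odd x then -1 else 1) x y" using that by (auto simp: admissible_def)
    obtain g where "g \<in> G" "rel g 1 (if B \<and> odd x then -1 else 1) x y" using ex_rel[OF adm] by blast
    with adm \<pi>_eq[OF this(1) adm this(2)] show ?thesis by blast
  qed
  have \<pi>V: "\<pi> x y \<in> V" if "even (x + y)" for x y
    using \<pi>_ex[OF that] by auto
  have equiv: "g (\<pi> x y) = \<pi> (e1 * x + a) (e2 * y + b)"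
    if g: "g \<in> G" "admissible B e1 e2 a b" "rel g e1 e2 a b" and xy: "even (x + y)" for g e1 e2 a b x y
  proof -
    obtain k e1' e2' where k: "k \<in> G" "admissible B e1' e2' x y" "rel k e1' e2' x y" "\<pi> x y = k x0"
      using \<pi>_ex[OF xy] by blast
    obtain m where m: "m \<in> G" "\<forall>x\<in>V. m x = g (k x)" using ex_comp[OF g(1) k(1)] by blast
    from \<pi>_eq[OF m(1) admissible_comp[OF g(2) k(2)] rel_comp[OF g(3) k(3,1) m(2)]]
    show ?thesis using m(2) k(4) by simp
  qed
  have \<pi>00: "\<pi> 0 0 = x0"
    using \<pi>_eq[OF id_mem _ rel_id] by (simp add: admissible_def)
  have \<pi>11: "\<pi> 1 1 = y0" using \<pi>_eq[OF h(1) admh h(3)] h(2) by simp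
  obtain h' where h': "h' \<in> G" "\<forall>x\<in>V. h' (h x) = x" "\<forall>x\<in>V. h (h' x) = x" using ex_inv[OF h(1)] by blast
  \<comment> \<open>The inverse of (x, y) -> (\<rho> x + 1, y + 1) sends the origin to (-\<rho>,
    -1).\<close>
  have z: "h' x0 = \<pi> (- \<rho>) (- 1)"
    using \<pi>_eq[OF h'(1) admissible_inv[OF admh] rel_inverse[OF h(1) h'(1) h(3) h'(2) \<rho>]] by simp
  have ge: "g0 y0 = \<pi> (- 1) \<rho>" "g0 (h' x0) = \<pi> \<rho> (- \<rho>)"
    using equiv[OF g0(1) adm0 g0(3), of 1 1] equiv[OF g0(1) adm0 g0(3), of "- \<rho>" "- 1"] \<pi>11 z
    by (simp_all add: \<rho>_def)
  \<comment> \<open>The out-neighbour (1, 1), the in-neighbour (-\<rho>, -1) and their images (-1,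
    \<rho>) and (\<rho>, -\<rho>) under g0 run through all four sign pairs, whichever sign \<rho>
    is.\<close>
  have nbr0: "(x0, v) \<in> parcs \<Gamma> \<longleftrightarrow> (\<exists>a b. \<bar>a\<bar> = 1 \<and> \<bar>b\<bar> = 1 \<and> v = \<pi> a b)" for v
  proof
    assume "(x0, v) \<in> parcs \<Gamma>"
    then obtain g where g: "g \<in> G" "g x0 = x0" "v = g y0 \<or> v = g (h' x0)" using nbr_cases[OF h(1,2) h'] by blast
    have "h' x0 \<in> V" using h'(1) by simp
    with stab[OF g(1,2)] g(3) have "v \<in> {y0, h' x0, g0 y0, g0 (h' x0)}" by auto
    then have "v \<in> {\<pi> 1 1, \<pi> (- \<rho>) (- 1), \<pi> (- 1) \<rho>, \<pi> \<rho> (- \<rho>)}" using \<pi>11 z ge by simp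
    moreover have "\<bar>- \<rho>\<bar> = 1" "\<bar>- 1 :: int\<bar> = 1" "\<bar>1 :: int\<bar> = 1" using \<rho> by simp_all
    ultimately show "\<exists>a b. \<bar>a\<bar> = 1 \<and> \<bar>b\<bar> = 1 \<and> v = \<pi> a b" using \<rho> by blast
  next
    have "(h' y0, h' x0) \<in> parcs \<Gamma>" by (rule arc_image[OF h'(1) arc_sym[OF base_arc]])
    then have xz: "(x0, h' x0) \<in> parcs \<Gamma>" using h(2) h'(2) x0V arc_sym arc_image[OF h'(1) base_arc] by metis
    have "(x0, g0 y0) \<in> parcs \<Gamma>" "(x0, g0 (h' x0)) \<in> parcs \<Gamma>"
      using arc_image[OF g0(1) base_arc] arc_image[OF g0(1) xz] g0(2) by simp_all
    then have four: "(x0, \<pi> 1 1) \<in> parcs \<Gamma>" "(x0, \<pi> (- \<rho>) (- 1)) \<in> parcs \<Gamma>" "(x0, \<pi> (- 1) \<rho>) \<in> parcs \<Gamma>"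
      "(x0, \<pi> \<rho> (- \<rho>)) \<in> parcs \<Gamma>"
      using base_arc xz z ge \<pi>11 by simp_all
    assume "\<exists>a b. \<bar>a\<bar> = 1 \<and> \<bar>b\<bar> = 1 \<and> v = \<pi> a b"
    then obtain a b where ab: "\<bar>a\<bar> = 1" "\<bar>b\<bar> = 1" "v = \<pi> a b" by blast
    then have "a = 1 \<or> a = -1" "b = 1 \<or> b = -1" by auto
    then show "(x0, v) \<in> parcs \<Gamma>" using four ab(3) by (cases B) (auto simp: \<rho>_def)
  qed
  have nbr: "(\<pi> x y, v) \<in> parcs \<Gamma> \<longleftrightarrow> (\<exists>a b. \<bar>a\<bar> = 1 \<and> \<bar>b\<bar> = 1 \<and> v = \<pi> (x + a) (y + b))"
    if xy: "even (x + y)" for x y v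
  proof -
    obtain g e1 e2 where g: "g \<in> G" "admissible B e1 e2 x y" "rel g e1 e2 x y" "\<pi> x y = g x0"
      using \<pi>_ex[OF xy] by blast
    have e: "\<bar>e1\<bar> = 1" "\<bar>e2\<bar> = 1" "e1 * e1 = 1" "e2 * e2 = 1"
      using g(2) by (auto elim!: admissible_cases)
    obtain k where k: "k \<in> G" "\<forall>x\<in>V. k (g x) = x" "\<forall>x\<in>V. g (k x) = x" using ex_inv[OF g(1)] by blast
    have ev: "even (a + b)" if "\<bar>a\<bar> = 1" "\<bar>b\<bar> = 1" for a b :: int
      using that abs_eq_one_odd by simp
    show ?thesis
    proof
      assume arc: "(\<pi> x y, v) \<in> parcs \<Gamma>"
      then have vV: "v \<in> V" using arc_verts by blast
      have "(x0, k v) \<in> parcs \<Gamma>" using arc_image[OF k(1) arc] g(4) k(2) by simp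
      then obtain a b where ab: "\<bar>a\<bar> = 1" "\<bar>b\<bar> = 1" "k v = \<pi> a b" using nbr0 by blast
      have "v = g (\<pi> a b)" using ab(3) k(3) vV by metis
      also have "\<dots> = \<pi> (e1 * a + x) (e2 * b + y)" by (rule equiv[OF g(1-3) ev[OF ab(1,2)]])
      finally have "v = \<pi> (x + e1 * a) (y + e2 * b)" by (simp add: add.commute)
      moreover have "\<bar>e1 * a\<bar> = 1" "\<bar>e2 * b\<bar> = 1" using e ab by (simp_all add: abs_mult)
      ultimately show "\<exists>a b. \<bar>a\<bar> = 1 \<and> \<bar>b\<bar> = 1 \<and> v = \<pi> (x + a) (y + b)" by blast
    next
      assume "\<exists>a b. \<bar>a\<bar> = 1 \<and> \<bar>b\<bar> = 1 \<and> v = \<pi> (x + a) (y + b)"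
      then obtain a b where ab: "\<bar>a\<bar> = 1" "\<bar>b\<bar> = 1" "v = \<pi> (x + a) (y + b)" by blast
      have ab': "\<bar>e1 * a\<bar> = 1" "\<bar>e2 * b\<bar> = 1" using e ab by (simp_all add: abs_mult)
      have "g (\<pi> (e1 * a) (e2 * b)) = \<pi> (e1 * (e1 * a) + x) (e2 * (e2 * b) + y)"
        by (rule equiv[OF g(1-3) ev[OF ab']])
      moreover have "e1 * (e1 * a) = a" "e2 * (e2 * b) = b" using e by (simp_all add: mult.assoc[symmetric])
      ultimately have "v = g (\<pi> (e1 * a) (e2 * b))" using ab(3) by (simp add: add.commute)
      moreover have "(x0, \<pi> (e1 * a) (e2 * b)) \<in> parcs \<Gamma>" using nbr0 ab' by blast
      ultimately show "(\<pi> x y, v) \<in> parcs \<Gamma>" using arc_image[OF g(1)] g(4) by simp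
    qed
  qed
  have verts: "V = {\<pi> x y | x y. even (x + y)}" (is "_ = ?W")
  proof (rule equalityI)
    have "arc_closed \<Gamma> ?W"
      unfolding arc_closed_def
    proof (intro allI impI)
      fix v w assume "v \<in> ?W" and arc: "(v, w) \<in> parcs \<Gamma>"
      then obtain x y where xy: "v = \<pi> x y" "even (x + y)" by blast
      obtain a b where ab: "\<bar>a\<bar> = 1" "\<bar>b\<bar> = 1" "w = \<pi> (x + a) (y + b)"
        using arc nbr[OF xy(2)] unfolding xy(1) by blast
      then have "even ((x + a) + (y + b))" using xy(2) abs_eq_one_odd by simp
      with ab(3) show "w \<in> ?W" by blast
    qed
    moreover have "x0 \<in> ?W" using \<pi>00[symmetric] by (intro CollectI exI[of _ 0]) simp
    moreover have "Digraph_Component.connected (with_proj \<Gamma>)" using OG4 by (simp add: OG4_def)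
    ultimately show "V \<subseteq> ?W" using x0V unfolding connected_iff[OF pair_graph] by meson
    show "?W \<subseteq> V" using \<pi>V by blast
  qed
  \<comment> \<open>Elements that agree at x0 differ by the stabilizer, hence k is g or g g0 and
    admits the same translation part as g. This gives both injectivity of the labelling and a
    lattice map for every element.\<close>
  have same: "\<exists>e1' e2'. admissible B e1' e2' x y \<and> rel k e1' e2' x y"
    if g: "g \<in> G" "admissible B e1 e2 x y" "rel g e1 e2 x y" and k: "k \<in> G" "k x0 = g x0" for g k e1 e2 x y
  proof -
    obtain g' where g': "g' \<in> G" "\<forall>x\<in>V. g' (g x) = x" "\<forall>x\<in>V. g (g' x) = x" using ex_inv[OF g(1)] by blast
    obtain m where m: "m \<in> G" "\<forall>x\<in>V. m x = g' (k x)" using ex_comp[OF g'(1) k(1)] by blast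
    have "m x0 = x0" using m(2) k(2) g'(2) x0V by simp
    then consider "m = (\<lambda>x\<in>V. x)" | "m = g0" using stab[OF m(1)] by blast
    then show ?thesis
    proof cases
      case 1
      have "k x = g x" if x: "x \<in> V" for x
      proof -
        have "g' (k x) = x" using m(2) x unfolding 1 by simp
        then show ?thesis using g'(3) closed[OF k(1) x] by force
      qed
      then have "k = g" using ext[OF k(1) g(1)] by blast
      with g show ?thesis by blast
    next
      case 2
      have "k x = g (g0 x)" if x: "x \<in> V" for x
      proof -
        have "g' (k x) = g0 x" using m(2) x unfolding 2 by simp
        then show ?thesis using g'(3) closed[OF k(1) x] by force
      qed
      then have "rel k (e1 * -1) (e2 * \<rho>) x y" using rel_g0[OF g(3)] by blast
      moreover have "admissible B (e1 * -1) (e2 * \<rho>) x y" using admissible_comp[OF g(2) adm0] by simp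
      ultimately show ?thesis by blast
    qed
  qed
  have "lattice_cover B r s \<Gamma> G \<pi>"
  proof
    show "V = {\<pi> x y | x y. even (x + y)}" by (fact verts)
    show "\<pi> x y = \<pi> x' y' \<longleftrightarrow> int r dvd x - x' \<and> int s dvd y - y' \<and> (B \<longrightarrow> even (x - x'))"
      if xy: "even (x + y)" and xy': "even (x' + y')" for x y x' y'
    proof -
      obtain g e1 e2 where g: "g \<in> G" "admissible B e1 e2 x y" "rel g e1 e2 x y" "\<pi> x y = g x0"
        using \<pi>_ex[OF xy] by blast
      obtain k c1 c2 where k: "k \<in> G" "admissible B c1 c2 x' y'" "rel k c1 c2 x' y'" "\<pi> x' y' = k x0"
        using \<pi>_ex[OF xy'] by blast
      show ?thesis
      proof
        assume "\<pi> x y = \<pi> x' y'"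
        then obtain d1 d2 where d: "admissible B d1 d2 x y" "rel k d1 d2 x y"
          using same[OF g(1-3) k(1)] g(4) k(4) by auto
        from rel_determines[OF d(2) k(3)] admissible_abs[OF d(1)] admissible_abs[OF k(2)]
        have *: "int r dvd x - x'" "int s dvd y - y'" "d1 = c1" "d2 = c2" by auto
        \<comment> \<open>With \<open>B\<close> the product of the signs determines the parity of
          the first entry, so equal signs force x and x' to have equal parity.\<close>
        moreover have "even (x - x')" if B using d(1) k(2) * that by (auto simp: admissible_def)
        ultimately show "int r dvd x - x' \<and> int s dvd y - y' \<and> (B \<longrightarrow> even (x - x'))" by blast
      next
        assume *: "int r dvd x - x' \<and> int s dvd y - y' \<and> (B \<longrightarrow> even (x - x'))"
        then have "rel g e1 e2 x' y'" using rel_cong[OF g(3)] by blast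
        moreover have "admissible B e1 e2 x' y'" using g(2) * xy' by (auto simp: admissible_def)
        ultimately have "\<pi> x' y' = g x0" by (intro \<pi>_eq[OF g(1)])
        then show "\<pi> x y = \<pi> x' y'" using g(4) by simp
      qed
    qed
    show "parcs \<Gamma> = lattice_arcs \<pi>"
    proof (intro equalityI subsetI)
      fix e assume e: "e \<in> parcs \<Gamma>"
      obtain u v where uv: "e = (u, v)" by (cases e)
      then have "u \<in> {\<pi> x y | x y. even (x + y)}" using arc_verts e verts by blast
      then obtain x y where xy: "u = \<pi> x y" "even (x + y)" by blast
      obtain a b where "\<bar>a\<bar> = 1" "\<bar>b\<bar> = 1" "v = \<pi> (x + a) (y + b)"
        using nbr[OF xy(2)] e unfolding uv xy(1) by blast
      with uv xy show "e \<in> lattice_arcs \<pi>"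
        unfolding lattice_arcs_def by blast
    next
      fix e assume "e \<in> lattice_arcs \<pi>"
      then obtain x y a b where *: "e = (\<pi> x y, \<pi> (x + a) (y + b))" "even (x + y)" "\<bar>a\<bar> = 1" "\<bar>b\<bar> = 1"
        unfolding lattice_arcs_def by blast
      then show "e \<in> parcs \<Gamma>" using nbr[OF *(2)] by blast
    qed
    show "\<exists>g\<in>G. acts \<pi> g e1 e2 a b"
      if adm: "admissible B e1 e2 a b" for e1 e2 a b
      using ex_rel[OF adm] equiv[OF _ adm] unfolding acts_def by blast
    show "\<exists>e1 e2 a b. admissible B e1 e2 a b \<and>
        acts \<pi> g e1 e2 a b" if g: "g \<in> G" for g
    proof -
      have "g x0 \<in> {\<pi> x y | x y. even (x + y)}" using closed[OF g x0V] unfolding verts .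
      then obtain x y where xy: "even (x + y)" "g x0 = \<pi> x y" by blast
      obtain k c1 c2 where k: "k \<in> G" "admissible B c1 c2 x y" "rel k c1 c2 x y" "\<pi> x y = k x0"
        using \<pi>_ex[OF xy(1)] by blast
      obtain e1 e2 where "admissible B e1 e2 x y" "rel g e1 e2 x y"
        using same[OF k(1-3) g] xy(2) k(4) by auto
      with equiv[OF g this] show ?thesis unfolding acts_def by blast
    qed
    show "G \<subseteq> extensional V" using subset_Bij by (auto simp: Bij_def)
  qed
  then show ?thesis by blast
qed

text \<open>If the stabilizer reflects only \<open>\<alpha>\<close>, a shift reversing \<open>\<beta>\<close> would confine \<open>\<beta>\<close> to two values.\<close>

lemma lattice_cover_reflection:
  assumes g0: "g0 \<in> G" "g0 x0 = x0" "rel g0 (-1) 1 0 0"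
    and stab: "\<And>g. \<lbrakk>g \<in> G; g x0 = x0\<rbrakk> \<Longrightarrow> g = (\<lambda>x\<in>V. x) \<or> g = g0"
  shows "\<exists>\<pi>. lattice_cover False r s \<Gamma> G \<pi>"
proof -
  obtain h0 where h0: "h0 \<in> G" "h0 x0 = y0" using ex_base_shift by blast
  obtain f1 f2 where f: "\<bar>f1\<bar> = 1" "\<bar>f2\<bar> = 1" "rel h0 f1 f2 1 1" using rel_base_shift[OF h0] by blast
  have "\<exists>h\<in>G. h x0 = y0 \<and> rel h 1 f2 1 1"
  proof (cases "f1 = 1")
    case True
    with h0 f show ?thesis by blast
  next
    case False
    then have "f1 = -1" using f(1) by auto
    obtain m where m: "m \<in> G" "\<forall>x\<in>V. m x = h0 (g0 x)" using ex_comp[OF h0(1) g0(1)] by blast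
    have "rel m 1 f2 1 1" using rel_comp[OF f(3) g0(3,1) m(2)] \<open>f1 = -1\<close> by simp
    moreover have "m x0 = y0" using m(2) g0(2) h0(2) x0V by simp
    ultimately show ?thesis using m(1) by blast
  qed
  then obtain h where h: "h \<in> G" "h x0 = y0" "rel h 1 f2 1 1" by blast
  have "f2 = 1"
  proof (rule ccontr)
    assume "f2 \<noteq> 1"
    then have f2: "f2 = -1" using f(2) by auto
    obtain h' where h': "h' \<in> G" "\<forall>x\<in>V. h' (h x) = x" "\<forall>x\<in>V. h (h' x) = x" using ex_inv[OF h(1)] by blast
    \<comment> \<open>Elements acting on the second coordinate as y -> y or y -> 1 - y. They are
      closed under composition and contain h, its inverse and the stabilizer, so by connectedness
      they reach every vertex from x0.\<close>
    define P where "P g \<longleftrightarrow> g \<in> G \<and> (\<exists>e a. rel g e 1 a 0 \<or> rel g e (-1) a 1)" for g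
    have Pcomp: "P m" if "P g" "P k" "m \<in> G" "\<forall>x\<in>V. m x = g (k x)" for g k m
    proof -
      obtain e a where g: "rel g e 1 a 0 \<or> rel g e (-1) a 1" using \<open>P g\<close> unfolding P_def by blast
      obtain c d where k: "rel k c 1 d 0 \<or> rel k c (-1) d 1" using \<open>P k\<close> unfolding P_def by blast
      have kG: "k \<in> G" using that(2) by (simp add: P_def)
      note comp = rel_comp[OF _ _ kG that(4)]
      from g k have "rel m (e * c) 1 (e * d + a) 0 \<or> rel m (e * c) (-1) (e * d + a) 1"
        by (elim disjE) (drule (1) comp, simp)+
      then show ?thesis using that(3) unfolding P_def by blast
    qed
    have Ph: "P h" using h f2 unfolding P_def by blast
    have "rel h' 1 (-1) (-1) 1" using rel_inverse[OF h(1) h'(1) h(3) h'(2)] f2 by simp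
    then have Ph': "P h'" using h'(1) unfolding P_def by blast
    have Pg: "P g" if "g \<in> G" "g x0 = x0" for g
      using stab[OF that] that(1) rel_id g0(3) unfolding P_def by blast
    let ?W = "{v. \<exists>g. P g \<and> g x0 = v}"
    have "arc_closed \<Gamma> ?W"
      unfolding arc_closed_def
    proof (intro allI impI)
      fix v w assume "v \<in> ?W" and arc: "(v, w) \<in> parcs \<Gamma>"
      then obtain g where g: "P g" "g x0 = v" by blast
      have gG: "g \<in> G" using g(1) by (simp add: P_def)
      obtain g' where g': "g' \<in> G" "\<forall>x\<in>V. g' (g x) = x" "\<forall>x\<in>V. g (g' x) = x" using ex_inv[OF gG] by blast
      have "(x0, g' w) \<in> parcs \<Gamma>" using arc_image[OF g'(1) arc] g(2) g'(2) x0V by force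
      then obtain k where k: "k \<in> G" "k x0 = x0" "g' w = k y0 \<or> g' w = k (h' x0)"
        using nbr_cases[OF h(1,2) h'] by blast
      have step: "w \<in> ?W" if "P l" "g' w = k (l x0)" for l
      proof -
        have lG: "l \<in> G" using that(1) by (simp add: P_def)
        obtain m where m: "m \<in> G" "\<forall>x\<in>V. m x = k (l x)" using ex_comp[OF k(1) lG] by blast
        obtain n where n: "n \<in> G" "\<forall>x\<in>V. n x = g (m x)" using ex_comp[OF gG m(1)] by blast
        have "P n" by (rule Pcomp[OF g(1) Pcomp[OF Pg[OF k(1,2)] that(1) m] n])
        moreover have "w \<in> V" using arc_verts[OF arc] by blast
        then have "n x0 = w" using n(2) m(2) that(2) g'(3) x0V by metis
        ultimately show ?thesis by blast
      qed
      from k(3) show "w \<in> ?W" using step[OF Ph] step[OF Ph'] h(2) by auto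
    qed
    moreover have "x0 \<in> ?W" using Pg[OF id_mem] by (intro CollectI exI[of _ "\<lambda>x\<in>V. x"]) simp
    moreover have "Digraph_Component.connected (with_proj \<Gamma>)" using OG4 by (simp add: OG4_def)
    ultimately have VW: "V \<subseteq> ?W" using x0V unfolding connected_iff[OF pair_graph] by meson
    \<comment> \<open>A vertex with second label 2 exists, but only the labels 0 and 1 are reached;
      s is at least 3.\<close>
    obtain v where v: "v \<in> V" "int s dvd \<beta> v - 2" using \<beta> unfolding cyclic_coordinate_def by blast
    then obtain g where "P g" "g x0 = v" using VW by blast
    then have "int s dvd \<beta> v - 0 \<or> int s dvd \<beta> v - 1"
      unfolding P_def using rel_base(2) by blast
    then have "int s dvd (\<beta> v - 0) - (\<beta> v - 2) \<or> int s dvd (\<beta> v - 1) - (\<beta> v - 2)" using v(2) dvd_diff by blast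
    then show False using not_dvd_2 by simp
  qed
  show ?thesis
  proof (rule lattice_cover_of_generators[OF g0(1,2) _ stab])
    show "rel g0 (-1) (if False then -1 else 1) 0 0" using g0(3) by simp
    show "rel h (if False then -1 else 1) 1 1 1" using h \<open>f2 = 1\<close> by simp
  qed (use h in auto)
qed

lemma lattice_cover_rotation:
  assumes g0: "g0 \<in> G" "g0 x0 = x0" "rel g0 (-1) (-1) 0 0"
    and stab: "\<And>g. \<lbrakk>g \<in> G; g x0 = x0\<rbrakk> \<Longrightarrow> g = (\<lambda>x\<in>V. x) \<or> g = g0"
  shows "\<exists>\<pi>. lattice_cover True r s \<Gamma> G \<pi>"
proof -
  obtain h0 where h0: "h0 \<in> G" "h0 x0 = y0" using ex_base_shift by blast
  obtain f1 f2 where f: "\<bar>f1\<bar> = 1" "\<bar>f2\<bar> = 1" "rel h0 f1 f2 1 1" using rel_base_shift[OF h0] by blast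
  have "\<exists>h\<in>G. \<exists>f. \<bar>f\<bar> = 1 \<and> h x0 = y0 \<and> rel h f 1 1 1"
  proof (cases "f2 = 1")
    case True
    with h0 f show ?thesis by blast
  next
    case False
    then have "f2 = -1" using f(2) by auto
    obtain m where m: "m \<in> G" "\<forall>x\<in>V. m x = h0 (g0 x)" using ex_comp[OF h0(1) g0(1)] by blast
    have "rel m (- f1) 1 1 1" using rel_comp[OF f(3) g0(3,1) m(2)] \<open>f2 = -1\<close> by simp
    moreover have "m x0 = y0" using m(2) g0(2) h0(2) x0V by simp
    moreover have "\<bar>- f1\<bar> = 1" using f(1) by simp
    ultimately show ?thesis using m(1) by blast
  qed
  then obtain h f where h: "h \<in> G" "\<bar>f\<bar> = 1" "h x0 = y0" "rel h f 1 1 1" by blast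
  have "f = -1"
  proof (rule ccontr)
    assume "f \<noteq> -1"
    then have f: "f = 1" using h(2) by auto
    obtain m where m: "m \<in> G" "\<forall>x\<in>V. m x = h (g0 x)" using ex_comp[OF h(1) g0(1)] by blast
    \<comment> \<open>With m = h g0, the product m h has signs (-1, -1) and no translation part, so
      it equals g0 and fixes x0. Hence m sends y0 = h x0 back to x0, while it sends x0 to
      y0.\<close>
    obtain n where n: "n \<in> G" "\<forall>x\<in>V. n x = m (h x)" using ex_comp[OF m(1) h(1)] by blast
    have "rel m (-1) (-1) 1 1" using rel_comp[OF h(4) g0(3,1) m(2)] f by simp
    from rel_comp[OF this h(4,1) n(2)] f have "rel n (-1) (-1) 0 0" by simp
    then have "n = g0" using rel_unique[OF n(1) g0(1) _ g0(3)] by simp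
    then have "m y0 = x0" using n(2) g0(2) h(3) x0V by metis
    moreover have "m x0 = y0" using m(2) g0(2) h(3) x0V by simp
    ultimately show False using no_swap[OF m(1)] by blast
  qed
  show ?thesis
  proof (rule lattice_cover_of_generators[OF g0(1,2) _ stab])
    show "rel g0 (-1) (if True then -1 else 1) 0 0" using g0(3) by simp
    show "rel h (if True then -1 else 1) 1 1 1" using h \<open>f = -1\<close> by simp
  qed (use h in auto)
qed

text \<open>The assumptions are symmetric in the two coordinates, which reduces a stabilizer
  reflecting \<beta> to one reflecting \<alpha>.\<close>

lemma swapped: "coordinates \<Gamma> G s r \<beta> \<alpha> x0 y0"
  by unfold_locales (use OG4 \<alpha> \<beta> faithful base_arc \<alpha>0 \<beta>0 \<alpha>1 \<beta>1 in blast)+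

lemma ex_lattice_cover:
  "\<exists>B r' s' \<pi>. 3 \<le> r' \<and> 3 \<le> s' \<and> lattice_cover B r' s' \<Gamma> G \<pi>"
proof -
  obtain g0 e1 e2 where g0: "g0 \<in> G" "g0 x0 = x0" "\<bar>e1\<bar> = 1" "\<bar>e2\<bar> = 1" "rel g0 e1 e2 0 0"
    "\<not> (e1 = 1 \<and> e2 = 1)" and st: "\<forall>g\<in>G. g x0 = x0 \<longrightarrow> g = (\<lambda>x\<in>V. x) \<or> g = g0"
    using stabilizer_generator by (elim exE conjE)
  have stab: "g = (\<lambda>x\<in>V. x) \<or> g = g0" if "g \<in> G" "g x0 = x0" for g using st that by blast
  from g0(3,4,6) consider "e1 = -1" "e2 = 1" | "e1 = 1" "e2 = -1" | "e1 = -1" "e2 = -1" by linarith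
  then show ?thesis
  proof cases
    case 1
    with lattice_cover_reflection[OF g0(1,2) _ stab] g0(5) rs3 show ?thesis by blast
  next
    case 2
    interpret sw: coordinates \<Gamma> G s r \<beta> \<alpha> x0 y0 by (rule swapped)
    have "sw.rel g0 (-1) 1 0 0" using g0(5) 2 unfolding rel_def sw.rel_def by blast
    with sw.lattice_cover_reflection[OF g0(1,2) _ stab] rs3 show ?thesis by blast
  next
    case 3
    with lattice_cover_rotation[OF g0(1,2) _ stab] g0(5) rs3 show ?thesis by blast
  qed
qed

end

section \<open>The classification\<close>

lemma (in graph_grp) ex_lattice_cover_of_independent:
  assumes bic: "basic_independent_cycle_type \<Gamma> G"
  shows "\<exists>B r s \<pi>. 3 \<le> r \<and> 3 \<le> s \<and> lattice_cover B r s \<Gamma> G \<pi>"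
proof -
  have basic: "OG4_basic \<Gamma> G" and OG4: "OG4 \<Gamma> G"
    using bic by (simp_all add: basic_independent_cycle_type_def OG4_basic_def)
  obtain M N where M: "cyclic_normal_quotient \<Gamma> G M" and N: "cyclic_normal_quotient \<Gamma> G N"
    and ind: "independent_quotients \<Gamma> G M N"
    using bic unfolding basic_independent_cycle_type_def by blast
  let ?K = "orbit_kernel V G M \<inter> orbit_kernel V G N"
  have nM: "normal_sub M" and nN: "normal_sub N"
    using M N nontrivial_normal_iff' by (simp_all add: cyclic_normal_quotient_def)
  obtain r \<alpha> where \<alpha>: "cyclic_coordinate r \<alpha>"
    and \<alpha>orb: "\<forall>x\<in>V. \<forall>y\<in>V. perm_grp.orb M x = perm_grp.orb M y \<longleftrightarrow> int r dvd \<alpha> x - \<alpha> y"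
    using ex_cyclic_coordinate[OF OG4 M] by blast
  obtain s \<beta> where \<beta>: "cyclic_coordinate s \<beta>"
    and \<beta>orb: "\<forall>x\<in>V. \<forall>y\<in>V. perm_grp.orb N x = perm_grp.orb N y \<longleftrightarrow> int s dvd \<beta> x - \<beta> y"
    using ex_cyclic_coordinate[OF OG4 N] by blast
  have memM: "g \<in> orbit_kernel V G M \<longleftrightarrow> (\<forall>x\<in>V. int r dvd \<alpha> (g x) - \<alpha> x)" if g: "g \<in> G" for g
    using mem_orbit_kernel_iff[OF nM, of g] \<alpha>orb g by simp
  have memN: "g \<in> orbit_kernel V G N \<longleftrightarrow> (\<forall>x\<in>V. int s dvd \<beta> (g x) - \<beta> x)" if g: "g \<in> G" for g
    using mem_orbit_kernel_iff[OF nN, of g] \<beta>orb g by simp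
  have nK: "normal_sub ?K" by (rule normal_orbit_kernels[OF nM nN])
  interpret K: normal_quotient \<Gamma> G ?K by unfold_locales (rule nK)
  have faithful: "g x = x"
    if g: "g \<in> G" "\<forall>x\<in>V. int r dvd \<alpha> (g x) - \<alpha> x" "\<forall>x\<in>V. int s dvd \<beta> (g x) - \<beta> x" "x \<in> V" for g x
  proof (rule ccontr)
    assume ne: "g x \<noteq> x"
    have "g \<in> ?K" using memM[OF g(1)] memN[OF g(1)] g(2,3) by simp
    then have "nontrivial_normal V G ?K" using nK ne g(4) unfolding nontrivial_normal_iff' by blast
    then have cc: "cyclic_or_complete K.Q" using basic unfolding OG4_basic_def cyclic_or_complete_def by blast
    \<comment> \<open>A nontrivial common kernel preserves \<alpha>, so vertices with labels 0, 1
      and 2 lie in different orbits. Having three vertices, the permitted quotient must be a cycle,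
      against independence.\<close>
    have "\<exists>v\<in>V. int r dvd \<alpha> v - n" for n using \<alpha> unfolding cyclic_coordinate_def by blast
    then obtain X where X: "\<And>n. X n \<in> V" "\<And>n. int r dvd \<alpha> (X n) - n" by metis
    have diff: "K.orbN (X n) \<noteq> K.orbN (X m)" if nm: "\<not> int r dvd n - m" for n m
    proof
      assume "K.orbN (X n) = K.orbN (X m)"
      then obtain k where k: "k \<in> ?K" "k (X m) = X n" using K.N.orb_eq_iff[OF X(1) X(1)] by metis
      have kG: "k \<in> G" using k(1) K.N_subset by blast
      have "int r dvd \<alpha> (k (X m)) - \<alpha> (X m)" using memM[OF kG] k(1) X(1) by blast
      then have "int r dvd \<alpha> (X n) - \<alpha> (X m)" unfolding k(2) .
      then have "int r dvd (\<alpha> (X n) - \<alpha> (X m)) - ((\<alpha> (X n) - n) - (\<alpha> (X m) - m))"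
        by (rule dvd_diff[OF _ dvd_diff[OF X(2) X(2)]])
      then show False using nm by simp
    qed
    have r: "3 \<le> r" using \<alpha> by (simp add: cyclic_coordinate_def)
    then have "\<not> int r dvd 0 - 1" "\<not> int r dvd 0 - 2" "\<not> int r dvd 1 - 2"
      using zdvd_imp_le[of "int r" 1] zdvd_imp_le[of "int r" 2] by auto
    note ds = this[THEN diff]
    have "K.orbN (X n) \<in> pverts K.Q" for n unfolding K.Q_verts using X(1) by blast
    from cyclic_or_complete_card[OF cc this this this ds] ind
    show False unfolding independent_quotients_def by blast
  qed
  have "V \<noteq> {}" using OG4 connected_iff[OF pair_graph] by (simp add: OG4_def)
  then obtain x0 where x0: "x0 \<in> V" by blast
  have "out_degree (with_proj \<Gamma>) x0 = 4" using OG4 x0 by (simp add: OG4_def)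
  then have "out_arcs (with_proj \<Gamma>) x0 \<noteq> {}" by (auto simp: out_degree_def)
  then obtain e where "e \<in> out_arcs (with_proj \<Gamma>) x0" by blast
  then obtain y0 where arc: "(x0, y0) \<in> parcs \<Gamma>" by (cases e) (auto simp: out_arcs_def)
  obtain d where d: "\<bar>d\<bar> = 1" "int r dvd \<alpha> y0 - (\<alpha> x0 + d)" using \<alpha> arc unfolding cyclic_coordinate_def by blast
  obtain c where c: "\<bar>c\<bar> = 1" "int s dvd \<beta> y0 - (\<beta> x0 + c)" using \<beta> arc unfolding cyclic_coordinate_def by blast
  \<comment> \<open>Subtracting the labels of x0 and multiplying by the signs d and c of the base
    arc gives x0 the labels (0, 0) and y0 the labels (1, 1).\<close>
  let ?\<alpha> = "\<lambda>x. d * (\<alpha> x - \<alpha> x0)" and ?\<beta> = "\<lambda>x. c * (\<beta> x - \<beta> x0)"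
  have sgn: "int k dvd e * (u - w) - e * (v - w) \<longleftrightarrow> int k dvd u - v" if "\<bar>e\<bar> = 1" for k e u v w
  proof -
    have "e = 1 \<or> e = -1" using that by auto
    then show ?thesis by (auto simp: dvd_diff_commute)
  qed
  interpret coordinates \<Gamma> G r s ?\<alpha> ?\<beta> x0 y0
  proof
    show "cyclic_coordinate r ?\<alpha>" by (rule cyclic_coordinate_normalize[OF \<alpha> d(1)])
    show "cyclic_coordinate s ?\<beta>" by (rule cyclic_coordinate_normalize[OF \<beta> c(1)])
    show "g x = x" if "g \<in> G" "\<forall>x\<in>V. int r dvd ?\<alpha> (g x) - ?\<alpha> x" "\<forall>x\<in>V. int s dvd ?\<beta> (g x) - ?\<beta> x" "x \<in> V" for g x
      using faithful[OF that(1) _ _ that(4)] that(2,3) unfolding sgn[OF d(1)] sgn[OF c(1)] by blast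
    have dd: "d = 1 \<or> d = -1" "c = 1 \<or> c = -1" using d c by auto
    have "int r dvd d * (\<alpha> y0 - (\<alpha> x0 + d))" "int s dvd c * (\<beta> y0 - (\<beta> x0 + c))" using d(2) c(2) by simp_all
    then show "int r dvd ?\<alpha> y0 - 1" "int s dvd ?\<beta> y0 - 1"
      using dd by (auto simp: algebra_simps)
  qed (use OG4 arc in simp_all)
  show ?thesis by (rule ex_lattice_cover)
qed

text \<open>Moduli of equal parity: both odd, possible only without \<open>B\<close>, or both even.
  The families of the theorem that mix parities, and the double covers, are brought to the even form
  by doubling.\<close>

definition normal_form :: "bool \<Rightarrow> nat \<Rightarrow> nat \<Rightarrow> bool" where
  "normal_form B r s \<longleftrightarrow> (\<not> B \<and> prime r \<and> odd r \<and> prime s \<and> odd s) \<or>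
    (\<exists>p q. r = 2 * p \<and> prime p \<and> s = 2 * q \<and> prime q \<and> (B \<or> p = 2 \<or> q = 2))"

lemma odd_double_dvd: "odd r \<Longrightarrow> even x \<Longrightarrow> int r dvd x \<longleftrightarrow> int (2 * r) dvd x" for x :: int
proof -
  assume r: "odd r" and x: "even x"
  have "coprime 2 (int r)" using r by simp
  then have "2 * int r dvd x" if "int r dvd x" using that x by (intro divides_mult)
  moreover have "int r dvd x" if "2 * int r dvd x" using that by (rule dvd_mult_right)
  ultimately show ?thesis by auto
qed

definition even_double :: "nat \<Rightarrow> nat" where
  "even_double r = (if even r then r else 2 * r)"

text \<open>With \<open>B\<close> or an even modulus, every kernel translation has two even entries,
  and an even number divisible by an odd r is divisible by 2r.\<close>

lemma lattice_cover_even_double: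
  assumes c: "lattice_cover B r s \<Gamma> G \<pi>" and par: "B \<or> even r \<or> even s"
  shows "lattice_cover B (even_double r) (even_double s) \<Gamma> G \<pi>"
proof (rule lattice_cover_change[OF c])
  let ?r = "even_double r" and ?s = "even_double s"
  fix x y :: int assume ev: "even (x + y)"
  have "even x \<and> even y" if "int r dvd x" "int s dvd y" "B \<longrightarrow> even x"
  proof -
    have "even x \<or> even y" using par that by (metis dvd_trans even_of_nat)
    then show ?thesis using ev by auto
  qed
  moreover have "even x \<and> even y" if "int ?r dvd x" "int ?s dvd y"
  proof -
    have "even ?r" "even ?s" by (simp_all add: even_double_def)
    then show ?thesis using that by (meson dvd_trans even_of_nat)
  qed
  moreover have "int r dvd x \<longleftrightarrow> int ?r dvd x" "int s dvd y \<longleftrightarrow> int ?s dvd y" if "even x \<and> even y"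
    using that odd_double_dvd[of r x] odd_double_dvd[of s y] unfolding even_double_def by auto
  ultimately show "(int r dvd x \<and> int s dvd y \<and> (B \<longrightarrow> even x)) \<longleftrightarrow> (int ?r dvd x \<and> int ?s dvd y \<and> (B \<longrightarrow> even x))"
    by blast
qed

lemma prime_of_divisors:
  fixes m :: nat
  assumes "2 \<le> m" "\<And>d. \<lbrakk>d dvd m; 2 \<le> d\<rbrakk> \<Longrightarrow> m dvd d"
  shows "prime m"
  unfolding prime_nat_iff
proof (intro conjI allI impI)
  show "1 < m" using assms(1) by simp
  fix d assume d: "d dvd m"
  then have "d \<noteq> 0" using assms(1) by (cases "d = 0") auto
  then have "2 \<le> d" if "d \<noteq> 1" using that by simp
  then show "d = 1 \<or> d = m" using assms(2)[OF d] dvd_antisym[OF d] by blast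
qed

text \<open>Each proper enlargement of the kernel with moduli at least 3 contradicts being basic.
  For even moduli a divisor d of r / 2 gives the modulus 2d, at least 4 once d is at least 2, so the
  halves must be prime.\<close>

lemma (in lattice_pair) basic_normal_form:
  assumes basic: "OG4_basic \<Gamma> G" and par: "(even r \<and> even s) \<or> (\<not> B \<and> odd r \<and> odd s)"
  shows "normal_form B r s"
  using par
proof
  assume ev: "even r \<and> even s"
  then obtain m n where mn: "r = 2 * m" "s = 2 * n" by (auto elim!: evenE)
  have "prime m"
  proof (rule prime_of_divisors)
    show "2 \<le> m" using mn r3 by simp
    fix d assume d: "d dvd m" "2 \<le> d"
    have "int r dvd int (2 * d) \<and> int s dvd 0"
      by (rule basic_kernel_maximal[OF basic, of "2 * d" s]) (use d mn s3 in simp_all)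
    then show "m dvd d" using mn(1) by (simp only: int_dvd_int_iff) simp
  qed
  moreover have "prime n"
  proof (rule prime_of_divisors)
    show "2 \<le> n" using mn s3 by simp
    fix d assume d: "d dvd n" "2 \<le> d"
    have "int r dvd 0 \<and> int s dvd int (2 * d)"
      by (rule basic_kernel_maximal[OF basic, of r "2 * d"]) (use d mn r3 in simp_all)
    then show "n dvd d" using mn(2) by (simp only: int_dvd_int_iff) simp
  qed
  moreover have "B \<or> m = 2 \<or> n = 2"
  proof (rule ccontr)
    assume ne: "\<not> ?thesis"
    then have "3 \<le> m" "3 \<le> n" using prime_ge_2_nat[OF \<open>prime m\<close>] prime_ge_2_nat[OF \<open>prime n\<close>] by linarith+
    moreover have "odd m" "odd n" using ne \<open>prime m\<close> \<open>prime n\<close> primes_dvd_imp_eq two_is_prime_nat by blast+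
    \<comment> \<open>The translation (m, n) has odd entries and even sum: it is admissible exactly
      without \<open>B\<close>, and it would enlarge the kernel of the moduli 2m and 2n.\<close>
    ultimately have "int r dvd int m \<and> int s dvd int n"
      using ne by (intro basic_kernel_maximal[OF basic, of m n]) (simp_all add: mn)
    then have "2 * m dvd m" using mn(1) by (simp only: int_dvd_int_iff)
    then show False using \<open>3 \<le> m\<close> by (auto dest: dvd_imp_le)
  qed
  ultimately show ?thesis using mn unfolding normal_form_def by blast
next
  assume od: "\<not> B \<and> odd r \<and> odd s"
  have "prime r"
  proof (rule prime_of_divisors)
    show "2 \<le> r" using r3 by simp
    fix d assume d: "d dvd r" "2 \<le> d"
    then have "odd d" using od by (meson dvd_trans)
    then have "3 \<le> d" using d(2) by (cases "d = 2") auto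
    \<comment> \<open>The witness is (2d, 0) since (d, 0) has odd sum; as r is odd, the factor 2 is
      removed afterwards.\<close>
    have "int r dvd int (2 * d) \<and> int s dvd 0"
      by (rule basic_kernel_maximal[OF basic, of d s]) (use d \<open>3 \<le> d\<close> s3 od in simp_all)
    then have "r dvd 2 * d" by (simp only: int_dvd_int_iff)
    moreover have "coprime r 2" using od by simp
    ultimately show "r dvd d" by (simp add: coprime_dvd_mult_right_iff)
  qed
  moreover have "prime s"
  proof (rule prime_of_divisors)
    show "2 \<le> s" using s3 by simp
    fix d assume d: "d dvd s" "2 \<le> d"
    then have "odd d" using od by (meson dvd_trans)
    then have "3 \<le> d" using d(2) by (cases "d = 2") auto
    have "int r dvd 0 \<and> int s dvd int (2 * d)"
      by (rule basic_kernel_maximal[OF basic, of r d]) (use d \<open>3 \<le> d\<close> r3 od in simp_all)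
    then have "s dvd 2 * d" by (simp only: int_dvd_int_iff)
    moreover have "coprime s 2" using od by simp
    ultimately show "s dvd d" by (simp add: coprime_dvd_mult_right_iff)
  qed
  ultimately show ?thesis using od unfolding normal_form_def by blast
qed

lemma basic_independent_cycle_type_iff:
  assumes pair: "graph_group_pair \<Gamma> G"
  shows "basic_independent_cycle_type \<Gamma> G \<longleftrightarrow> (\<exists>B r s \<pi>. normal_form B r s \<and> lattice_cover B r s \<Gamma> G \<pi>)"
proof
  interpret graph_grp \<Gamma> G by unfold_locales (rule pair)
  assume bic: "basic_independent_cycle_type \<Gamma> G"
  obtain B r s \<pi> where 1: "3 \<le> r" "3 \<le> s" "lattice_cover B r s \<Gamma> G \<pi>"
    using ex_lattice_cover_of_independent[OF bic] by blast
  have "\<exists>r' s'. 3 \<le> r' \<and> 3 \<le> s' \<and> lattice_cover B r' s' \<Gamma> G \<pi> \<and>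
    ((even r' \<and> even s') \<or> (\<not> B \<and> odd r' \<and> odd s'))"
  proof (cases "\<not> B \<and> odd r \<and> odd s")
    case True
    with 1 show ?thesis by blast
  next
    case False
    have "lattice_cover B (even_double r) (even_double s) \<Gamma> G \<pi>"
      using lattice_cover_even_double[OF 1(3)] False by blast
    moreover have "even (even_double r)" "even (even_double s)" "3 \<le> even_double r" "3 \<le> even_double s"
      using 1(1,2) by (simp_all add: even_double_def)
    ultimately show ?thesis by blast
  qed
  then obtain r' s' where 2: "3 \<le> r'" "3 \<le> s'" "lattice_cover B r' s' \<Gamma> G \<pi>"
    and par: "(even r' \<and> even s') \<or> (\<not> B \<and> odd r' \<and> odd s')" by blast
  interpret lattice_cover B r' s' \<Gamma> G \<pi> by (rule 2(3))
  interpret lattice_pair B r' s' \<Gamma> G \<pi> by unfold_locales (fact 2)+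
  have "OG4_basic \<Gamma> G" using bic by (simp add: basic_independent_cycle_type_def)
  from basic_normal_form[OF this par] 2(3)
  show "\<exists>B r s \<pi>. normal_form B r s \<and> lattice_cover B r s \<Gamma> G \<pi>" by blast
next
  interpret graph_grp \<Gamma> G by unfold_locales (rule pair)
  assume "\<exists>B r s \<pi>. normal_form B r s \<and> lattice_cover B r s \<Gamma> G \<pi>"
  then obtain B r s \<pi> where nf: "normal_form B r s" and c: "lattice_cover B r s \<Gamma> G \<pi>" by blast
  interpret lattice_cover B r s \<Gamma> G \<pi> by (rule c)
  have ge: "2 * p \<ge> 3" if "prime p" for p :: nat using prime_ge_2_nat[OF that] by simp
  have ge': "p \<ge> 3" if "prime p" "odd p" for p :: nat
    using prime_ge_2_nat[OF that(1)] that(2) by (cases "p = 2") auto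
  have "3 \<le> r" "3 \<le> s" using nf ge ge' unfolding normal_form_def by blast+
  then interpret lattice_pair B r s \<Gamma> G \<pi> by unfold_locales
  show "basic_independent_cycle_type \<Gamma> G"
    by (rule basic_independent_cycle_type) (use nf in \<open>simp add: normal_form_def\<close>)
qed

text \<open>The second alternative serves the models with an odd parameter whose kernel translations
  are those of the doubled parameter.\<close>

lemma basic_of_model:
  assumes "graph_group_pair \<Gamma> G" "pair_iso \<Gamma> G \<Delta> H" "lattice_cover B r s \<Delta> H \<rho>"
    and "normal_form B r s \<or> (normal_form B (even_double r) (even_double s) \<and> (B \<or> even r \<or> even s))"
  shows "basic_independent_cycle_type \<Gamma> G"
proof -
  obtain \<pi> where "lattice_cover B r s \<Gamma> G \<pi>" using lattice_cover_transport[OF assms(1-3)] by blast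
  with assms(4) lattice_cover_even_double show ?thesis
    unfolding basic_independent_cycle_type_iff[OF assms(1)] by blast
qed

theorem theorem1:
  fixes \<Gamma> :: "'a pair_pre_digraph" and G :: "('a \<Rightarrow> 'a) set"
  assumes "graph_group_pair \<Gamma> G"
  shows "basic_independent_cycle_type \<Gamma> G \<longleftrightarrow>
    (\<exists>p q :: nat. prime p \<and> odd p \<and> prime q \<and> odd q \<and>
      ((\<exists>(r, s) \<in> {(4, p), (p, 4), (p, q)}. pair_iso \<Gamma> G (Gam r s) (G_grp r s)) \<or>
       (\<exists>(r, s) \<in> {(4, 4), (4, 2 * p), (2 * p, 4)}.
          pair_iso \<Gamma> G (Gam_plus r s) (G_plus_grp r s)) \<or>
       (\<exists>(r, s) \<in> {(p, 4), (p, 2 * q)}. pair_iso \<Gamma> G (Gam r s) (H_grp r s)) \<or>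
       (\<exists>(r, s) \<in> {(4, 4), (4, 2 * p), (2 * p, 4), (2 * p, 2 * q)}.
          pair_iso \<Gamma> G (Gam_plus r s) (H_plus_grp r s)) \<or>
       pair_iso \<Gamma> G (Gam2 p q) (G2_grp p q)))"
    (is "?L \<longleftrightarrow> (\<exists>p q. prime p \<and> odd p \<and> prime q \<and> odd q \<and> ?R p q)")
proof
  \<comment> \<open>For moduli (4, 4) no odd prime occurs in the parameters; 3 fills the quantified
    p and q.\<close>
  have p3: "prime (3::nat)" "odd (3::nat)" by simp_all
  have odd2: "odd p" if "prime p" "p \<noteq> 2" for p :: nat
    using that primes_dvd_imp_eq two_is_prime_nat by blast
  assume ?L
  then obtain B r s \<pi> where nf: "normal_form B r s" and c: "lattice_cover B r s \<Gamma> G \<pi>"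
    using basic_independent_cycle_type_iff[OF assms] by blast
  \<comment> \<open>All even normal forms are realized by the plus models; together with (p, q) in
    the first family they suffice in this direction.\<close>
  have G_plus: "pair_iso \<Gamma> G (Gam_plus r s) (G_plus_grp r s)" if "even r" "even s" "0 < r" "0 < s" "\<not> B"
    using lattice_cover_unique[OF c, of "Gam_plus r s" "G_plus_grp r s"]
      lattice_cover_G_plus_grp[OF that(3,4,1,2)] that(5) by auto
  have H_plus: "pair_iso \<Gamma> G (Gam_plus r s) (H_plus_grp r s)" if "even r" "even s" "0 < r" "0 < s" "B"
    using lattice_cover_unique[OF c, of "Gam_plus r s" "H_plus_grp r s"]
      lattice_cover_H_plus_grp[OF that(3,4,1,2)] that(5) by auto
  from nf consider (odd) "\<not> B" "prime r" "odd r" "prime s" "odd s"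
    | (even) p q where "r = 2 * p" "prime p" "s = 2 * q" "prime q" "B \<or> p = 2 \<or> q = 2"
    unfolding normal_form_def by blast
  then show "\<exists>p q. prime p \<and> odd p \<and> prime q \<and> odd q \<and> ?R p q"
  proof cases
    case odd
    have "0 < r" "0 < s" using odd by (auto simp: prime_gt_0_nat)
    then have "pair_iso \<Gamma> G (Gam r s) (G_grp r s)"
      using lattice_cover_unique[OF c, of "Gam r s" "G_grp r s"] lattice_cover_G_grp[of r s] odd by auto
    with odd show ?thesis by blast
  next
    case even
    have pos: "0 < r" "0 < s" "even r" "even s" using even by (auto simp: prime_gt_0_nat)
    consider "p = 2" "q = 2" | "p = 2" "odd q" | "odd p" "q = 2" | "odd p" "odd q"
      using odd2 even by blast
    then show ?thesis
    proof cases
      case 1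
      with even have "r = 4" "s = 4" by simp_all
      then show ?thesis using G_plus H_plus pos p3 by (cases B) blast+
    next
      case 2
      with even have "r = 4" "s = 2 * q" "prime q" by simp_all
      then show ?thesis using G_plus H_plus pos \<open>odd q\<close> by (cases B) blast+
    next
      case 3
      with even have "r = 2 * p" "s = 4" "prime p" by simp_all
      then show ?thesis using G_plus H_plus pos \<open>odd p\<close> by (cases B) blast+
    next
      case 4
      with even have "B" by auto
      with H_plus[OF pos(3,4,1,2)] 4 even show ?thesis by blast
    qed
  qed
next
  assume "\<exists>p q. prime p \<and> odd p \<and> prime q \<and> odd q \<and> ?R p q"
  then obtain p q where p: "prime p" "odd p" and q: "prime q" "odd q" and R: "?R p q" by blast
  have pos: "0 < p" "0 < q" using p q by (simp_all add: prime_gt_0_nat)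
  have even: "normal_form B (2 * u) (2 * v)" if "prime u" "prime v" "B \<or> u = 2 \<or> v = 2" for B u v
    using that unfolding normal_form_def by blast
  have dbl: "even_double p = 2 * p" "even_double q = 2 * q" "even_double 4 = 4"
    "even_double (2 * u) = 2 * u" for u
    using p q by (simp_all add: even_double_def)
  note model = basic_of_model[OF assms]
  have G: ?L if rs: "(r, s) \<in> {(4, p), (p, 4), (p, q)}" and iso: "pair_iso \<Gamma> G (Gam r s) (G_grp r s)" for r s
  proof (rule model[OF iso lattice_cover_G_grp])
    have "normal_form False p q" using p q by (simp add: normal_form_def)
    then show "normal_form False r s \<or>
        (normal_form False (even_double r) (even_double s) \<and> (False \<or> even r \<or> even s))"
      using rs dbl even[of 2 p False] even[of p 2 False] p by auto
  qed (use rs p q pos in auto)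
  have Gp: ?L if rs: "(r, s) \<in> {(4, 4), (4, 2 * p), (2 * p, 4)}"
    and iso: "pair_iso \<Gamma> G (Gam_plus r s) (G_plus_grp r s)" for r s
  proof (rule model[OF iso lattice_cover_G_plus_grp])
    have "normal_form False r s" using rs even[of 2 2 False] even[of 2 p False] even[of p 2 False] p by auto
    then show "normal_form False r s \<or>
        (normal_form False (even_double r) (even_double s) \<and> (False \<or> even r \<or> even s))" ..
  qed (use rs pos in auto)
  have H: ?L if rs: "(r, s) \<in> {(p, 4), (p, 2 * q)}" and iso: "pair_iso \<Gamma> G (Gam r s) (H_grp r s)" for r s
  proof (rule model[OF iso lattice_cover_H_grp])
    have "normal_form True (even_double r) (even_double s)"
      using rs dbl even[of p 2 True] even[of p q True] p q by auto
    then show "normal_form True r s \<or>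
        (normal_form True (even_double r) (even_double s) \<and> (True \<or> even r \<or> even s))" by simp
  qed (use rs p pos in auto)
  have Hp: ?L if rs: "(r, s) \<in> {(4, 4), (4, 2 * p), (2 * p, 4), (2 * p, 2 * q)}"
    and iso: "pair_iso \<Gamma> G (Gam_plus r s) (H_plus_grp r s)" for r s
  proof (rule model[OF iso lattice_cover_H_plus_grp])
    have "normal_form True r s"
      using rs even[of 2 2 True] even[of 2 p True] even[of p 2 True] even[of p q True] p q by auto
    then show "normal_form True r s \<or>
        (normal_form True (even_double r) (even_double s) \<and> (True \<or> even r \<or> even s))" ..
  qed (use rs pos in auto)
  have G2: ?L if iso: "pair_iso \<Gamma> G (Gam2 p q) (G2_grp p q)"
  proof (rule model[OF iso lattice_cover_G2_grp])
    show "normal_form True p q \<or>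
        (normal_form True (even_double p) (even_double q) \<and> (True \<or> even p \<or> even q))"
      using dbl even[of p q True] p q by simp
  qed (use p q pos in auto)
  from R show ?L
    by (elim disjE bexE case_prodE; (simp only:)?) (erule (1) G Gp H Hp | erule G2)+
qed

end
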